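(* Let $s\in\mathbb{Z}$ and let $D\ge2$ be a fixed number of frequency channels $\nu_1,\dots,\nu_D$. Suppose that one observes on $\mathbb{S}^2$ the spin-$s$ fields $P_{\nu_r}(x)=P(x)+N_{\nu_r}(x)$, $r=1,\dots,D$, where $P,N_{\nu_1},\dots,N_{\nu_D}$ are independent zero-mean Gaussian isotropic spin-$s$ random fields. Assume that the angular power spectrum $(C_l)$ of $P$ satisfies $C_l=l^{-\alpha}g(l)>0$, $c_0^{-1}\le g(l)\le c_0$, $\alpha>2$, and for every $n\in\mathbb{N}$ there is $c_n>0$ with $|\frac{d^n}{du^n}g(u)|\le c_nu^{-n}$ for $u\in(|s|,\infty)$; and that for each $r$ the angular power spectrum $(C_{lN_r})$ of $N_{\nu_r}$ satisfies $C_{lN_r}=l^{-\gamma}g_{N_r}(l)>0$, $c_{0N}^{-1}\le g_{N_r}(l)\le c_{0N}$, $\gamma>2$, and for every $n\in\mathbb{N}$ there is $c_{nN}>0$ with $|\frac{d^n}{du^n}g_{N_r}(u)|\le c_{nN}u^{-n}$ for $u\in(|s|,\infty)$. Let $$\beta_{jk;sr}=\int_{\mathbb{S}^2}P_{\nu_r}\overline{\psi_{jk;s}}\,dx,\qquad \beta_{jk;sN_r}=\int_{\mathbb{S}^2}N_{\nu_r}\overline{\psi_{jk;s}}\,dx,$$ $$\widetilde{\Gamma}^{AP}_{j;s}:=\frac1D\sum_k\sum_{r=1}^D\big\{|\beta_{jk;sr}|^2-E|\beta_{jk;sN_r}|^2\big\},\qquad \widetilde{\Gamma}^{CP}_{j;s}:=\frac1{D(D-1)}\sum_k\sum_{r_1\ne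 r_2}\beta_{jk;sr_1}\overline{\beta_{jk;sr_2}} .$$ Then, as $j\to\infty$, $$\frac{\widetilde{\Gamma}^{CP}_{j;s}-\widetilde{\Gamma}^{AP}_{j;s}}{\sqrt{\mathrm{Var}\{\widetilde{\Gamma}^{CP}_{j;s}-\widetilde{\Gamma}^{AP}_{j;s}\}}}\longrightarrow_dN(0,1),\qquad\text{where}\quad \mathrm{Var}\{\widetilde{\Gamma}^{CP}_{j;s}-\widetilde{\Gamma}^{AP}_{j;s}\}=O\big(B^{2(1-\gamma)j}\big).$$
   Context: $dx$ is surface measure on the unit sphere $\mathbb{S}^2$. Spin harmonics. For $s\in\mathbb{Z}$, $l\ge|s|$, $m=-l,\dots,l$, in the fixed chart with spherical coordinates $(\vartheta,\varphi)$ on $\mathbb{S}^2\setminus\{\text{poles}\}$, the spin-$s$ spherical harmonics are $Y_{l;ms}(\vartheta,\varphi)=(-1)^m\sqrt{\frac{2l+1}{4\pi}}\,e^{im\varphi}d^l_{-m,s}(\vartheta)$, where $d^l_{mn}$ are the Wigner (small) $d$-functions, i.e. the Wigner matrices of $SO(3)$ are $D^l_{mn}(\alpha,\beta,\gamma)=e^{-im\alpha}d^l_{mn}(\beta)e^{-in\gamma}$. They are orthonormal in $L^2(\mathbb{S}^2)$ and $\sum_m|Y_{l;ms}|^2=\frac{2l+1}{4\pi}$. A change of chart only multiplies spin-$s$ quantities by a unimodular phase, so the quadratic quantities considered do not depend on the chart. Put $e_{ls}=(l-s)(l+s+1)$. Sums over $l$ run over $l\ge|s|$ (and $l\geq 1$).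 Spin needlets. Fix $B>1$ and a nonnegative $b\in C^\infty$ with compact support in $[1/B,B]$, and $\sum_{j\in\mathbb{Z}}b^2(u/B^j)=1$ for all $u>0$. For each $j\ge0$ there are finitely many cubature points $\xi_{jk}\in\mathbb{S}^2$ and weights $\lambda_{jk}>0$ (nested in $j$), with $\sum_k\lambda_{jk}=4\pi$ and $\sum_k\lambda_{jk}Y_{l;ms}(\xi_{jk})\overline{Y_{l';m's}(\xi_{jk})}=\delta_l^{l'}\delta_m^{m'}$ for all $l,l'$ with $\sqrt{e_{ls}},\sqrt{e_{l's}}\le B^{j+1}$; with constants independent of $j$, $cB^{-2j}\le\lambda_{jk}\le c'B^{-2j}$, the number of points is bounded above and below by constants times $B^{2j}$, distinct points are at distance $\ge\kappa'B^{-j}$, and each point of $\mathbb{S}^2$ is within $\kappa B^{-j}$ of some $\xi_{jk}$. The spin needlets are $\psi_{jk;s}(x)=\sqrt{\lambda_{jk}}\sum_l b\big(\frac{\sqrt{e_{ls}}}{B^j}\big)\sum_{m=-l}^lY_{l;ms}(x)\overline{Y_{l;ms}(\xi_{jk})}$. Sums over $k$ run over all cubature points of level $j$. Random fields. A Gaussian isotropic spin-$s$ field with (total) angular power spectrum $(C_l)$ is $\sum_{l}\sum_{m=-l}^l a_{l;ms}Y_{l;ms}$ (convergence in mean square), where $(a_{l;ms})$ are jointly Gaussian, zero-mean, complex with $E\,a_{l;ms}\overline{a_{l';m's}}=C_l\delta_l^{l'}\delta_m^{m'}$ and $E\,a_{l;ms}a_{l';m's}=0$. *)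

theory Defs
  imports "HOL-Probability.Probability" "HOL-Library.Landau_Symbols"
begin

definition sph_point :: "real \<Rightarrow> real \<Rightarrow> real ^ 3" where
  "sph_point \<theta> \<phi> = vector [sin \<theta> * cos \<phi>, sin \<theta> * sin \<phi>, cos \<theta>]"

definition colatitude :: "real ^ 3 \<Rightarrow> real" where
  "colatitude x = arccos (x $ 3)"

text \<open>At the two poles \<open>Arg 0 = 0\<close> picks \<open>\<phi> = 0\<close>, i.e. the frame carried along that meridian;
  any other choice changes spin-\<open>s\<close> quantities at the pole only by a unimodular factor.\<close>

definition longitude :: "real ^ 3 \<Rightarrow> real" where
  "longitude x = Arg (Complex (x $ 1) (x $ 2))"

text \<open>Surface measure, with area element \<open>sin \<theta> d\<theta> d\<phi>\<close>; its underlying space is the sphere.\<close>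

definition S2 :: "(real ^ 3) measure" where
  "S2 = distr
     (density (lborel :: (real \<times> real) measure)
       (\<lambda>(\<theta>, \<phi>). ennreal (sin \<theta>) * indicator ({0..pi} \<times> {-pi<..pi}) (\<theta>, \<phi>)))
     (restrict_space borel (sphere 0 1))
     (\<lambda>(\<theta>, \<phi>). sph_point \<theta> \<phi>)"

definition geodesic_dist :: "real ^ 3 \<Rightarrow> real ^ 3 \<Rightarrow> real" where
  "geodesic_dist x y = arccos (x \<bullet> y)"

text \<open>Wigner's formula for \<open>\<langle>l m| exp (- i \<beta> J\<^sub>y) |l n\<rangle>\<close>, so that
  \<open>D\<^sup>l\<^sub>m\<^sub>n(\<alpha>,\<beta>,\<gamma>) = exp (- i m \<alpha>) d\<^sup>l\<^sub>m\<^sub>n(\<beta>) exp (- i n \<gamma>)\<close> in the z-y-z convention.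
  The range of \<open>k\<close> is where all factorial arguments are nonnegative; the
  exponents are then nonnegative too, so that \<open>nat\<close> truncates nothing.\<close>

definition wigner_d :: "nat \<Rightarrow> int \<Rightarrow> int \<Rightarrow> real \<Rightarrow> real" where
  "wigner_d l m n \<beta> = (let L = int l in
     sqrt (fact (nat (L + m)) * fact (nat (L - m)) * fact (nat (L + n)) * fact (nat (L - n))) *
     (\<Sum>k\<in>{max 0 (n - m)..min (L + n) (L - m)}.
        (-1) ^ nat (m - n + k) *
        cos (\<beta> / 2) ^ nat (2 * L + n - m - 2 * k) * sin (\<beta> / 2) ^ nat (m - n + 2 * k) /
        (fact (nat (L + n - k)) * fact (nat k) * fact (nat (m - n + k)) * fact (nat (L - m - k)))))"

definition spin_harmonic :: "int \<Rightarrow> nat \<Rightarrow> int \<Rightarrow> real ^ 3 \<Rightarrow> complex" where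
  "spin_harmonic s l m x =
     of_real ((-1) powi m * sqrt ((2 * real l + 1) / (4 * pi)))
     * cis (of_int m * longitude x) * of_real (wigner_d l (- m) s (colatitude x))"

definition spin_eigenvalue :: "int \<Rightarrow> nat \<Rightarrow> real" where
  "spin_eigenvalue s l = of_int ((int l - s) * (int l + s + 1))"

definition multipoles :: "int \<Rightarrow> nat set" where
  "multipoles s = {l. \<bar>s\<bar> \<le> int l \<and> 1 \<le> l}"

definition smooth_on :: "real set \<Rightarrow> (real \<Rightarrow> real) \<Rightarrow> bool" where
  "smooth_on S f \<longleftrightarrow> (\<forall>n. \<forall>x\<in>S. (deriv ^^ n) f field_differentiable (at x))"

definition needlet_window :: "real \<Rightarrow> (real \<Rightarrow> real) \<Rightarrow> bool" where
  "needlet_window B b \<longleftrightarrow>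
     smooth_on UNIV b \<and> (\<forall>u. 0 \<le> b u) \<and> (\<forall>u. u \<notin> {1 / B..B} \<longrightarrow> b u = 0) \<and>
     (\<forall>u>0. ((\<lambda>j::int. (b (u / B powi j))\<^sup>2) has_sum 1) UNIV)"

text \<open>At level \<open>j\<close> the cubature points and weights are \<open>\<xi> j k\<close>, \<open>w j k\<close> with \<open>k < K j\<close>.\<close>

definition cubature_system ::
  "int \<Rightarrow> real \<Rightarrow> (nat \<Rightarrow> nat) \<Rightarrow> (nat \<Rightarrow> nat \<Rightarrow> real ^ 3) \<Rightarrow> (nat \<Rightarrow> nat \<Rightarrow> real) \<Rightarrow> bool" where
  "cubature_system s B K \<xi> w \<longleftrightarrow>
     (\<forall>j. \<forall>k<K j. \<xi> j k \<in> sphere 0 1 \<and> 0 < w j k) \<and>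
     (\<forall>j. \<xi> j ` {..<K j} \<subseteq> \<xi> (Suc j) ` {..<K (Suc j)}) \<and>
     (\<forall>j. (\<Sum>k<K j. w j k) = 4 * pi) \<and>
     (\<forall>j l l' m m'.
        \<bar>s\<bar> \<le> int l \<and> \<bar>s\<bar> \<le> int l' \<and> \<bar>m\<bar> \<le> int l \<and> \<bar>m'\<bar> \<le> int l' \<and>
        sqrt (spin_eigenvalue s l) \<le> B ^ (j + 1) \<and> sqrt (spin_eigenvalue s l') \<le> B ^ (j + 1) \<longrightarrow>
        (\<Sum>k<K j. of_real (w j k) * spin_harmonic s l m (\<xi> j k) * cnj (spin_harmonic s l' m' (\<xi> j k)))
          = (if l = l' \<and> m = m' then 1 else 0)) \<and>
     (\<exists>c>0. \<exists>c'>0. \<forall>j. \<forall>k<K j. c / B ^ (2 * j) \<le> w j k \<and> w j k \<le> c' / B ^ (2 * j)) \<and>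
     (\<exists>c>0. \<exists>c'>0. \<forall>j. c * B ^ (2 * j) \<le> real (K j) \<and> real (K j) \<le> c' * B ^ (2 * j)) \<and>
     (\<exists>\<kappa>'>0. \<forall>j. \<forall>k<K j. \<forall>k'<K j. k \<noteq> k' \<longrightarrow> \<kappa>' / B ^ j \<le> geodesic_dist (\<xi> j k) (\<xi> j k')) \<and>
     (\<exists>\<kappa>>0. \<forall>j. \<forall>x\<in>sphere 0 1. \<exists>k<K j. geodesic_dist x (\<xi> j k) \<le> \<kappa> / B ^ j)"

definition spin_needlet ::
  "int \<Rightarrow> real \<Rightarrow> (real \<Rightarrow> real) \<Rightarrow> (nat \<Rightarrow> nat \<Rightarrow> real ^ 3) \<Rightarrow> (nat \<Rightarrow> nat \<Rightarrow> real)
     \<Rightarrow> nat \<Rightarrow> nat \<Rightarrow> real ^ 3 \<Rightarrow> complex" where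
  "spin_needlet s B b \<xi> w j k x =
     of_real (sqrt (w j k)) *
     (\<Sum>\<^sub>\<infinity>l\<in>multipoles s. of_real (b (sqrt (spin_eigenvalue s l) / B ^ j)) *
        (\<Sum>m\<in>{- int l..int l}. spin_harmonic s l m x * cnj (spin_harmonic s l m (\<xi> j k))))"

definition gaussian_rv :: "'w measure \<Rightarrow> ('w \<Rightarrow> real) \<Rightarrow> bool" where
  "gaussian_rv M X \<longleftrightarrow>
     (\<exists>\<mu> \<sigma>. 0 < \<sigma> \<and> distributed M lborel X (normal_density \<mu> \<sigma>)) \<or>
     (\<exists>\<mu>. X \<in> borel_measurable M \<and> (AE \<omega> in M. X \<omega> = \<mu>))"

text \<open>Real linear combinations of real and imaginary parts are exactly the
  real parts of complex linear combinations.\<close>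

definition jointly_gaussian :: "'w measure \<Rightarrow> 'i set \<Rightarrow> ('i \<Rightarrow> 'w \<Rightarrow> complex) \<Rightarrow> bool" where
  "jointly_gaussian M I a \<longleftrightarrow>
     (\<forall>i\<in>I. a i \<in> borel_measurable M) \<and>
     (\<forall>J c. finite J \<and> J \<subseteq> I \<longrightarrow> gaussian_rv M (\<lambda>\<omega>. Re (\<Sum>i\<in>J. c i * a i \<omega>)))"

definition multipole_indices :: "int \<Rightarrow> (nat \<times> int) set" where
  "multipole_indices s = (SIGMA l : multipoles s. {- int l..int l})"

definition gaussian_spin_coefficients ::
  "'w measure \<Rightarrow> int \<Rightarrow> (nat \<Rightarrow> real) \<Rightarrow> (nat \<times> int \<Rightarrow> 'w \<Rightarrow> complex) \<Rightarrow> bool" where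
  "gaussian_spin_coefficients M s C a \<longleftrightarrow>
     jointly_gaussian M (multipole_indices s) a \<and>
     (\<forall>i\<in>multipole_indices s. (\<integral>\<omega>. a i \<omega> \<partial>M) = 0) \<and>
     (\<forall>i\<in>multipole_indices s. \<forall>i'\<in>multipole_indices s.
        (\<integral>\<omega>. a i \<omega> * cnj (a i' \<omega>) \<partial>M) = (if i = i' then of_real (C (fst i)) else 0) \<and>
        (\<integral>\<omega>. a i \<omega> * a i' \<omega> \<partial>M) = 0)"

text \<open>The expansion converges in mean square, i.e. in \<open>L\<^sup>2(\<Omega> \<times> S\<^sup>2)\<close>.\<close>

definition gaussian_isotropic_spin_field ::
  "'w measure \<Rightarrow> int \<Rightarrow> (nat \<Rightarrow> real) \<Rightarrow> ('w \<Rightarrow> real ^ 3 \<Rightarrow> complex) \<Rightarrow> bool" where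
  "gaussian_isotropic_spin_field M s C T \<longleftrightarrow>
     (\<lambda>(\<omega>, x). T \<omega> x) \<in> borel_measurable (M \<Otimes>\<^sub>M S2) \<and>
     (\<exists>a. gaussian_spin_coefficients M s C a \<and>
        (\<lambda>L. \<integral>\<^sup>+ (\<omega>, x). ennreal ((cmod (T \<omega> x -
                (\<Sum>l\<in>{l \<in> multipoles s. l \<le> L}. \<Sum>m\<in>{- int l..int l}.
                   a (l, m) \<omega> * spin_harmonic s l m x)))\<^sup>2) \<partial>(M \<Otimes>\<^sub>M S2))
          \<longlonglongrightarrow> 0)"

definition regular_spectrum :: "int \<Rightarrow> real \<Rightarrow> (nat \<Rightarrow> real) \<Rightarrow> bool" where
  "regular_spectrum s \<alpha> C \<longleftrightarrow>
     (\<exists>g :: real \<Rightarrow> real.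
        (\<forall>l\<in>multipoles s. C l = real l powr (- \<alpha>) * g (real l) \<and> 0 < C l) \<and>
        (\<exists>c\<^sub>0>0. \<forall>l\<in>multipoles s. 1 / c\<^sub>0 \<le> g (real l) \<and> g (real l) \<le> c\<^sub>0) \<and>
        smooth_on {of_int \<bar>s\<bar><..} g \<and>
        (\<forall>n::nat. \<exists>c>0. \<forall>u\<in>{of_int \<bar>s\<bar><..}. \<bar>(deriv ^^ n) g u\<bar> \<le> c / u ^ n))"

text \<open>Independence as random elements of the space of functions on the sphere
  with its cylinder sigma-algebra; index \<open>0\<close> is the signal \<open>P\<close>, index \<open>r \<ge> 1\<close> the noise \<open>N r\<close>.\<close>

definition independent_signal_noise ::
  "'w measure \<Rightarrow> nat \<Rightarrow> ('w \<Rightarrow> real ^ 3 \<Rightarrow> complex) \<Rightarrow> (nat \<Rightarrow> 'w \<Rightarrow> real ^ 3 \<Rightarrow> complex) \<Rightarrow> bool" where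
  "independent_signal_noise M D P N \<longleftrightarrow>
     prob_space.indep_vars M (\<lambda>_. \<Pi>\<^sub>M x\<in>sphere 0 1. borel)
       (\<lambda>r \<omega>. restrict (if r = 0 then P \<omega> else N r \<omega>) (sphere 0 1)) {0..D}"

definition field_coefficient ::
  "('w \<Rightarrow> real ^ 3 \<Rightarrow> complex) \<Rightarrow> (nat \<Rightarrow> nat \<Rightarrow> real ^ 3 \<Rightarrow> complex) \<Rightarrow> nat \<Rightarrow> nat \<Rightarrow> 'w \<Rightarrow> complex" where
  "field_coefficient T \<psi> j k \<omega> = (\<integral>x. T \<omega> x * cnj (\<psi> j k x) \<partial>S2)"

definition Gamma_AP ::
  "'w measure \<Rightarrow> nat \<Rightarrow> (nat \<Rightarrow> nat) \<Rightarrow> (nat \<Rightarrow> nat \<Rightarrow> real ^ 3 \<Rightarrow> complex)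
     \<Rightarrow> ('w \<Rightarrow> real ^ 3 \<Rightarrow> complex) \<Rightarrow> (nat \<Rightarrow> 'w \<Rightarrow> real ^ 3 \<Rightarrow> complex) \<Rightarrow> nat \<Rightarrow> 'w \<Rightarrow> real" where
  "Gamma_AP M D K \<psi> P N j \<omega> =
     1 / real D * (\<Sum>k<K j. \<Sum>r\<in>{1..D}.
        (cmod (field_coefficient (\<lambda>\<omega> x. P \<omega> x + N r \<omega> x) \<psi> j k \<omega>))\<^sup>2
        - (\<integral>\<omega>'. (cmod (field_coefficient (N r) \<psi> j k \<omega>'))\<^sup>2 \<partial>M))"

definition Gamma_CP_complex ::
  "nat \<Rightarrow> (nat \<Rightarrow> nat) \<Rightarrow> (nat \<Rightarrow> nat \<Rightarrow> real ^ 3 \<Rightarrow> complex)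
     \<Rightarrow> ('w \<Rightarrow> real ^ 3 \<Rightarrow> complex) \<Rightarrow> (nat \<Rightarrow> 'w \<Rightarrow> real ^ 3 \<Rightarrow> complex) \<Rightarrow> nat \<Rightarrow> 'w \<Rightarrow> complex" where
  "Gamma_CP_complex D K \<psi> P N j \<omega> =
     1 / (of_nat D * (of_nat D - 1)) * (\<Sum>k<K j. \<Sum>r\<^sub>1\<in>{1..D}. \<Sum>r\<^sub>2\<in>{1..D} - {r\<^sub>1}.
        field_coefficient (\<lambda>\<omega> x. P \<omega> x + N r\<^sub>1 \<omega> x) \<psi> j k \<omega> *
        cnj (field_coefficient (\<lambda>\<omega> x. P \<omega> x + N r\<^sub>2 \<omega> x) \<psi> j k \<omega>))"

text \<open>The summands for \<open>(r\<^sub>1, r\<^sub>2)\<close> and \<open>(r\<^sub>2, r\<^sub>1)\<close> are conjugate, so taking the real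
  part discards nothing (lemma \<open>of_real_Gamma_CP\<close>).\<close>

definition Gamma_CP ::
  "nat \<Rightarrow> (nat \<Rightarrow> nat) \<Rightarrow> (nat \<Rightarrow> nat \<Rightarrow> real ^ 3 \<Rightarrow> complex)
     \<Rightarrow> ('w \<Rightarrow> real ^ 3 \<Rightarrow> complex) \<Rightarrow> (nat \<Rightarrow> 'w \<Rightarrow> real ^ 3 \<Rightarrow> complex) \<Rightarrow> nat \<Rightarrow> 'w \<Rightarrow> real" where
  "Gamma_CP D K \<psi> P N j \<omega> = Re (Gamma_CP_complex D K \<psi> P N j \<omega>)"

lemma cross_sum_cnj:
  fixes z :: "nat \<Rightarrow> complex"
  shows "cnj (\<Sum>p\<in>A. \<Sum>q\<in>A - {p}. z p * cnj (z q)) = (\<Sum>p\<in>A. \<Sum>q\<in>A - {p}. z p * cnj (z q))"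
proof (cases "finite A")
  case True
  have eq: "A - {p} = {q \<in> A. q \<noteq> p}" for p by auto
  have "(\<Sum>p\<in>A. \<Sum>q\<in>{q \<in> A. q \<noteq> p}. z q * cnj (z p)) = (\<Sum>p\<in>A. \<Sum>q\<in>{q \<in> A. p \<noteq> q}. z p * cnj (z q))"
    using True by (rule sum.swap_restrict[OF _ True])
  then show ?thesis
    unfolding eq by (simp add: mult.commute neq_commute)
qed simp

lemma of_real_Gamma_CP:
  "of_real (Gamma_CP D K \<psi> P N j \<omega>) = Gamma_CP_complex D K \<psi> P N j \<omega>"
proof -
  have "cnj (Gamma_CP_complex D K \<psi> P N j \<omega>) = Gamma_CP_complex D K \<psi> P N j \<omega>"
    unfolding Gamma_CP_complex_def complex_cnj_mult cnj_sum[of _ "{..<K j}"] cross_sum_cnj by simp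
  then show ?thesis
    by (simp add: Gamma_CP_def complex_eq_iff)
qed

end

(*
  Write V(z) = sum_r |z_r|^2 - |sum_r z_r|^2 / D for the squared deviation over channels. Pathwise,
  the difference of the cross and auto estimators is - sum_k V(beta_k) / (D - 1) plus a constant.
  V is invariant under shifts, so the signal P drops out, and the exactness of the cubature turns the
  sum over k into sum_(l,m) b_l^2 V(a_lm), where the a_lm are the harmonic coefficients of the noises.
  Their real and imaginary parts are independent centred Gaussians, so this is a weighted sum of about
  B^(2j) independent centred sample variances, each of variance comparable to B^(-2 gamma j), and
  Lyapunov's condition holds.

  Identifying the pathwise integrals against Y_lm with the coefficients a_lm needs the orthonormality
  of the spin harmonics. It is read off the cubature: the rule is eventually exact for the products
  with m = l or m = -l, whose integrals are Beta integrals, and these products generate all monomials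
  in cos^2(theta/2) and sin^2(theta/2).
*)

theory Submission
  imports Defs
begin

section \<open>A central limit theorem for triangular arrays\<close>

text \<open>The independence hypothesis shapes the probabilistic part. It concerns the
  sigma-algebras generated by the point values of the fields, while the statistics are built from
  integrals over the sphere. Joint measurability refers to the full sigma-algebra of
  \<open>M\<close>, so such an integral need not be measurable for the point values; it is shown to
  agree almost surely with a variable that is. The coefficients \<open>a\<close> of the mean-square
  expansion come from an existential statement and carry no independence across channels by
  themselves; they inherit it by being almost surely equal to these integrals. Within a channel,
  independence comes from the Gaussian law. Both sources meet in one joint characteristic function,
  which factorises over channels, multipoles, and real and imaginary parts. Since the uniqueness
  theorem is applied in dimension one only, passing from this factorisation to independence takes
  its own argument. The limit theorem asks for fourth moments of the summands, hence eighth moments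
  of Gaussians.\<close>

context prob_space begin

lemma square_integrable_of_fourth:
  fixes X :: "'a \<Rightarrow> real"
  assumes [measurable]: "X \<in> borel_measurable M" and X4: "integrable M (\<lambda>\<omega>. X \<omega> ^ 4)"
  shows "integrable M (\<lambda>\<omega>. (X \<omega>)\<^sup>2)" "integrable M X"
    "(expectation (\<lambda>\<omega>. (X \<omega>)\<^sup>2))\<^sup>2 \<le> expectation (\<lambda>\<omega>. X \<omega> ^ 4)"
proof -
  have eq: "((X \<omega>)\<^sup>2)\<^sup>2 = X \<omega> ^ 4" for \<omega> by simp
  show X2: "integrable M (\<lambda>\<omega>. (X \<omega>)\<^sup>2)"
    by (rule square_integrable_imp_integrable) (use X4 in \<open>simp_all add: eq\<close>)
  then show "integrable M X"
    by (rule square_integrable_imp_integrable[rotated]) simp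
  have "0 \<le> variance (\<lambda>\<omega>. (X \<omega>)\<^sup>2)"
    by (rule variance_positive)
  also have "\<dots> = expectation (\<lambda>\<omega>. X \<omega> ^ 4) - (expectation (\<lambda>\<omega>. (X \<omega>)\<^sup>2))\<^sup>2"
    by (subst variance_eq) (use X2 X4 in \<open>simp_all add: eq\<close>)
  finally show "(expectation (\<lambda>\<omega>. (X \<omega>)\<^sup>2))\<^sup>2 \<le> expectation (\<lambda>\<omega>. X \<omega> ^ 4)" by simp
qed

text \<open>Only even moments are controlled later, so the cubic term is traded by
  \<open>2 * |x|^3 <= \<epsilon> * x^2 + x^4 / \<epsilon>\<close>, a perfect square.
  \<open>\<epsilon>\<close> stays free so that one value, fitted to the totals of a row, serves all
  its summands, including those with vanishing moments.\<close>

lemma char_fourth_moment_bound: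
  fixes X :: "'a \<Rightarrow> real"
  assumes [measurable]: "X \<in> borel_measurable M" and X4: "integrable M (\<lambda>\<omega>. X \<omega> ^ 4)"
    and mean: "expectation X = 0" and "0 < \<epsilon>"
  defines "v \<equiv> expectation (\<lambda>\<omega>. (X \<omega>)\<^sup>2)" and "f \<equiv> expectation (\<lambda>\<omega>. X \<omega> ^ 4)"
  shows "cmod (char (distr M borel X) t - exp (- (t\<^sup>2 * v / 2)))
    \<le> \<bar>t\<bar> ^ 3 / 12 * (\<epsilon> * v + f / \<epsilon>) + t ^ 4 * f / 8"
proof -
  note sq = square_integrable_of_fourth[OF assms(1) X4]
  have v: "0 \<le> v" unfolding v_def by simp
  have "cmod (char (distr M borel X) t - (1 - t\<^sup>2 * v / 2))
    \<le> (t\<^sup>2 / 6) * expectation (\<lambda>\<omega>. min (6 * (X \<omega>)\<^sup>2) (\<bar>t\<bar> * \<bar>X \<omega>\<bar> ^ 3))"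
    by (rule char_approx3'[OF assms(1) sq(2) sq(1) mean _ refl]) (simp add: mean v_def)
  also have "expectation (\<lambda>\<omega>. min (6 * (X \<omega>)\<^sup>2) (\<bar>t\<bar> * \<bar>X \<omega>\<bar> ^ 3))
     \<le> expectation (\<lambda>\<omega>. \<bar>t\<bar> / 2 * (\<epsilon> * (X \<omega>)\<^sup>2 + X \<omega> ^ 4 / \<epsilon>))"
  proof (rule integral_mono)
    show "integrable M (\<lambda>\<omega>. min (6 * (X \<omega>)\<^sup>2) (\<bar>t\<bar> * \<bar>X \<omega>\<bar> ^ 3))"
      by (rule Bochner_Integration.integrable_bound[where f="\<lambda>\<omega>. 6 * (X \<omega>)\<^sup>2"]) (use sq in auto)
    show "integrable M (\<lambda>\<omega>. \<bar>t\<bar> / 2 * (\<epsilon> * (X \<omega>)\<^sup>2 + X \<omega> ^ 4 / \<epsilon>))"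
      using sq X4 by auto
    fix \<omega>
    have "2 * \<bar>X \<omega>\<bar> ^ 3 \<le> \<epsilon> * (X \<omega>)\<^sup>2 + X \<omega> ^ 4 / \<epsilon>"
    proof -
      define a where "a = \<bar>X \<omega>\<bar>"
      have "\<epsilon> * a\<^sup>2 + a ^ 4 / \<epsilon> - 2 * a ^ 3 = a\<^sup>2 * (\<epsilon> - a)\<^sup>2 / \<epsilon>"
        using \<open>0 < \<epsilon>\<close> by (simp add: field_simps power2_eq_square power3_eq_cube power4_eq_xxxx)
      moreover have "0 \<le> a\<^sup>2 * (\<epsilon> - a)\<^sup>2 / \<epsilon>" using \<open>0 < \<epsilon>\<close> by simp
      ultimately show ?thesis by (simp add: a_def)
    qed
    then have "\<bar>t\<bar> / 2 * (2 * \<bar>X \<omega>\<bar> ^ 3) \<le> \<bar>t\<bar> / 2 * (\<epsilon> * (X \<omega>)\<^sup>2 + X \<omega> ^ 4 / \<epsilon>)"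
      by (intro mult_left_mono) auto
    then show "min (6 * (X \<omega>)\<^sup>2) (\<bar>t\<bar> * \<bar>X \<omega>\<bar> ^ 3) \<le> \<bar>t\<bar> / 2 * (\<epsilon> * (X \<omega>)\<^sup>2 + X \<omega> ^ 4 / \<epsilon>)"
      by simp
  qed
  also have "\<dots> = \<bar>t\<bar> / 2 * (\<epsilon> * v + f / \<epsilon>)"
    using sq X4 by (simp add: v_def f_def)
  finally have 1: "cmod (char (distr M borel X) t - (1 - t\<^sup>2 * v / 2)) \<le> t\<^sup>2 / 6 * (\<bar>t\<bar> / 2 * (\<epsilon> * v + f / \<epsilon>))"
    by (simp add: mult_left_mono)
  \<comment> \<open>Second-order Taylor expansion with remainder \<open>exp z * y^2 / 2\<close>; the
    intermediate point is not positive, so \<open>exp z <= 1\<close>.\<close>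
  have "\<bar>exp (- y) - (1 - y)\<bar> \<le> y\<^sup>2 / 2" if "0 \<le> y" for y :: real
  proof (cases "y = 0")
    case False
    with that have "0 < y" by simp
    obtain z where "exp (- y) = (\<Sum>m<2. (- y) ^ m / fact m) + exp z / fact 2 * (- y) ^ 2" "\<bar>z\<bar> \<le> \<bar>- y\<bar>" "z \<le> 0"
    proof -
      have "\<exists>z. - y < z \<and> z < 0 \<and> exp (- y) = (\<Sum>m<2. exp 0 / fact m * (- y) ^ m) + exp z / fact 2 * (- y) ^ 2"
        by (rule Maclaurin_minus[where diff="\<lambda>_. exp"]) (use \<open>0 < y\<close> in \<open>auto intro: DERIV_exp\<close>)
      then show ?thesis using that by force
    qed
    then have E: "exp (- y) - (1 - y) = exp z * y\<^sup>2 / 2" and "exp z \<le> 1"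
      by (simp_all add: eval_nat_numeral)
    show ?thesis
      unfolding E using mult_right_mono[OF \<open>exp z \<le> 1\<close>, of "y\<^sup>2"] by (simp add: abs_mult)
  qed simp
  from this[of "t\<^sup>2 * v / 2"] have "\<bar>exp (- (t\<^sup>2 * v / 2)) - (1 - t\<^sup>2 * v / 2)\<bar> \<le> (t\<^sup>2 * v / 2)\<^sup>2 / 2"
    using v by simp
  also have "\<dots> = t ^ 4 * v\<^sup>2 / 8"
    by (simp add: power2_eq_square power4_eq_xxxx)
  \<comment> \<open>Jensen's inequality \<open>v^2 <= f\<close>, which keeps the error linear in the
    fourth moment.\<close>
  also have "\<dots> \<le> t ^ 4 * f / 8"
    using sq(3) by (simp add: v_def f_def mult_left_mono)
  finally have 2: "cmod (exp (- (t\<^sup>2 * v / 2)) - (1 - t\<^sup>2 * v / 2)) \<le> t ^ 4 * f / 8"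
    unfolding of_real_diff[symmetric] norm_of_real .
  have "cmod (char (distr M borel X) t - exp (- (t\<^sup>2 * v / 2)))
    \<le> cmod (char (distr M borel X) t - (1 - t\<^sup>2 * v / 2)) + cmod (exp (- (t\<^sup>2 * v / 2)) - (1 - t\<^sup>2 * v / 2))"
    using norm_triangle_ineq4[of "char (distr M borel X) t - (1 - t\<^sup>2 * v / 2)"
        "exp (- (t\<^sup>2 * v / 2)) - (1 - t\<^sup>2 * v / 2)"] by simp
  also have "\<dots> \<le> t\<^sup>2 / 6 * (\<bar>t\<bar> / 2 * (\<epsilon> * v + f / \<epsilon>)) + t ^ 4 * f / 8"
    using 1 2 by (rule add_mono)
  also have "t\<^sup>2 / 6 * (\<bar>t\<bar> / 2 * (\<epsilon> * v + f / \<epsilon>)) = \<bar>t\<bar> ^ 3 / 12 * (\<epsilon> * v + f / \<epsilon>)"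
  proof -
    have "t\<^sup>2 = \<bar>t\<bar>\<^sup>2" by simp
    then show ?thesis by (simp only: power2_eq_square power3_eq_cube) simp
  qed
  finally show ?thesis .
qed

text \<open>The index set and the laws may change with the row, as they do with the needlet level.
  Products of numbers of modulus at most one differ by at most the sum of the differences of their
  factors, so the errors of the summands add up. With one \<open>\<epsilon>\<close> per row the
  total is \<open>|t|^3 / 6 * sqrt r + t^4 / 8 * r\<close>, where \<open>r\<close> is the ratio
  \<open>F n / (V n)^2\<close>, and Levy's continuity theorem concludes.\<close>

theorem lyapunov_central_limit:
  fixes X :: "nat \<Rightarrow> 'i \<Rightarrow> 'a \<Rightarrow> real"
  assumes fin: "\<And>n. finite (I n)"
    and indep: "\<And>n. indep_vars (\<lambda>_. borel) (X n) (I n)"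
    and X4: "\<And>n i. i \<in> I n \<Longrightarrow> integrable M (\<lambda>\<omega>. X n i \<omega> ^ 4)"
    and mean: "\<And>n i. i \<in> I n \<Longrightarrow> expectation (X n i) = 0"
  defines "V \<equiv> \<lambda>n. \<Sum>i\<in>I n. expectation (\<lambda>\<omega>. (X n i \<omega>)\<^sup>2)"
    and "F \<equiv> \<lambda>n. \<Sum>i\<in>I n. expectation (\<lambda>\<omega>. X n i \<omega> ^ 4)"
  assumes pos: "eventually (\<lambda>n. 0 < V n) sequentially"
    and lyapunov: "(\<lambda>n. F n / (V n)\<^sup>2) \<longlonglongrightarrow> 0"
  shows "weak_conv_m (\<lambda>n. distr M borel (\<lambda>\<omega>. (\<Sum>i\<in>I n. X n i \<omega>) / sqrt (V n))) std_normal_distribution"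
proof (rule levy_continuity)
  have [measurable]: "i \<in> I n \<Longrightarrow> X n i \<in> borel_measurable M" for n i
    using indep[of n] by (auto simp: indep_vars_def)
  show "real_distribution (distr M borel (\<lambda>\<omega>. (\<Sum>i\<in>I n. X n i \<omega>) / sqrt (V n)))" for n
    by (rule real_distribution_distr) measurable
  show "real_distribution std_normal_distribution"
    by (rule real_dist_normal_dist)
  fix t
  let ?L = "\<lambda>n. F n / (V n)\<^sup>2"
  have bound: "cmod (char (distr M borel (\<lambda>\<omega>. (\<Sum>i\<in>I n. X n i \<omega>) / sqrt (V n))) t - exp (- (t\<^sup>2 / 2)))
      \<le> \<bar>t\<bar> ^ 3 / 6 * sqrt (?L n) + t ^ 4 * ?L n / 8" if V: "0 < V n" for n
  proof -
    \<comment> \<open>Moves the normalisation from the variable to the argument of the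
      characteristic function, so that the summands keep their laws.\<close>
    define \<tau> where "\<tau> = t / sqrt (V n)"
    let ?v = "\<lambda>i. expectation (\<lambda>\<omega>. (X n i \<omega>)\<^sup>2)" and ?f = "\<lambda>i. expectation (\<lambda>\<omega>. X n i \<omega> ^ 4)"
    \<comment> \<open>Needed for a positive \<open>\<epsilon>\<close>: if all fourth moments
      vanished, so would all second moments, against \<open>V n > 0\<close>.\<close>
    have "F n > 0"
    proof (rule ccontr)
      assume "\<not> 0 < F n"
      moreover have f: "0 \<le> ?f i" for i by (rule Bochner_Integration.integral_nonneg) simp
      ultimately have "F n = 0" unfolding F_def by (meson linorder_neqE_linordered_idom sum_nonneg not_less)
      then have "?f i = 0" if "i \<in> I n" for i
        using f fin that unfolding F_def by (subst (asm) sum_nonneg_eq_0_iff) auto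
      then have "?v i = 0" if "i \<in> I n" for i
        using square_integrable_of_fourth(3)[OF _ X4, of n i] that by simp
      then show False using V unfolding V_def by simp
    qed
    \<comment> \<open>Balances the two terms: \<open>\<epsilon> * V n\<close> and
      \<open>F n / \<epsilon>\<close> both equal \<open>sqrt (F n * V n)\<close>.\<close>
    define \<epsilon> where "\<epsilon> = sqrt (F n / V n)"
    have \<epsilon>: "0 < \<epsilon>" using \<open>F n > 0\<close> V by (simp add: \<epsilon>_def)
    have "char (distr M borel (\<lambda>\<omega>. (\<Sum>i\<in>I n. X n i \<omega>) / sqrt (V n))) t
        = char (distr M borel (\<lambda>\<omega>. \<Sum>i\<in>I n. X n i \<omega>)) \<tau>"
      unfolding char_def by (subst (1 2) integral_distr) (auto simp: \<tau>_def field_simps)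
    also have "\<dots> = (\<Prod>i\<in>I n. char (distr M borel (X n i)) \<tau>)"
      by (rule char_distr_sum[OF indep])
    finally have 1: "char (distr M borel (\<lambda>\<omega>. (\<Sum>i\<in>I n. X n i \<omega>) / sqrt (V n))) t = \<dots>" .
    have "- (t\<^sup>2 / 2) = (\<Sum>i\<in>I n. - (\<tau>\<^sup>2 * ?v i / 2))"
    proof -
      have "(\<Sum>i\<in>I n. - (\<tau>\<^sup>2 * ?v i / 2)) = - (\<tau>\<^sup>2 * V n / 2)"
        unfolding V_def by (simp add: sum_negf sum_distrib_left sum_divide_distrib)
      also have "\<dots> = - (t\<^sup>2 / 2)" using V by (simp add: \<tau>_def power_divide)
      finally show ?thesis ..
    qed
    then have "exp (- (t\<^sup>2 / 2)) = (\<Prod>i\<in>I n. exp (- (\<tau>\<^sup>2 * ?v i / 2)))"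
      by (simp only: exp_sum[OF fin])
    then have "complex_of_real (exp (- (t\<^sup>2 / 2))) = (\<Prod>i\<in>I n. complex_of_real (exp (- (\<tau>\<^sup>2 * ?v i / 2))))"
      by (simp only: of_real_prod)
    then have "cmod (char (distr M borel (\<lambda>\<omega>. (\<Sum>i\<in>I n. X n i \<omega>) / sqrt (V n))) t - complex_of_real (exp (- (t\<^sup>2 / 2))))
       \<le> (\<Sum>i\<in>I n. cmod (char (distr M borel (X n i)) \<tau> - complex_of_real (exp (- (\<tau>\<^sup>2 * ?v i / 2)))))"
      unfolding 1
      by (simp only:) (intro norm_prod_diff real_distribution.cmod_char_le_1 real_distribution_distr;
          force intro!: mult_nonneg_nonneg)
    also have "\<dots> \<le> (\<Sum>i\<in>I n. \<bar>\<tau>\<bar> ^ 3 / 12 * (\<epsilon> * ?v i + ?f i / \<epsilon>) + \<tau> ^ 4 * ?f i / 8)"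
    proof (rule sum_mono)
      fix i assume i: "i \<in> I n"
      then show "cmod (char (distr M borel (X n i)) \<tau> - complex_of_real (exp (- (\<tau>\<^sup>2 * ?v i / 2))))
        \<le> \<bar>\<tau>\<bar> ^ 3 / 12 * (\<epsilon> * ?v i + ?f i / \<epsilon>) + \<tau> ^ 4 * ?f i / 8"
        using char_fourth_moment_bound[OF _ X4[OF i] mean[OF i] \<epsilon>, of \<tau>] by (simp add: exp_of_real)
    qed
    also have "\<dots> = \<bar>\<tau>\<bar> ^ 3 / 12 * (\<epsilon> * V n + F n / \<epsilon>) + \<tau> ^ 4 * F n / 8"
      unfolding V_def F_def
      by (simp only: sum.distrib sum_distrib_left sum_divide_distrib distrib_left)
    also have "\<epsilon> * V n + F n / \<epsilon> = 2 * sqrt (F n * V n)"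
    proof -
      have "\<epsilon> * V n = sqrt (F n * V n)"
        using V by (simp add: \<epsilon>_def real_sqrt_divide real_sqrt_mult field_simps)
      moreover have "F n / \<epsilon> = sqrt (F n * V n)"
        using V \<open>F n > 0\<close> by (simp add: \<epsilon>_def real_sqrt_divide real_sqrt_mult field_simps)
      ultimately show ?thesis by simp
    qed
    also have "\<bar>\<tau>\<bar> ^ 3 / 12 * (2 * sqrt (F n * V n)) = \<bar>t\<bar> ^ 3 / 6 * sqrt (?L n)"
    proof -
      have "sqrt (V n) ^ 3 = V n * sqrt (V n)" using V by (simp add: power3_eq_cube)
      then show ?thesis using V
        by (simp add: \<tau>_def power_divide real_sqrt_divide real_sqrt_mult abs_divide field_simps)
    qed
    also have "\<tau> ^ 4 * F n / 8 = t ^ 4 * ?L n / 8"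
    proof -
      have "sqrt (V n) ^ 4 = (V n)\<^sup>2" using V by (simp add: power4_eq_xxxx power2_eq_square)
      then show ?thesis by (simp add: \<tau>_def power_divide)
    qed
    finally show ?thesis by (simp add: exp_of_real)
  qed
  have "(\<lambda>n. \<bar>t\<bar> ^ 3 / 6 * sqrt (?L n) + t ^ 4 * ?L n / 8) \<longlonglongrightarrow> \<bar>t\<bar> ^ 3 / 6 * sqrt 0 + t ^ 4 * 0 / 8"
    by (intro tendsto_intros lyapunov) simp
  then have lim: "(\<lambda>n. \<bar>t\<bar> ^ 3 / 6 * sqrt (?L n) + t ^ 4 * ?L n / 8) \<longlonglongrightarrow> 0" by simp
  have "(\<lambda>n. char (distr M borel (\<lambda>\<omega>. (\<Sum>i\<in>I n. X n i \<omega>) / sqrt (V n))) t - exp (- (t\<^sup>2 / 2))) \<longlonglongrightarrow> 0"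
    by (rule Lim_null_comparison[OF eventually_mono[OF pos bound] lim])
  then show "(\<lambda>n. char (distr M borel (\<lambda>\<omega>. (\<Sum>i\<in>I n. X n i \<omega>) / sqrt (V n))) t) \<longlonglongrightarrow> char std_normal_distribution t"
    by (simp add: char_std_normal_distribution LIM_zero_iff exp_of_real[symmetric])
qed

end

section \<open>Independence from characteristic functions\<close>

context prob_space begin

lemma integrable_of_norm_bound:
  fixes f :: "'a \<Rightarrow> 'b::{banach, second_countable_topology}"
  assumes [measurable]: "f \<in> borel_measurable M" and "\<And>\<omega>. norm (f \<omega>) \<le> c"
  shows "integrable M f"
  by (rule integrable_const_bound[of _ c]) (use assms in auto)

text \<open>\<open>W + 2\<close> is positive, so it reweights \<open>M\<close> to a probability measure, to which the uniqueness theorem applies.\<close>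

lemma real_weight_decouples:
  fixes W X :: "'a \<Rightarrow> real"
  assumes [measurable]: "W \<in> borel_measurable M" "X \<in> borel_measurable M" "A \<in> sets borel"
    and W: "\<And>\<omega>. \<bar>W \<omega>\<bar> \<le> 1"
    and char: "\<And>t. expectation (\<lambda>\<omega>. of_real (W \<omega>) * iexp (t * X \<omega>)) = of_real (expectation W)
        * expectation (\<lambda>\<omega>. iexp (t * X \<omega>))"
  shows "expectation (\<lambda>\<omega>. W \<omega> * indicator A (X \<omega>)) = expectation W * prob (X -` A \<inter> space M)"
proof -
  have iW: "integrable M W" by (rule integrable_of_norm_bound[where c=1]) (use W in auto)
  \<comment> \<open>\<open>W\<close> is at least -1, so the unnormalised density
    \<open>W + 2\<close> is at least 1 and its mass \<open>c\<close> is positive.\<close>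
  define c where "c = expectation (\<lambda>\<omega>. W \<omega> + 2)"
  have c: "c = expectation W + 2" using iW by (simp add: c_def prob_space)
  have "- 1 \<le> expectation W"
    by (rule integral_ge_const[OF iW]) (use W in \<open>auto simp: abs_le_iff\<close>)
  then have "0 < c" using c by linarith
  define Q where "Q = density M (\<lambda>\<omega>. ennreal ((W \<omega> + 2) / c))"
  have nonneg: "0 \<le> (W \<omega> + 2) / c" for \<omega>
    using W[of \<omega>] \<open>0 < c\<close> by (auto simp: abs_le_iff intro!: divide_nonneg_pos)
  have [measurable]: "X \<in> borel_measurable Q" unfolding Q_def by simp
  have "prob_space Q"
  proof
    have "emeasure Q (space Q) = (\<integral>\<^sup>+\<omega>. ennreal ((W \<omega> + 2) / c) \<partial>M)"
      unfolding Q_def by (subst emeasure_density) (auto intro!: nn_integral_cong)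
    also have "\<dots> = ennreal (expectation (\<lambda>\<omega>. (W \<omega> + 2) / c))"
      by (rule nn_integral_eq_integral) (use iW nonneg in auto)
    also have "expectation (\<lambda>\<omega>. (W \<omega> + 2) / c) = 1"
      using \<open>0 < c\<close> by (simp add: c_def)
    finally show "emeasure Q (space Q) = 1" by simp
  qed
  then interpret Q: prob_space Q .
  \<comment> \<open>By hypothesis the characteristic function of \<open>X\<close> under
    \<open>Q\<close> is \<open>((c - 2) + 2) / c\<close> times the one under
    \<open>M\<close>.\<close>
  have "char (distr Q borel X) = char (distr M borel X)"
  proof
    fix t
    have "char (distr Q borel X) t = (CLINT \<omega>|Q. iexp (t * X \<omega>))"
      unfolding char_def by (subst integral_distr) auto
    also have "\<dots> = (CLINT \<omega>|M. ((W \<omega> + 2) / c) *\<^sub>R iexp (t * X \<omega>))"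
      unfolding Q_def by (rule integral_density) (use nonneg in auto)
    also have "\<dots> = (CLINT \<omega>|M. (1 / c) *\<^sub>R (of_real (W \<omega>) * iexp (t * X \<omega>) + 2 * iexp (t * X \<omega>)))"
      by (intro Bochner_Integration.integral_cong) (simp_all add: scaleR_conv_of_real algebra_simps add_divide_distrib)
    also have "\<dots> = (1 / c) *\<^sub>R (expectation (\<lambda>\<omega>. of_real (W \<omega>) * iexp (t * X \<omega>)) + 2
        * expectation (\<lambda>\<omega>. iexp (t * X \<omega>)))"
    proof -
      have "integrable M (\<lambda>\<omega>. of_real (W \<omega>) * iexp (t * X \<omega>))"
        by (rule integrable_of_norm_bound[where c=1]) (use W in \<open>auto simp: norm_mult\<close>)
      moreover have "integrable M (\<lambda>\<omega>. iexp (t * X \<omega>))"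
        by (rule integrable_of_norm_bound[where c=1]) auto
      ultimately show ?thesis by simp
    qed
    also have "\<dots> = expectation (\<lambda>\<omega>. iexp (t * X \<omega>))"
    proof -
      have "complex_of_real (expectation W) = of_real c - 2" by (simp add: c)
      then show ?thesis
        unfolding char using \<open>0 < c\<close> by (simp add: scaleR_conv_of_real left_diff_distrib)
    qed
    also have "\<dots> = char (distr M borel X) t"
      unfolding char_def by (subst integral_distr) auto
    finally show "char (distr Q borel X) t = char (distr M borel X) t" .
  qed
  then have eq: "distr Q borel X = distr M borel X"
    by (intro Levy_uniqueness Q.real_distribution_distr real_distribution_distr) auto
  \<comment> \<open>Equality of the two laws of \<open>X\<close>, tested on \<open>A\<close>; the
    contribution of the constant 2 is subtracted afterwards.\<close>
  have "expectation (\<lambda>\<omega>. (W \<omega> + 2) / c * indicator A (X \<omega>)) = (LINT \<omega>|Q. indicator A (X \<omega>))"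
    unfolding Q_def by (subst integral_density) (use nonneg in auto)
  also have "\<dots> = (LINT x|distr Q borel X. indicator A x)"
    by (subst integral_distr) auto
  also have "\<dots> = (LINT \<omega>|M. indicator A (X \<omega>))"
    unfolding eq by (subst integral_distr) auto
  finally have *: "expectation (\<lambda>\<omega>. (W \<omega> + 2) / c * indicator A (X \<omega>)) = expectation (\<lambda>\<omega>. indicator A (X \<omega>))" .
  have p: "expectation (\<lambda>\<omega>. indicator A (X \<omega>)) = prob (X -` A \<inter> space M)"
  proof -
    have "expectation (\<lambda>\<omega>. indicator A (X \<omega>)) = expectation (indicat_real (X -` A \<inter> space M))"
      by (intro Bochner_Integration.integral_cong) (auto simp: indicator_def)
    then show ?thesis by simp
  qed
  have "(\<lambda>\<omega>. (W \<omega> + 2) / c * indicator A (X \<omega>)) = (\<lambda>\<omega>. (1 / c) * (W \<omega> * indicator A (X \<omega>) + 2 * indicator A (X \<omega>)))"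
    by (auto simp: field_simps)
  moreover have "integrable M (\<lambda>\<omega>. W \<omega> * indicator A (X \<omega>))"
    by (rule integrable_of_norm_bound[where c=1]) (use W in \<open>auto simp: indicator_def\<close>)
  moreover have "integrable M (\<lambda>\<omega>. indicator A (X \<omega>) :: real)"
    by (rule integrable_of_norm_bound[where c=1]) (auto simp: indicator_def)
  ultimately have "(1 / c) * (expectation (\<lambda>\<omega>. W \<omega> * indicator A (X \<omega>)) + 2 * expectation (\<lambda>\<omega>. indicator A (X \<omega>)))
     = expectation (\<lambda>\<omega>. indicator A (X \<omega>))"
    using * by simp
  then have "expectation (\<lambda>\<omega>. W \<omega> * indicator A (X \<omega>)) = (c - 2) * expectation (\<lambda>\<omega>. indicator A (X \<omega>))"
    using \<open>0 < c\<close> by (simp add: field_simps)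
  then show ?thesis using p c by simp
qed

text \<open>Both parts of \<open>W\<close> are combinations of \<open>W\<close> and its conjugate,
  and the hypothesis for the conjugate at \<open>t\<close> is the conjugate of the hypothesis at
  \<open>- t\<close>. Complex weights are needed because in the induction below the weight contains
  the exponentials of the variables not yet treated.\<close>

lemma complex_weight_decouples:
  fixes W :: "'a \<Rightarrow> complex" and X :: "'a \<Rightarrow> real"
  assumes [measurable]: "W \<in> borel_measurable M" "X \<in> borel_measurable M" "A \<in> sets borel"
    and W: "\<And>\<omega>. cmod (W \<omega>) \<le> 1"
    and char: "\<And>t. expectation (\<lambda>\<omega>. W \<omega> * iexp (t * X \<omega>)) = expectation W * expectation (\<lambda>\<omega>. iexp (t * X \<omega>))"
  shows "expectation (\<lambda>\<omega>. W \<omega> * indicator A (X \<omega>)) = expectation W * prob (X -` A \<inter> space M)"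
proof -
  let ?E = "\<lambda>t. expectation (\<lambda>\<omega>. iexp (t * X \<omega>))"
  have iW: "integrable M W" by (rule integrable_of_norm_bound[where c=1]) (use W in auto)
  have i1: "integrable M (\<lambda>\<omega>. W \<omega> * iexp (t * X \<omega>))" for t
    by (rule integrable_of_norm_bound[where c=1]) (use W in \<open>auto simp: norm_mult\<close>)
  have [measurable]: "(\<lambda>\<omega>. cnj (W \<omega>)) \<in> borel_measurable M"
    by (rule borel_measurable_continuous_on[OF _ assms(1)]) (intro continuous_intros)
  have i2: "integrable M (\<lambda>\<omega>. cnj (W \<omega>) * iexp (t * X \<omega>))" for t
    by (rule integrable_of_norm_bound[where c=1]) (use W in \<open>auto simp: norm_mult\<close>)
  have cnjW: "expectation (\<lambda>\<omega>. cnj (W \<omega>) * iexp (t * X \<omega>)) = cnj (expectation W) * ?E t" for t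
  proof -
    have "expectation (\<lambda>\<omega>. cnj (W \<omega>) * iexp (t * X \<omega>)) = expectation (\<lambda>\<omega>. cnj (W \<omega> * iexp ((- t) * X \<omega>)))"
      by (intro Bochner_Integration.integral_cong) (simp_all add: exp_cnj)
    also have "\<dots> = cnj (expectation W * ?E (- t))"
      unfolding Bochner_Integration.integral_cnj char ..
    also have "\<dots> = cnj (expectation W) * cnj (?E (- t))" by simp
    also have "cnj (?E (- t)) = expectation (\<lambda>\<omega>. cnj (iexp ((- t) * X \<omega>)))"
      unfolding Bochner_Integration.integral_cnj ..
    also have "\<dots> = ?E t"
      by (intro Bochner_Integration.integral_cong) (simp_all add: exp_cnj)
    finally show ?thesis by simp
  qed
  have re: "expectation (\<lambda>\<omega>. Re (W \<omega>) * indicator A (X \<omega>)) = expectation (\<lambda>\<omega>. Re (W \<omega>)) * prob (X -` A \<inter> space M)"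
  proof (rule real_weight_decouples)
    show "\<bar>Re (W \<omega>)\<bar> \<le> 1" for \<omega> using W[of \<omega>] abs_Re_le_cmod[of "W \<omega>"] by linarith
    fix t
    have "expectation (\<lambda>\<omega>. of_real (Re (W \<omega>)) * iexp (t * X \<omega>))
        = expectation (\<lambda>\<omega>. (W \<omega> * iexp (t * X \<omega>) + cnj (W \<omega>) * iexp (t * X \<omega>)) / 2)"
      by (intro Bochner_Integration.integral_cong refl)
        (simp only: distrib_right[symmetric] complex_add_cnj, simp)
    also have "\<dots> = (expectation W + cnj (expectation W)) / 2 * ?E t"
      using i1[of t] i2[of t] by (simp add: char cnjW algebra_simps add_divide_distrib del: of_real_mult)
    also have "(expectation W + cnj (expectation W)) / 2 = of_real (expectation (\<lambda>\<omega>. Re (W \<omega>)))"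
      using iW by (simp only: complex_add_cnj) simp
    finally show "expectation (\<lambda>\<omega>. of_real (Re (W \<omega>)) * iexp (t * X \<omega>)) = of_real (expectation (\<lambda>\<omega>. Re (W \<omega>))) * ?E t" .
  qed auto
  have im: "expectation (\<lambda>\<omega>. Im (W \<omega>) * indicator A (X \<omega>)) = expectation (\<lambda>\<omega>. Im (W \<omega>)) * prob (X -` A \<inter> space M)"
  proof (rule real_weight_decouples)
    show "\<bar>Im (W \<omega>)\<bar> \<le> 1" for \<omega> using W[of \<omega>] abs_Im_le_cmod[of "W \<omega>"] by linarith
    fix t
    have cancel_i: "of_real (2 * y) * \<i> * e / (2 * \<i>) = of_real y * e" for y e
      by (rule nonzero_divide_eq_eq[THEN iffD2]) (simp_all add: mult_ac)
    have "expectation (\<lambda>\<omega>. of_real (Im (W \<omega>)) * iexp (t * X \<omega>))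
        = expectation (\<lambda>\<omega>. (W \<omega> * iexp (t * X \<omega>) - cnj (W \<omega>) * iexp (t * X \<omega>)) / (2 * \<i>))"
      by (intro Bochner_Integration.integral_cong refl)
        (simp only: left_diff_distrib[symmetric] complex_diff_cnj cancel_i)
    also have "\<dots> = (expectation W - cnj (expectation W)) / (2 * \<i>) * ?E t"
      using i1[of t] i2[of t] by (simp add: char cnjW algebra_simps diff_divide_distrib del: of_real_mult)
    also have "(expectation W - cnj (expectation W)) / (2 * \<i>) = of_real (expectation (\<lambda>\<omega>. Im (W \<omega>)))"
      using iW by (simp only: complex_diff_cnj) (simp add: complex_eq_iff)
    finally show "expectation (\<lambda>\<omega>. of_real (Im (W \<omega>)) * iexp (t * X \<omega>)) = of_real (expectation (\<lambda>\<omega>. Im (W \<omega>))) * ?E t" .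
  qed auto
  have iA: "integrable M (\<lambda>\<omega>. W \<omega> * indicator A (X \<omega>))"
    by (rule integrable_of_norm_bound[where c=1]) (use W in \<open>auto simp: norm_mult indicator_def\<close>)
  have R: "Re (expectation (\<lambda>\<omega>. W \<omega> * indicator A (X \<omega>))) = expectation (\<lambda>\<omega>. Re (W \<omega>) * indicator A (X \<omega>))"
    using iA by (subst integral_Re[symmetric]) (auto intro!: Bochner_Integration.integral_cong simp: indicator_def)
  have I: "Im (expectation (\<lambda>\<omega>. W \<omega> * indicator A (X \<omega>))) = expectation (\<lambda>\<omega>. Im (W \<omega>) * indicator A (X \<omega>))"
    using iA by (subst integral_Im[symmetric]) (auto intro!: Bochner_Integration.integral_cong simp: indicator_def)
  show ?thesis
    using re im iW by (simp add: complex_eq_iff R I)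
qed

text \<open>Indicators replace exponentials one variable at a time.\<close>

theorem indep_vars_of_char_prod:
  fixes X :: "'i \<Rightarrow> 'a \<Rightarrow> real"
  assumes fin: "finite I" and rv: "\<And>i. i \<in> I \<Longrightarrow> X i \<in> borel_measurable M"
    and char: "\<And>t. expectation (\<lambda>\<omega>. iexp (\<Sum>i\<in>I. t i * X i \<omega>)) = (\<Prod>i\<in>I. expectation (\<lambda>\<omega>. iexp (t i * X i \<omega>)))"
  shows "indep_vars (\<lambda>_. borel) X I"
proof -
  note rv[measurable]
  let ?E = "\<lambda>i t. expectation (\<lambda>\<omega>. iexp (t * X i \<omega>))"
  \<comment> \<open>Interpolates between the hypothesis (\<open>J\<close> empty) and the product
    formula for events (\<open>J = I\<close>). \<open>t\<close> stays arbitrary, since the step for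
    \<open>k\<close> uses the induction hypothesis with every value of the \<open>k\<close>-th
    entry.\<close>
  have main: "expectation (\<lambda>\<omega>. (\<Prod>i\<in>J. indicator (A i) (X i \<omega>)) * iexp (\<Sum>i\<in>I - J. t i * X i \<omega>))
      = (\<Prod>i\<in>J. of_real (prob (X i -` A i \<inter> space M))) * (\<Prod>i\<in>I - J. ?E i (t i))"
    if J: "J \<subseteq> I" and A: "\<And>i. i \<in> I \<Longrightarrow> A i \<in> sets borel" for J A t
  proof -
    have "finite J" using J fin by (rule finite_subset)
    from this J show ?thesis
    proof (induction J arbitrary: t rule: finite_induct)
      case empty
      then show ?case using char by simp
    next
      case (insert k J)
      then have k: "k \<in> I" "k \<notin> J" "J \<subseteq> I" by auto
      note A[measurable]
      define W where "W \<omega> = (\<Prod>i\<in>J. indicator (A i) (X i \<omega>)) * iexp (\<Sum>i\<in>I - insert k J. t i * X i \<omega>)" for \<omega>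
      have [measurable]: "W \<in> borel_measurable M"
      proof -
        have "(\<lambda>\<omega>. \<Prod>i\<in>J. indicator (A i) (X i \<omega>) :: complex) \<in> borel_measurable M"
          using k by (intro borel_measurable_prod) (auto intro!: measurable_compose[OF rv] borel_measurable_indicator A)
        moreover have "(\<lambda>\<omega>. iexp (\<Sum>i\<in>I - insert k J. t i * X i \<omega>)) \<in> borel_measurable M"
          by measurable
        ultimately show ?thesis unfolding W_def by (rule borel_measurable_times)
      qed
      have W1: "cmod (W \<omega>) \<le> 1" for \<omega>
        unfolding W_def norm_mult norm_exp_i_times mult_1_right
        by (subst prod_norm[symmetric]) (intro prod_le_1, auto simp: indicator_def)
      have WE: "expectation (\<lambda>\<omega>. W \<omega> * iexp (u * X k \<omega>))
          = (\<Prod>i\<in>J. of_real (prob (X i -` A i \<inter> space M))) * (\<Prod>i\<in>I - insert k J. ?E i (t i)) * ?E k u" for u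
      proof -
        have eq: "I - J = insert k (I - insert k J)" using k by auto
        have "(\<Sum>i\<in>I - J. (t(k := u)) i * X i \<omega>) = (\<Sum>i\<in>I - insert k J. t i * X i \<omega>) + u * X k \<omega>" for \<omega>
          unfolding eq using fin by (subst sum.insert) (auto intro!: sum.cong)
        then have "W \<omega> * iexp (u * X k \<omega>) = (\<Prod>i\<in>J. indicator (A i) (X i \<omega>)) * iexp (\<Sum>i\<in>I - J. (t(k := u)) i
            * X i \<omega>)" for \<omega>
          unfolding W_def by (simp only: of_real_add distrib_left exp_add mult.assoc)
        then have "expectation (\<lambda>\<omega>. W \<omega> * iexp (u * X k \<omega>)) = (\<Prod>i\<in>J. of_real (prob (X i -` A i \<inter> space M)))
            * (\<Prod>i\<in>I - J. ?E i ((t(k := u)) i))"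
          using insert.IH[of "t(k := u)"] k by simp
        also have "(\<Prod>i\<in>I - J. ?E i ((t(k := u)) i)) = ?E k u * (\<Prod>i\<in>I - insert k J. ?E i (t i))"
          unfolding eq using fin by (subst prod.insert) (auto intro!: prod.cong)
        finally show ?thesis by (simp add: mult_ac)
      qed
      \<comment> \<open>The value \<open>u = 0\<close> gives the mean of \<open>W\<close>; with it,
        \<open>WE\<close> is the factorisation that \<open>complex_weight_decouples\<close> asks
        for.\<close>
      have E0: "expectation W = (\<Prod>i\<in>J. of_real (prob (X i -` A i \<inter> space M))) * (\<Prod>i\<in>I - insert k J. ?E i (t i))"
        using WE[of 0] by (simp add: prob_space)
      have "expectation (\<lambda>\<omega>. W \<omega> * indicator (A k) (X k \<omega>)) = expectation W * prob (X k -` A k \<inter> space M)"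
        by (rule complex_weight_decouples) (use k A W1 WE E0 in auto)
      moreover have "W \<omega> * indicator (A k) (X k \<omega>) = (\<Prod>i\<in>insert k J. indicator (A i) (X i \<omega>)) * iexp (\<Sum>i\<in>I
          - insert k J. t i * X i \<omega>)" for \<omega>
        unfolding W_def using insert.hyps by (simp add: mult_ac)
      ultimately show ?case using insert.hyps by (simp add: E0 mult_ac)
    qed
  qed
  show ?thesis
  proof (cases "I = {}")
    case True
    then show ?thesis by (simp add: indep_vars_def indep_sets_def)
  next
    case False
    have gen: "sets borel = sigma_sets (space borel) (sets (borel :: real measure))"
      by (metis sets.sigma_sets_eq)
    have "(\<forall>A\<in>(\<Pi> i\<in>I. sets borel). prob (\<Inter>j\<in>I. X j -` A j \<inter> space M) = (\<Prod>j\<in>I. prob (X j -` A j \<inter> space M)))"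
    proof
      fix A :: "'i \<Rightarrow> real set" assume A: "A \<in> (\<Pi> i\<in>I. sets borel)"
      have "expectation (\<lambda>\<omega>. (\<Prod>i\<in>I. indicator (A i) (X i \<omega>)) :: complex)
          = (\<Prod>i\<in>I. of_real (prob (X i -` A i \<inter> space M)))"
        using main[of I A "\<lambda>_. 0"] A by auto
      moreover have "expectation (\<lambda>\<omega>. (\<Prod>i\<in>I. indicator (A i) (X i \<omega>)) :: complex)
         = of_real (expectation (indicator (\<Inter>j\<in>I. X j -` A j \<inter> space M)))"
      proof (subst integral_complex_of_real[symmetric], intro Bochner_Integration.integral_cong refl)
        fix \<omega> assume "\<omega> \<in> space M"
        show "(\<Prod>i\<in>I. indicator (A i) (X i \<omega>)) = complex_of_real (indicator (\<Inter>j\<in>I. X j -` A j \<inter> space M) \<omega>)"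
        proof (cases "\<forall>i\<in>I. X i \<omega> \<in> A i")
          case True
          then show ?thesis using \<open>\<omega> \<in> space M\<close> by (auto simp: indicator_def)
        next
          case F: False
          then show ?thesis using fin by (auto simp: indicator_def)
        qed
      qed
      moreover have "(\<Inter>j\<in>I. X j -` A j \<inter> space M) \<in> events"
        using A fin False by (intro sets.finite_INT) (auto intro!: measurable_sets[OF rv])
      ultimately show "prob (\<Inter>j\<in>I. X j -` A j \<inter> space M) = (\<Prod>j\<in>I. prob (X j -` A j \<inter> space M))"
        by (simp flip: of_real_prod)
    qed
    then show ?thesis
      using indep_vars_finite[OF False fin gen, of X] rv by (auto simp: Int_stable_def)
  qed
qed

end

section \<open>Integrals of random functions and the sigma-algebras that determine them\<close>

context prob_space begin

text \<open>The conditional expectation given \<open>F\<close> leaves every \<open>G \<cdot> x\<close> fixed, hence also the integral over \<open>x\<close>.\<close>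

lemma integral_of_adapted_process:
  fixes G :: "'a \<Rightarrow> 'b \<Rightarrow> real"
  assumes "finite_measure S" and sub: "subalgebra M F"
    and G: "integrable (M \<Otimes>\<^sub>M S) (\<lambda>(\<omega>, x). G \<omega> x)"
    and adapted: "\<And>x. x \<in> space S \<Longrightarrow> (\<lambda>\<omega>. G \<omega> x) \<in> borel_measurable F"
  obtains R where "R \<in> borel_measurable F" "AE \<omega> in M. (LINT x|S. G \<omega> x) = R \<omega>"
proof -
  interpret S: finite_measure S by fact
  interpret pair_sigma_finite M S ..
  interpret finite_measure_subalgebra M F by unfold_locales (rule sub)
  define R where "R \<omega> = (LINT x|S. G \<omega> x)" for \<omega>
  have iR: "integrable M R"
    using integrable_fst'[OF G] by (simp add: R_def[abs_def])
  then have [measurable]: "R \<in> borel_measurable M" by simp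
  let ?R' = "real_cond_exp M F R"
  have iR': "integrable M ?R'" by (rule real_cond_exp_int(1)[OF iR])
  have Gm [measurable]: "(\<lambda>(\<omega>, x). G \<omega> x) \<in> borel_measurable (M \<Otimes>\<^sub>M S)"
    using G by simp
  have swap: "(LINT \<omega>|M. q \<omega> * R \<omega>) = (LINT x|S. LINT \<omega>|M. q \<omega> * G \<omega> x)"
    if [measurable]: "q \<in> borel_measurable M" and q: "\<And>\<omega>. \<bar>q \<omega>\<bar> \<le> 1" for q
  proof -
    have "integrable (M \<Otimes>\<^sub>M S) (\<lambda>(\<omega>, x). q \<omega> * G \<omega> x)"
      by (rule Bochner_Integration.integrable_bound[OF G])
        (use q in \<open>auto simp: abs_mult case_prod_unfold mult_left_le_one_le\<close>)
    from Fubini_integral[OF this] show ?thesis by (simp add: R_def)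
  qed
  \<comment> \<open>The two variables are compared through integrals over all events of
    \<open>M\<close>, not only those of \<open>F\<close>: they are to be equal, not merely to have
    the same conditional expectation.\<close>
  have "AE \<omega> in M. R \<omega> = ?R' \<omega>"
  proof (rule density_unique_real[OF iR iR'])
    fix A assume A [measurable]: "A \<in> sets M"
    let ?c = "real_cond_exp M F (indicator A)"
    \<comment> \<open>A version of the conditional expectation of the indicator with values in [0,1]
      everywhere, because \<open>swap\<close> asks for a bound at every point.\<close>
    define p where "p \<omega> = max 0 (min 1 (?c \<omega>))" for \<omega>
    have pF [measurable]: "p \<in> borel_measurable F" unfolding p_def by measurable
    have pM [measurable]: "p \<in> borel_measurable M" by (rule measurable_from_subalg[OF sub pF])
    have p1: "\<bar>p \<omega>\<bar> \<le> 1" for \<omega> by (auto simp: p_def)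
    have iA: "integrable M (indicat_real A)" by (rule integrable_real_indicator) (auto simp: less_top[symmetric])
    have "AE \<omega> in M. 0 \<le> ?c \<omega>" by (rule real_cond_exp_pos) auto
    moreover have "AE \<omega> in M. ?c \<omega> \<le> 1"
      by (rule real_cond_exp_le_c[OF iA]) (auto simp: indicator_def)
    ultimately have cp: "AE \<omega> in M. ?c \<omega> = p \<omega>"
      by eventually_elim (auto simp: p_def)
    have "AE x in S. integrable M (\<lambda>\<omega>. G \<omega> x)"
      using AE_integrable_snd[OF G] by simp
    then have inner: "AE x in S. (LINT \<omega>|M. indicator A \<omega> * G \<omega> x) = (LINT \<omega>|M. p \<omega> * G \<omega> x)"
      using AE_space
    proof eventually_elim
      case (elim x)
      have [measurable]: "(\<lambda>\<omega>. G \<omega> x) \<in> borel_measurable F" using adapted elim(2) .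
      have "integrable M (\<lambda>\<omega>. G \<omega> x * indicator A \<omega>)"
        using integrable_mult_indicator[OF A elim(1)] by (simp add: mult.commute)
      then have "(LINT \<omega>|M. G \<omega> x * ?c \<omega>) = (LINT \<omega>|M. G \<omega> x * indicator A \<omega>)"
        by (rule real_cond_exp_intg(2)) auto
      moreover have "(LINT \<omega>|M. G \<omega> x * ?c \<omega>) = (LINT \<omega>|M. G \<omega> x * p \<omega>)"
        using elim(1) cp by (intro integral_cong_AE) auto
      ultimately show ?case by (simp add: mult.commute)
    qed
    have "(LINT \<omega>:A|M. R \<omega>) = (LINT x|S. LINT \<omega>|M. indicator A \<omega> * G \<omega> x)"
      unfolding set_lebesgue_integral_def by (subst swap[symmetric]) (auto simp: indicator_def)
    also have "\<dots> = (LINT x|S. LINT \<omega>|M. p \<omega> * G \<omega> x)"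
      by (rule integral_cong_AE[OF _ _ inner]) measurable
    also have "\<dots> = (LINT \<omega>|M. p \<omega> * R \<omega>)"
      by (rule swap[symmetric]) (auto simp: p1)
    also have "\<dots> = (LINT \<omega>|M. p \<omega> * ?R' \<omega>)"
    proof (rule real_cond_exp_intg(2)[symmetric])
      show "integrable M (\<lambda>\<omega>. p \<omega> * R \<omega>)"
        by (rule Bochner_Integration.integrable_bound[OF iR]) (use p1 in \<open>auto simp: abs_mult mult_left_le_one_le\<close>)
    qed auto
    also have "\<dots> = (LINT \<omega>|M. ?R' \<omega> * ?c \<omega>)"
      using cp by (intro integral_cong_AE) auto
    also have "\<dots> = (LINT \<omega>|M. ?R' \<omega> * indicator A \<omega>)"
    proof (rule real_cond_exp_intg(2))
      show "integrable M (\<lambda>\<omega>. ?R' \<omega> * indicator A \<omega>)"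
        using integrable_mult_indicator[OF A iR'] by (simp add: mult.commute)
    qed auto
    also have "\<dots> = (LINT \<omega>:A|M. ?R' \<omega>)"
      unfolding set_lebesgue_integral_def by (simp add: mult.commute)
    finally show "(LINT \<omega>:A|M. R \<omega>) = (LINT \<omega>:A|M. ?R' \<omega>)" .
  qed
  then show ?thesis
    by (intro that[of ?R']) (auto simp: R_def)
qed

text \<open>The variables to which this is applied come from a conditional expectation: they are
  measurable for the sigma-algebra generated by \<open>X i\<close> but are not given as explicit
  functions of \<open>X i\<close>. Their preimages form subfamilies of those of \<open>X i\<close>,
  and independence passes to subfamilies.\<close>

lemma indep_vars_vimage_algebra:
  assumes "indep_vars M' X I"
    and Y: "\<And>i. i \<in> I \<Longrightarrow> Y i \<in> vimage_algebra (space M) (X i) (M' i) \<rightarrow>\<^sub>M N i"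
  shows "indep_vars N Y I"
  unfolding indep_vars_def2
proof
  have X: "X i \<in> M \<rightarrow>\<^sub>M M' i" if "i \<in> I" for i using assms(1) that by (auto simp: indep_vars_def2)
  have sub: "sets (vimage_algebra (space M) (X i) (M' i)) = {X i -` A \<inter> space M |A. A \<in> sets (M' i)}" if "i \<in> I" for i
    using measurable_space[OF X[OF that]] by (intro sets_vimage_algebra2) auto
  show "\<forall>i\<in>I. random_variable (N i) (Y i)"
  proof
    fix i assume i: "i \<in> I"
    have "sets (vimage_algebra (space M) (X i) (M' i)) \<subseteq> sets M"
      unfolding sub[OF i] using measurable_sets[OF X[OF i]] by auto
    then show "random_variable (N i) (Y i)"
      using Y[OF i] by (auto simp: measurable_def space_vimage_algebra)
  qed
  show "indep_sets (\<lambda>i. {Y i -` A \<inter> space M |A. A \<in> sets (N i)}) I"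
  proof (rule indep_sets_mono_sets)
    show "indep_sets (\<lambda>i. {X i -` A \<inter> space M |A. A \<in> sets (M' i)}) I"
      using assms(1) by (simp add: indep_vars_def2)
    fix i assume i: "i \<in> I"
    show "{Y i -` A \<inter> space M |A. A \<in> sets (N i)} \<subseteq> {X i -` A \<inter> space M |A. A \<in> sets (M' i)}"
      unfolding sub[OF i, symmetric] using measurable_sets[OF Y[OF i]] by (auto simp: space_vimage_algebra)
  qed
qed

end

section \<open>Moments of a sample variance\<close>

text \<open>For \<open>D >= 1\<close> this is the sum of squared distances to the mean. The expanded
  form is a combination of two quadratic energies, of the entries and of their sum, and Parseval's
  identity applies to each.\<close>

definition squared_deviation :: "nat \<Rightarrow> (nat \<Rightarrow> real) \<Rightarrow> real" where
  "squared_deviation D x = (\<Sum>r\<in>{1..D}. (x r)\<^sup>2) - (\<Sum>r\<in>{1..D}. x r)\<^sup>2 / real D"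

lemma squared_deviation_bounds:
  "0 \<le> squared_deviation D x" "squared_deviation D x \<le> (\<Sum>r\<in>{1..D}. (x r)\<^sup>2)"
proof -
  have "(\<Sum>r\<in>{1..D}. 1 * x r)\<^sup>2 \<le> (\<Sum>r\<in>{1..D}. 1\<^sup>2) * (\<Sum>r\<in>{1..D}. (x r)\<^sup>2)"
    by (rule Cauchy_Schwarz_ineq_sum)
  then show "0 \<le> squared_deviation D x"
    unfolding squared_deviation_def by (cases "D = 0") (simp_all add: pos_divide_le_eq mult.commute)
qed (simp add: squared_deviation_def)

text \<open>Ordered by powers of the first channel: a multiple of its square, a term linear in it
  and a part free of it. The lower bound on the variance projects onto the first of these.\<close>

lemma squared_deviation_split:
  fixes x :: "nat \<Rightarrow> real"
  assumes "1 \<le> D"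
  defines "T \<equiv> \<Sum>r\<in>{2..D}. x r"
  shows "squared_deviation D x = (1 - 1 / D) * (x 1)\<^sup>2 - 2 / D * (x 1 * T) + ((\<Sum>r\<in>{2..D}. (x r)\<^sup>2) - T\<^sup>2 / D)"
proof -
  have sum: "(\<Sum>r\<in>{1..D}. f r) = f 1 + (\<Sum>r\<in>{2..D}. f r)" for f :: "nat \<Rightarrow> real"
    using assms(1) by (simp add: sum.atLeast_Suc_atMost numeral_2_eq_2)
  show ?thesis
    using assms(1) unfolding squared_deviation_def sum T_def[symmetric]
    by (simp add: field_simps power2_eq_square)
qed

text \<open>Dividing by \<open>D - 1\<close> makes the mean of the first term the average of the
  \<open>v r\<close> even when these differ, because for independent centred channels
  \<open>squared_deviation\<close> has mean \<open>(1 - 1/D)\<close> times their sum.\<close>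

definition centred_sample_variance :: "nat \<Rightarrow> (nat \<Rightarrow> 'a \<Rightarrow> real) \<Rightarrow> (nat \<Rightarrow> real) \<Rightarrow> 'a \<Rightarrow> real" where
  "centred_sample_variance D x v \<omega> = squared_deviation D (\<lambda>r. x r \<omega>) / (real D - 1) - (\<Sum>r\<in>{1..D}. v r) / real D"

context prob_space begin

lemma indep_sum_second_moment:
  fixes X :: "'i \<Rightarrow> 'a \<Rightarrow> real"
  assumes fin: "finite I" and indep: "indep_vars (\<lambda>_. borel) X I"
    and sq: "\<And>i. i \<in> I \<Longrightarrow> integrable M (\<lambda>\<omega>. (X i \<omega>)\<^sup>2)" and mean: "\<And>i. i \<in> I \<Longrightarrow> expectation (X i) = 0"
  shows "integrable M (\<lambda>\<omega>. (\<Sum>i\<in>I. X i \<omega>)\<^sup>2)"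
    "expectation (\<lambda>\<omega>. (\<Sum>i\<in>I. X i \<omega>)\<^sup>2) = (\<Sum>i\<in>I. expectation (\<lambda>\<omega>. (X i \<omega>)\<^sup>2))"
proof -
  have rv: "X i \<in> borel_measurable M" if "i \<in> I" for i using indep that by (simp add: indep_vars_def2)
  have int: "integrable M (X i)" if "i \<in> I" for i
    by (rule square_integrable_imp_integrable[OF rv[OF that] sq[OF that]])
  have cross: "integrable M (\<lambda>\<omega>. X i \<omega> * X k \<omega>) \<and> expectation (\<lambda>\<omega>. X i \<omega> * X k \<omega>) = (if i
      = k then expectation (\<lambda>\<omega>. (X i \<omega>)\<^sup>2) else 0)"
    if "i \<in> I" "k \<in> I" for i k
  proof (cases "i = k")
    case True
    then show ?thesis using sq that by (simp add: power2_eq_square)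
  next
    case False
    have ind: "indep_vars (\<lambda>_. borel) X {i, k}" by (rule indep_vars_subset[OF indep]) (use that in auto)
    have i: "integrable M (X j)" if "j \<in> {i, k}" for j using int that \<open>i \<in> I\<close> \<open>k \<in> I\<close> by auto
    show ?thesis
      using indep_vars_lebesgue_integral[OF _ ind i] indep_vars_integrable[OF _ ind i] False mean that by simp
  qed
  have eq: "(\<Sum>i\<in>I. X i \<omega>)\<^sup>2 = (\<Sum>i\<in>I. \<Sum>k\<in>I. X i \<omega> * X k \<omega>)" for \<omega>
    by (simp add: power2_eq_square sum_product)
  show "integrable M (\<lambda>\<omega>. (\<Sum>i\<in>I. X i \<omega>)\<^sup>2)"
    unfolding eq using cross by (intro Bochner_Integration.integrable_sum) blast
  have "expectation (\<lambda>\<omega>. (\<Sum>i\<in>I. X i \<omega>)\<^sup>2) = (\<Sum>i\<in>I. \<Sum>k\<in>I. expectation (\<lambda>\<omega>. X i \<omega> * X k \<omega>))"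
    unfolding eq
  proof (subst Bochner_Integration.integral_sum)
    show "integrable M (\<lambda>\<omega>. \<Sum>k\<in>I. X i \<omega> * X k \<omega>)" if "i \<in> I" for i
      using cross that by (intro Bochner_Integration.integrable_sum) blast
    show "(\<Sum>i\<in>I. expectation (\<lambda>\<omega>. \<Sum>k\<in>I. X i \<omega> * X k \<omega>)) = (\<Sum>i\<in>I. \<Sum>k\<in>I. expectation (\<lambda>\<omega>. X i \<omega> * X k \<omega>))"
      using cross by (intro sum.cong refl Bochner_Integration.integral_sum) blast
  qed
  also have "\<dots> = (\<Sum>i\<in>I. \<Sum>k\<in>I. if i = k then expectation (\<lambda>\<omega>. (X i \<omega>)\<^sup>2) else 0)"
    using cross by (intro sum.cong refl) blast
  also have "\<dots> = (\<Sum>i\<in>I. expectation (\<lambda>\<omega>. (X i \<omega>)\<^sup>2))" using fin by (simp add: sum.delta)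
  finally show "expectation (\<lambda>\<omega>. (\<Sum>i\<in>I. X i \<omega>)\<^sup>2) = (\<Sum>i\<in>I. expectation (\<lambda>\<omega>. (X i \<omega>)\<^sup>2))" .
qed

section \<open>Sample variance of independent channels with Gaussian moments\<close>

context
  fixes D :: nat and x :: "nat \<Rightarrow> 'a \<Rightarrow> real" and v :: "nat \<Rightarrow> real"
  assumes D: "2 \<le> D" and indep: "indep_vars (\<lambda>_. borel) x {1..D}"
    and int: "\<And>r k. r \<in> {1..D} \<Longrightarrow> integrable M (\<lambda>\<omega>. x r \<omega> ^ k)"
    and m1: "\<And>r. r \<in> {1..D} \<Longrightarrow> expectation (x r) = 0"
    and m2: "\<And>r. r \<in> {1..D} \<Longrightarrow> expectation (\<lambda>\<omega>. (x r \<omega>)\<^sup>2) = v r"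
    and m4: "\<And>r. r \<in> {1..D} \<Longrightarrow> expectation (\<lambda>\<omega>. x r \<omega> ^ 4) = 3 * (v r)\<^sup>2"
    and m8: "\<And>r. r \<in> {1..D} \<Longrightarrow> expectation (\<lambda>\<omega>. x r \<omega> ^ 8) = 105 * v r ^ 4"
begin

lemma channel_measurable [measurable]: "r \<in> {1..D} \<Longrightarrow> x r \<in> borel_measurable M"
  using indep by (simp add: indep_vars_def2)

lemma channel_variance_nonneg: "r \<in> {1..D} \<Longrightarrow> 0 \<le> v r"
  using m2[of r] by (metis Bochner_Integration.integral_nonneg zero_le_power2)

lemma sum_square_moment:
  assumes "A \<subseteq> {1..D}"
  shows "integrable M (\<lambda>\<omega>. (\<Sum>r\<in>A. x r \<omega>)\<^sup>2)" "expectation (\<lambda>\<omega>. (\<Sum>r\<in>A. x r \<omega>)\<^sup>2) = (\<Sum>r\<in>A. v r)"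
proof -
  have fin: "finite A" using assms finite_subset by blast
  have A: "r \<in> {1..D}" if "r \<in> A" for r using assms that by auto
  note sm = indep_sum_second_moment[OF fin indep_vars_subset[OF indep assms] int[OF A] m1[OF A]]
  show "integrable M (\<lambda>\<omega>. (\<Sum>r\<in>A. x r \<omega>)\<^sup>2)" by (rule sm(1))
  show "expectation (\<lambda>\<omega>. (\<Sum>r\<in>A. x r \<omega>)\<^sup>2) = (\<Sum>r\<in>A. v r)"
    by (rule trans[OF sm(2)]) (assumption, assumption, intro sum.cong refl m2 A)
qed

lemma measurable_csv [measurable]: "centred_sample_variance D x v \<in> borel_measurable M"
  unfolding centred_sample_variance_def squared_deviation_def by measurable

lemma csv_mean: "expectation (centred_sample_variance D x v) = 0"
proof -
  have sq: "integrable M (\<lambda>\<omega>. \<Sum>r\<in>{1..D}. (x r \<omega>)\<^sup>2)"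
    by (intro Bochner_Integration.integrable_sum int)
  have "expectation (\<lambda>\<omega>. squared_deviation D (\<lambda>r. x r \<omega>)) = (\<Sum>r\<in>{1..D}. v r) - (\<Sum>r\<in>{1..D}. v r) / real D"
    unfolding squared_deviation_def using sq sum_square_moment[of "{1..D}"] int m2
    by (simp add: Bochner_Integration.integral_sum)
  moreover have "integrable M (\<lambda>\<omega>. squared_deviation D (\<lambda>r. x r \<omega>))"
    unfolding squared_deviation_def using sq sum_square_moment[of "{1..D}"] by auto
  ultimately have "expectation (centred_sample_variance D x v)
     = ((\<Sum>r\<in>{1..D}. v r) - (\<Sum>r\<in>{1..D}. v r) / real D) / (real D - 1) - (\<Sum>r\<in>{1..D}. v r) / real D"
    unfolding centred_sample_variance_def by (simp add: prob_space)
  also have "\<dots> = 0" using D by (simp add: field_simps)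
  finally show ?thesis .
qed

text \<open>Dropping the negative square and replacing the denominators by 1 is crude, but it leaves
  a sum over single channels, so that the upper moment bounds below need no mixed moments.\<close>

lemma csv_abs_le: "\<bar>centred_sample_variance D x v \<omega>\<bar> \<le> (\<Sum>r\<in>{1..D}. (x r \<omega>)\<^sup>2 + v r)"
proof -
  let ?V = "squared_deviation D (\<lambda>r. x r \<omega>)"
  have "?V / (real D - 1) \<le> ?V / 1"
    using D squared_deviation_bounds(1) by (intro divide_left_mono) auto
  then have 1: "0 \<le> ?V / (real D - 1)" "?V / (real D - 1) \<le> (\<Sum>r\<in>{1..D}. (x r \<omega>)\<^sup>2)"
    using D squared_deviation_bounds[of D "\<lambda>r. x r \<omega>"] by (auto intro: order_trans)
  have v: "0 \<le> (\<Sum>r\<in>{1..D}. v r)" by (intro sum_nonneg channel_variance_nonneg)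
  then have "(\<Sum>r\<in>{1..D}. v r) / real D \<le> (\<Sum>r\<in>{1..D}. v r) / 1"
    using D by (intro divide_left_mono) auto
  then show ?thesis
    using 1 v divide_nonneg_nonneg[OF v, of "real D"] unfolding centred_sample_variance_def sum.distrib by linarith
qed

lemma csv_sq_le: "(centred_sample_variance D x v \<omega>)\<^sup>2 \<le> D * (\<Sum>r\<in>{1..D}. ((x r \<omega>)\<^sup>2 + v r)\<^sup>2)"
proof -
  have "(centred_sample_variance D x v \<omega>)\<^sup>2 \<le> (\<Sum>r\<in>{1..D}. 1 * ((x r \<omega>)\<^sup>2 + v r))\<^sup>2"
    unfolding abs_le_square_iff[symmetric] mult_1_left by (rule order_trans[OF csv_abs_le abs_ge_self])
  also have "\<dots> \<le> (\<Sum>r\<in>{1..D}. 1\<^sup>2) * (\<Sum>r\<in>{1..D}. ((x r \<omega>)\<^sup>2 + v r)\<^sup>2)"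
    by (rule Cauchy_Schwarz_ineq_sum)
  finally show ?thesis by simp
qed

text \<open>Two applications of the Cauchy-Schwarz inequality give \<open>D^3\<close>, and
  \<open>(a + b)^4 <= 8 * (a^4 + b^4)\<close> gives the 8.\<close>

lemma csv_fourth_le: "centred_sample_variance D x v \<omega> ^ 4 \<le> 8 * D ^ 3 * (\<Sum>r\<in>{1..D}. x r \<omega> ^ 8 + v r ^ 4)"
proof -
  have pm: "(a + b) ^ 4 \<le> 8 * (a ^ 4 + b ^ 4)" for a b :: real
  proof -
    have "(a + b)\<^sup>2 \<le> 2 * (a\<^sup>2 + b\<^sup>2)" using sum_squares_bound[of a b] by (simp add: power2_sum)
    then have "((a + b)\<^sup>2)\<^sup>2 \<le> (2 * (a\<^sup>2 + b\<^sup>2))\<^sup>2" by (intro power_mono) auto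
    also have "\<dots> \<le> 8 * ((a\<^sup>2)\<^sup>2 + (b\<^sup>2)\<^sup>2)" using sum_squares_bound[of "a\<^sup>2" "b\<^sup>2"]
        by (simp add: power2_sum power_mult_distrib)
    finally show ?thesis by simp
  qed
  let ?y = "\<lambda>r. ((x r \<omega>)\<^sup>2 + v r)\<^sup>2"
  have "centred_sample_variance D x v \<omega> ^ 4 = ((centred_sample_variance D x v \<omega>)\<^sup>2)\<^sup>2" by simp
  also have "\<dots> \<le> (D * (\<Sum>r\<in>{1..D}. ?y r))\<^sup>2"
    by (intro power_mono csv_sq_le) simp
  also have "\<dots> = D\<^sup>2 * (\<Sum>r\<in>{1..D}. 1 * ?y r)\<^sup>2" by (simp add: power_mult_distrib)
  also have "\<dots> \<le> D\<^sup>2 * ((\<Sum>r\<in>{1..D}. 1\<^sup>2) * (\<Sum>r\<in>{1..D}. (?y r)\<^sup>2))"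
    by (intro mult_left_mono Cauchy_Schwarz_ineq_sum) simp
  also have "\<dots> = D ^ 3 * (\<Sum>r\<in>{1..D}. ((x r \<omega>)\<^sup>2 + v r) ^ 4)"
    by (simp add: power2_eq_square[of "real D"] power3_eq_cube)
  also have "\<dots> \<le> D ^ 3 * (\<Sum>r\<in>{1..D}. 8 * (((x r \<omega>)\<^sup>2) ^ 4 + v r ^ 4))"
    by (intro mult_left_mono sum_mono pm) simp
  also have "\<dots> = 8 * D ^ 3 * (\<Sum>r\<in>{1..D}. x r \<omega> ^ 8 + v r ^ 4)"
    by (simp add: sum_distrib_left algebra_simps flip: power_mult)
  finally show ?thesis .
qed

text \<open>848 is \<open>8 * (105 + 1)\<close>, with 105 from the eighth Gaussian moment.\<close>

lemma csv_fourth: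
  "integrable M (\<lambda>\<omega>. centred_sample_variance D x v \<omega> ^ 4)"
  "expectation (\<lambda>\<omega>. centred_sample_variance D x v \<omega> ^ 4) \<le> 848 * D ^ 3 * (\<Sum>r\<in>{1..D}. v r ^ 4)"
proof -
  have i8: "integrable M (\<lambda>\<omega>. 8 * D ^ 3 * (\<Sum>r\<in>{1..D}. x r \<omega> ^ 8 + v r ^ 4))"
    using int by (intro integrable_mult_right Bochner_Integration.integrable_sum
        Bochner_Integration.integrable_add) auto
  show i4: "integrable M (\<lambda>\<omega>. centred_sample_variance D x v \<omega> ^ 4)"
  proof (rule Bochner_Integration.integrable_bound[OF i8])
    show "AE \<omega> in M. norm (centred_sample_variance D x v \<omega> ^ 4) \<le> norm (8 * D ^ 3 * (\<Sum>r\<in>{1..D}. x r \<omega> ^ 8 + v r ^ 4))"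
    proof (rule AE_I2)
      fix \<omega>
      have "0 \<le> centred_sample_variance D x v \<omega> ^ 4" by simp
      then show "norm (centred_sample_variance D x v \<omega> ^ 4) \<le> norm (8 * D ^ 3 * (\<Sum>r\<in>{1..D}. x r \<omega> ^ 8 + v r ^ 4))"
        using csv_fourth_le[of \<omega>] unfolding real_norm_def by linarith
    qed
  qed measurable
  have "expectation (\<lambda>\<omega>. centred_sample_variance D x v \<omega> ^ 4) \<le> expectation (\<lambda>\<omega>. 8 * D ^ 3
      * (\<Sum>r\<in>{1..D}. x r \<omega> ^ 8 + v r ^ 4))"
    by (rule integral_mono[OF i4 i8 csv_fourth_le])
  also have "\<dots> = 8 * D ^ 3 * (\<Sum>r\<in>{1..D}. 105 * v r ^ 4 + v r ^ 4)"
    using int m8 by (simp add: Bochner_Integration.integral_sum prob_space)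
  also have "\<dots> = 848 * D ^ 3 * (\<Sum>r\<in>{1..D}. v r ^ 4)"
    by (simp add: sum_distrib_left mult.assoc)
  finally show "expectation (\<lambda>\<omega>. centred_sample_variance D x v \<omega> ^ 4) \<le> 848 * D ^ 3 * (\<Sum>r\<in>{1..D}. v r ^ 4)" .
qed

text \<open>6 is \<open>3 + 2 + 1\<close>, the mean of the expanded square
  \<open>(x^2 + v)^2\<close> in units of \<open>v^2\<close>.\<close>

lemma csv_square:
  "integrable M (\<lambda>\<omega>. (centred_sample_variance D x v \<omega>)\<^sup>2)"
  "expectation (\<lambda>\<omega>. (centred_sample_variance D x v \<omega>)\<^sup>2) \<le> 6 * D * (\<Sum>r\<in>{1..D}. (v r)\<^sup>2)"
proof -
  have eq: "((x r \<omega>)\<^sup>2 + v r)\<^sup>2 = x r \<omega> ^ 4 + 2 * v r * (x r \<omega>)\<^sup>2 + (v r)\<^sup>2" for r \<omega>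
    by (simp add: power2_eq_square power4_eq_xxxx algebra_simps)
  have i4: "integrable M (\<lambda>\<omega>. D * (\<Sum>r\<in>{1..D}. ((x r \<omega>)\<^sup>2 + v r)\<^sup>2))"
    unfolding eq using int
        by (intro integrable_mult_right Bochner_Integration.integrable_sum Bochner_Integration.integrable_add) auto
  show i2: "integrable M (\<lambda>\<omega>. (centred_sample_variance D x v \<omega>)\<^sup>2)"
  proof (rule Bochner_Integration.integrable_bound[OF i4])
    show "AE \<omega> in M. norm ((centred_sample_variance D x v \<omega>)\<^sup>2) \<le> norm (D * (\<Sum>r\<in>{1..D}. ((x r \<omega>)\<^sup>2 + v r)\<^sup>2))"
    proof (rule AE_I2)
      fix \<omega>
      have "0 \<le> (centred_sample_variance D x v \<omega>)\<^sup>2" by simp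
      then show "norm ((centred_sample_variance D x v \<omega>)\<^sup>2) \<le> norm (D * (\<Sum>r\<in>{1..D}. ((x r \<omega>)\<^sup>2 + v r)\<^sup>2))"
        using csv_sq_le[of \<omega>] unfolding real_norm_def by linarith
    qed
  qed measurable
  have "expectation (\<lambda>\<omega>. (centred_sample_variance D x v \<omega>)\<^sup>2) \<le> expectation (\<lambda>\<omega>. D * (\<Sum>r\<in>{1..D}. ((x r \<omega>)\<^sup>2 + v r)\<^sup>2))"
    by (rule integral_mono[OF i2 i4 csv_sq_le])
  also have "\<dots> = D * (\<Sum>r\<in>{1..D}. 3 * (v r)\<^sup>2 + 2 * v r * v r + (v r)\<^sup>2)"
    unfolding eq using int m4 m2 by (simp add: Bochner_Integration.integral_sum prob_space)
  also have "\<dots> = 6 * D * (\<Sum>r\<in>{1..D}. (v r)\<^sup>2)"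
    by (simp add: sum_distrib_left power2_eq_square algebra_simps)
  finally show "expectation (\<lambda>\<omega>. (centred_sample_variance D x v \<omega>)\<^sup>2) \<le> 6 * D * (\<Sum>r\<in>{1..D}. (v r)\<^sup>2)" .
qed

text \<open>Channel 1 and the block of the other channels are disjoint groups of an independent
  family. The factor \<open>g\<close> takes the block as a restricted function because grouped
  variables are independent in that form.\<close>

lemma first_independent_of_rest:
  fixes f :: "real \<Rightarrow> real" and g :: "(nat \<Rightarrow> real) \<Rightarrow> real"
  assumes [measurable]: "f \<in> borel_measurable borel" and g: "g \<in> borel_measurable (\<Pi>\<^sub>M r\<in>{2..D}. borel)"
    and "integrable M (\<lambda>\<omega>. f (x 1 \<omega>))" "integrable M (\<lambda>\<omega>. g (\<lambda>r\<in>{2..D}. x r \<omega>))"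
  shows "integrable M (\<lambda>\<omega>. f (x 1 \<omega>) * g (\<lambda>r\<in>{2..D}. x r \<omega>))"
    "expectation (\<lambda>\<omega>. f (x 1 \<omega>) * g (\<lambda>r\<in>{2..D}. x r \<omega>)) = expectation (\<lambda>\<omega>. f (x 1 \<omega>))
        * expectation (\<lambda>\<omega>. g (\<lambda>r\<in>{2..D}. x r \<omega>))"
proof -
  have "indep_var (\<Pi>\<^sub>M r\<in>{1}. borel) (\<lambda>\<omega>. \<lambda>r\<in>{1}. x r \<omega>) (\<Pi>\<^sub>M r\<in>{2..D}. borel) (\<lambda>\<omega>. \<lambda>r\<in>{2..D}. x r \<omega>)"
    by (rule indep_var_restrict[OF indep]) (use D in auto)
  then have "indep_var borel ((\<lambda>z. f (z 1)) \<circ> (\<lambda>\<omega>. \<lambda>r\<in>{1}. x r \<omega>)) borel (g \<circ> (\<lambda>\<omega>. \<lambda>r\<in>{2..D}. x r \<omega>))"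
    by (rule indep_var_compose[OF _ _ g]) measurable
  then have ind: "indep_var borel (\<lambda>\<omega>. f (x 1 \<omega>)) borel (\<lambda>\<omega>. g (\<lambda>r\<in>{2..D}. x r \<omega>))"
    by (simp add: comp_def)
  from indep_var_integrable[OF ind assms(3,4)] indep_var_lebesgue_integral[OF ind assms(3,4)]
  show "integrable M (\<lambda>\<omega>. f (x 1 \<omega>) * g (\<lambda>r\<in>{2..D}. x r \<omega>))"
    "expectation (\<lambda>\<omega>. f (x 1 \<omega>) * g (\<lambda>r\<in>{2..D}. x r \<omega>)) = expectation (\<lambda>\<omega>. f (x 1 \<omega>))
        * expectation (\<lambda>\<omega>. g (\<lambda>r\<in>{2..D}. x r \<omega>))" .
qed

text \<open>Projecting onto \<open>x\<^sub>1\<^sup>2 - v\<^sub>1\<close>, which is uncorrelated with every other term, bounds the variance from below.\<close>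

lemma csv_square_lower:
  "2 * (v 1)\<^sup>2 / (real D)\<^sup>2 \<le> expectation (\<lambda>\<omega>. (centred_sample_variance D x v \<omega>)\<^sup>2)"
proof -
  have D1: "1 \<in> {1..D}" using D by simp
  define T where "T \<omega> = (\<Sum>r\<in>{2..D}. x r \<omega>)" for \<omega>
  define G where "G \<omega> = (x 1 \<omega>)\<^sup>2 - v 1" for \<omega>
  define \<beta> where "\<beta> \<omega> = ((\<Sum>r\<in>{2..D}. (x r \<omega>)\<^sup>2) - (T \<omega>)\<^sup>2 / D) / (real D - 1) - (\<Sum>r\<in>{1..D}. v r) / D" for \<omega>
  have iT: "integrable M T"
    unfolding T_def using int[of _ 1] by (intro Bochner_Integration.integrable_sum) auto
  have ET: "expectation T = 0"
    unfolding T_def using int[of _ 1] m1 by (subst Bochner_Integration.integral_sum) auto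
  have i\<beta>: "integrable M \<beta>"
    unfolding \<beta>_def T_def
    by (intro Bochner_Integration.integrable_diff integrable_divide Bochner_Integration.integrable_sum
        integrable_const int sum_square_moment(1)) auto
  have iG: "integrable M G" unfolding G_def using int[OF D1] by simp
  have EG: "expectation G = 0" unfolding G_def using int[OF D1] m2[OF D1] by (simp add: prob_space)
  have G2: "(G \<omega>)\<^sup>2 = x 1 \<omega> ^ 4 - 2 * v 1 * (x 1 \<omega>)\<^sup>2 + (v 1)\<^sup>2" for \<omega>
    by (simp add: G_def power2_eq_square power4_eq_xxxx algebra_simps)
  have iG2: "integrable M (\<lambda>\<omega>. (G \<omega>)\<^sup>2)" unfolding G2 using int[OF D1] by simp
  have EG2: "expectation (\<lambda>\<omega>. (G \<omega>)\<^sup>2) = 2 * (v 1)\<^sup>2"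
    unfolding G2 using int[OF D1] m2[OF D1] m4[OF D1] by (simp add: prob_space) (simp add: power2_eq_square)
  have xG: "x 1 \<omega> * G \<omega> = x 1 \<omega> ^ 3 - v 1 * x 1 \<omega>" for \<omega>
    by (simp add: G_def power2_eq_square power3_eq_cube algebra_simps)
  have ixG: "integrable M (\<lambda>\<omega>. x 1 \<omega> * G \<omega>)" unfolding xG using int[OF D1, of 3] int[OF D1, of 1] by simp
  \<comment> \<open>The term linear in channel 1 carries the factor \<open>T\<close>, which is
    independent of that channel and has mean zero.\<close>
  have xGT: "integrable M (\<lambda>\<omega>. (x 1 \<omega> * G \<omega>) * T \<omega>)" "expectation (\<lambda>\<omega>. (x 1 \<omega> * G \<omega>) * T \<omega>) = 0"
    using first_independent_of_rest[of "\<lambda>y. y * (y\<^sup>2 - v 1)" "\<lambda>z. \<Sum>r\<in>{2..D}. z r"] ixG iT ET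
    by (auto simp: G_def T_def[abs_def])
  have G\<beta>: "integrable M (\<lambda>\<omega>. G \<omega> * \<beta> \<omega>)" "expectation (\<lambda>\<omega>. G \<omega> * \<beta> \<omega>) = 0"
    using first_independent_of_rest[of "\<lambda>y. y\<^sup>2 - v 1" "\<lambda>z. ((\<Sum>r\<in>{2..D}. (z r)\<^sup>2)
        - (\<Sum>r\<in>{2..D}. z r)\<^sup>2 / D) / (real D - 1) - (\<Sum>r\<in>{1..D}. v r) / D"]
      iG i\<beta> EG by (auto simp: G_def[abs_def] T_def \<beta>_def[abs_def])
  define c where "c = 2 / (real D * (real D - 1))"
  have q: "centred_sample_variance D x v \<omega> = (x 1 \<omega>)\<^sup>2 / D - c * (x 1 \<omega> * T \<omega>) + \<beta> \<omega>" for \<omega>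
  proof -
    have "centred_sample_variance D x v \<omega> = ((1 - 1 / D) * (x 1 \<omega>)\<^sup>2 - 2 / D * (x 1 \<omega> * T \<omega>)
        + ((\<Sum>r\<in>{2..D}. (x r \<omega>)\<^sup>2) - (T \<omega>)\<^sup>2 / D)) / (real D - 1) - (\<Sum>r\<in>{1..D}. v r) / D"
      unfolding centred_sample_variance_def T_def using D by (subst squared_deviation_split) auto
    also have "\<dots> = ((1 - 1 / D) / (real D - 1)) * (x 1 \<omega>)\<^sup>2 - (2 / D / (real D - 1)) * (x 1 \<omega> * T \<omega>) + \<beta> \<omega>"
    proof -
      have "(p * a - q * b + e) / d - f = (p / d) * a - (q / d) * b + (e / d - f)" for p a q b e d f :: real
        by (simp add: add_divide_distrib diff_divide_distrib)
      then show ?thesis unfolding \<beta>_def .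
    qed
    also have "(1 - 1 / D) / (real D - 1) = 1 / real D" using D by (simp add: field_simps)
    finally show ?thesis by (simp add: c_def)
  qed
  have qG: "centred_sample_variance D x v \<omega> * G \<omega> = (x 1 \<omega> ^ 4 - v 1 * (x 1 \<omega>)\<^sup>2) / D - c * ((x 1 \<omega> * G \<omega>)
      * T \<omega>) + G \<omega> * \<beta> \<omega>" for \<omega>
    unfolding q by (simp add: G_def power2_eq_square power4_eq_xxxx algebra_simps diff_divide_distrib)
  have iqG: "integrable M (\<lambda>\<omega>. centred_sample_variance D x v \<omega> * G \<omega>)"
    unfolding qG using int[OF D1] xGT(1) G\<beta>(1) by simp
  have EqG: "expectation (\<lambda>\<omega>. centred_sample_variance D x v \<omega> * G \<omega>) = 2 * (v 1)\<^sup>2 / D"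
    unfolding qG using int[OF D1] xGT G\<beta> m2[OF D1] m4[OF D1] by simp (simp add: power2_eq_square)
  \<comment> \<open>\<open>1 / D\<close> is the regression coefficient: the covariance with
    \<open>G\<close>, which is \<open>2 * (v 1)^2 / D\<close>, divided by the variance
    \<open>2 * (v 1)^2\<close> of \<open>G\<close>.\<close>
  have "0 \<le> expectation (\<lambda>\<omega>. (centred_sample_variance D x v \<omega> - G \<omega> / D)\<^sup>2)" by simp
  also have "\<dots> = expectation (\<lambda>\<omega>. (centred_sample_variance D x v \<omega>)\<^sup>2 - 2 / D
      * (centred_sample_variance D x v \<omega> * G \<omega>) + (1 / D)\<^sup>2 * (G \<omega>)\<^sup>2)"
    by (intro Bochner_Integration.integral_cong refl) (simp add: power2_diff power_divide)
  also have "\<dots> = expectation (\<lambda>\<omega>. (centred_sample_variance D x v \<omega>)\<^sup>2) - 2 / D * (2 * (v 1)\<^sup>2 / D) + (1 / D)\<^sup>2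
      * (2 * (v 1)\<^sup>2)"
    using csv_square(1) iqG iG2 by (simp add: EqG EG2)
  finally show ?thesis by (simp add: power2_eq_square field_simps)
qed

end

declare channel_measurable [measurable del] and measurable_csv [measurable del]

end

section \<open>Orthonormality of spin harmonics\<close>

text \<open>In the variable \<open>x = cos^2 (\<theta> / 2)\<close> this is
  \<open>x^p * (1 - x)^q\<close>. Products of two Wigner functions with the same lower indices are
  combinations of such terms.\<close>

definition half_angle_monomial :: "nat \<Rightarrow> nat \<Rightarrow> real \<Rightarrow> real" where
  "half_angle_monomial p q \<theta> = cos (\<theta> / 2) ^ (2 * p) * sin (\<theta> / 2) ^ (2 * q)"

lemma half_angle_monomial_split:
  "half_angle_monomial p q \<theta> = half_angle_monomial (Suc p) q \<theta> + half_angle_monomial p (Suc q) \<theta>"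
proof -
  have "half_angle_monomial (Suc p) q \<theta> = half_angle_monomial p q \<theta> * (cos (\<theta> / 2))\<^sup>2"
    "half_angle_monomial p (Suc q) \<theta> = half_angle_monomial p q \<theta> * (sin (\<theta> / 2))\<^sup>2"
    by (simp_all add: half_angle_monomial_def power2_eq_square)
  then have "half_angle_monomial (Suc p) q \<theta> + half_angle_monomial p (Suc q) \<theta>
     = half_angle_monomial p q \<theta> * ((cos (\<theta> / 2))\<^sup>2 + (sin (\<theta> / 2))\<^sup>2)"
    by (simp only: distrib_left)
  then show ?thesis by simp
qed

lemma continuous_half_angle_monomial [continuous_intros]:
  "continuous_on A (half_angle_monomial p q)"
  unfolding half_angle_monomial_def by (intro continuous_intros) auto

text \<open>Substituting \<open>x = cos^2 (\<theta> / 2)\<close> gives twice the Beta integral of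
  \<open>x^p * (1 - x)^q\<close>. The induction on \<open>q\<close> integrates by parts: the
  primitive \<open>2 * x^(p+1) * (1 - x)^(q+1)\<close> vanishes at both ends.\<close>

lemma has_integral_half_angle_monomial:
  "has_bochner_integral lborel (\<lambda>\<theta>. indicator {0..pi} \<theta> *\<^sub>R (half_angle_monomial p q \<theta> * sin \<theta>))
     (2 * fact p * fact q / fact (p + q + 1))"
proof (induction q arbitrary: p)
  case 0
  have "has_bochner_integral lborel (\<lambda>\<theta>. indicator {0..pi} \<theta> *\<^sub>R (half_angle_monomial p 0 \<theta> * sin \<theta>))
     (- (2 / (p + 1)) * cos (pi / 2) ^ (2 * (p + 1)) - (- (2 / (p + 1)) * cos (0 / 2) ^ (2 * (p + 1))))"
  proof (rule has_bochner_integral_FTC_Icc)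
    fix x :: real
    have "((\<lambda>x. cos (x / 2) ^ (2 * (p + 1))) has_real_derivative
       real (2 * (p + 1)) * (cos (x / 2) ^ (2 * p + 1) * (- sin (x / 2) * (1 / 2)))) (at x within {0..pi})"
      by (auto intro!: derivative_eq_intros simp del: power_Suc)
    then have "((\<lambda>x. - (2 / (p + 1)) * cos (x / 2) ^ (2 * (p + 1))) has_real_derivative
       - (2 / (p + 1)) * (real (2 * (p + 1)) * (cos (x / 2) ^ (2 * p + 1) * (- sin (x / 2)
           * (1 / 2))))) (at x within {0..pi})"
      by (rule DERIV_cmult)
    also have "- (2 / (p + 1)) * (real (2 * (p + 1)) * (cos (x / 2) ^ (2 * p + 1) * (- sin (x / 2) * (1 / 2))))
       = half_angle_monomial p 0 x * sin x"
    proof -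
      have "- (2 / c) * (2 * c * (K * (- z * (1 / 2)))) = 2 * K * z" if "c \<noteq> 0" for c K z :: real
        using that by simp
      note cancel = this[of "real p + 1" "cos (x / 2) ^ (2 * p + 1)" "sin (x / 2)"]
      have e: "real (2 * (p + 1)) = 2 * (real p + 1)" by simp
      have "- (2 / (real p + 1)) * (real (2 * (p + 1)) * (cos (x / 2) ^ (2 * p + 1) * (- sin (x / 2) * (1 / 2))))
        = 2 * cos (x / 2) ^ (2 * p + 1) * sin (x / 2)" unfolding e by (rule cancel) simp
      also have "\<dots> = half_angle_monomial p 0 x * sin x"
        using sin_double[of "x / 2"] by (simp add: half_angle_monomial_def)
      finally show ?thesis by (simp only: of_nat_add of_nat_1)
    qed
    finally show "((\<lambda>x. - (2 / (p + 1)) * cos (x / 2) ^ (2 * (p + 1))) has_vector_derivative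
       half_angle_monomial p 0 x * sin x) (at x within {0..pi})"
      by (simp add: has_real_derivative_iff_has_vector_derivative)
  qed (auto intro!: continuous_intros)
  moreover have "- (2 / (p + 1)) * cos (pi / 2) ^ (2 * (p + 1)) - (- (2 / (p + 1)) * cos (0 / 2) ^ (2 * (p + 1)))
      = 2 * fact p * fact 0 / fact (p + 0 + 1)"
  proof -
    have "fact (p + 0 + 1) = (real p + 1) * fact p" by simp
    then show ?thesis by (simp only:) simp
  qed
  ultimately show ?case by (simp only:)
next
  case (Suc q)
  let ?G = "\<lambda>x. cos (x / 2) ^ (2 * (p + 1)) * sin (x / 2) ^ (2 * (q + 1)) :: real"
  have "has_bochner_integral lborel (\<lambda>\<theta>. indicator {0..pi} \<theta> *\<^sub>R
      (((q + 1) * (half_angle_monomial (Suc p) q \<theta> * sin \<theta>) - (p + 1) * (half_angle_monomial p (Suc q) \<theta> * sin \<theta>))))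
     (2 * ?G pi - 2 * ?G 0)"
  proof (rule has_bochner_integral_FTC_Icc)
    fix x :: real
    let ?c = "cos (x / 2)" and ?s = "sin (x / 2)"
    define P Q X Y where "P = real p + 1" and "Q = real q + 1" and "X = ?c ^ (2 * p)" and "Y = ?s ^ (2 * q)"
    note PQ = P_def Q_def X_def Y_def
    have "(?G has_real_derivative
       (real (2 * (p + 1)) * (?c ^ (2 * p + 1) * (- ?s * (1 / 2)))) * ?s ^ (2 * (q + 1))
       + (real (2 * (q + 1)) * (?s ^ (2 * q + 1) * (?c * (1 / 2)))) * ?c ^ (2 * (p + 1))) (at x within {0..pi})"
      by (auto intro!: derivative_eq_intros simp: mult_ac simp del: power_Suc)
    then have "((\<lambda>x. 2 * ?G x) has_real_derivative
       2 * ((real (2 * (p + 1)) * (?c ^ (2 * p + 1) * (- ?s * (1 / 2)))) * ?s ^ (2 * (q + 1))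
       + (real (2 * (q + 1)) * (?s ^ (2 * q + 1) * (?c * (1 / 2)))) * ?c ^ (2 * (p + 1)))) (at x within {0..pi})"
      by (rule DERIV_cmult)
    also have "2 * ((real (2 * (p + 1)) * (?c ^ (2 * p + 1) * (- ?s * (1 / 2)))) * ?s ^ (2 * (q + 1))
       + (real (2 * (q + 1)) * (?s ^ (2 * q + 1) * (?c * (1 / 2)))) * ?c ^ (2 * (p + 1)))
       = 2 * ((2 * P * (X * ?c * (- ?s * (1 / 2)))) * (Y * ?s * ?s)
       + (2 * Q * (Y * ?s * (?c * (1 / 2)))) * (X * ?c * ?c))"
      by (simp add: PQ mult_ac add_ac)
    also have "\<dots> = Q * (X * ?c * ?c * Y * (2 * ?s * ?c)) - P * (X * Y * ?s * ?s * (2 * ?s * ?c))"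
      by (simp add: algebra_simps)
    also have "\<dots> = (q + 1) * (half_angle_monomial (Suc p) q x * sin x) - (p + 1)
        * (half_angle_monomial p (Suc q) x * sin x)"
      using sin_double[of "x / 2"] by (simp add: half_angle_monomial_def PQ mult_ac add_ac)
    finally show "((\<lambda>x. 2 * ?G x) has_vector_derivative
       (q + 1) * (half_angle_monomial (Suc p) q x * sin x) - (p + 1) * (half_angle_monomial p (Suc q) x
           * sin x)) (at x within {0..pi})"
      by (simp add: has_real_derivative_iff_has_vector_derivative)
  qed (auto intro!: continuous_intros)
  then have 1: "has_bochner_integral lborel (\<lambda>\<theta>. indicator {0..pi} \<theta> *\<^sub>R
      (((q + 1) * (half_angle_monomial (Suc p) q \<theta> * sin \<theta>) - (p + 1) * (half_angle_monomial p (Suc q) \<theta> * sin \<theta>)))) 0"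
    by simp
  have "has_bochner_integral lborel (\<lambda>\<theta>. (1 / (p + 1)) * ((q + 1)
      * (indicator {0..pi} \<theta> *\<^sub>R (half_angle_monomial (Suc p) q \<theta> * sin \<theta>))
      - indicator {0..pi} \<theta> *\<^sub>R
      (((q + 1) * (half_angle_monomial (Suc p) q \<theta> * sin \<theta>) - (p + 1) * (half_angle_monomial p (Suc q) \<theta> * sin \<theta>)))))
      ((1 / (p + 1)) * ((q + 1) * (2 * fact (Suc p) * fact q / fact (Suc p + q + 1)) - 0))"
    by (intro has_bochner_integral_mult_right has_bochner_integral_diff Suc.IH 1)
  also have "(\<lambda>\<theta>. (1 / (p + 1)) * ((q + 1) * (indicator {0..pi} \<theta> *\<^sub>R (half_angle_monomial (Suc p) q \<theta> * sin \<theta>))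
      - indicator {0..pi} \<theta> *\<^sub>R
      (((q + 1) * (half_angle_monomial (Suc p) q \<theta> * sin \<theta>) - (p + 1) * (half_angle_monomial p (Suc q) \<theta> * sin \<theta>)))))
      = (\<lambda>\<theta>. indicator {0..pi} \<theta> *\<^sub>R (half_angle_monomial p (Suc q) \<theta> * sin \<theta>))"
    by (rule ext) (simp add: field_simps indicator_def)
  also have "(1 / (p + 1)) * ((q + 1) * (2 * fact (Suc p) * fact q / fact (Suc p + q + 1)) - 0)
     = 2 * fact p * fact (Suc q) / fact (p + Suc q + 1)"
  proof -
    define Z :: real where "Z = fact (p + q + 2)"
    define P where "P = real p + 1"
    have "fact (Suc p + q + 1) = Z" "fact (p + Suc q + 1) = Z" "fact (Suc p) = P * fact p" "P \<noteq> 0" "real p + 1 = P"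
      by (simp_all add: Z_def P_def del: of_nat_Suc)
    moreover have "fact (Suc q) = (real q + 1) * fact q" by simp
    ultimately show ?thesis by (simp only: of_nat_add of_nat_1) simp
  qed
  finally show ?case .
qed

text \<open>Picture the diagonals on which \<open>p - q\<close> is constant. Two neighbouring ones
  yield the next on either side, so the diagonals \<open>T\<close> and \<open>T + 1\<close> spread
  one way by \<open>up\<close> and the other way by \<open>down\<close>. The second movement stays
  within \<open>p >= T\<close>; for monomials this is divisibility by the \<open>T\<close>-th power
  of the squared cosine.\<close>

lemma nat_grid_ideal:
  fixes E :: "nat \<Rightarrow> nat \<Rightarrow> bool"
  assumes up: "\<And>p q. E p q \<Longrightarrow> E p (Suc q) \<Longrightarrow> E (Suc p) q"
    and down: "\<And>p q. E p q \<Longrightarrow> E (Suc p) q \<Longrightarrow> E p (Suc q)"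
    and base: "\<And>i. E (T + i) i" "\<And>i. E (Suc (T + i)) i"
  shows "E (T + i) k"
proof -
  \<comment> \<open>\<open>d\<close> counts the diagonals above \<open>T\<close>.\<close>
  have U: "E (T + (k + d)) k \<and> E (Suc (T + (k + d))) k" for d k
  proof (induction d arbitrary: k)
    case 0
    then show ?case using base[of k] by simp
  next
    case (Suc d)
    show ?case using up[of "Suc (T + (k + d))" k] Suc.IH[of k] Suc.IH[of "Suc k"] by simp
  qed
  \<comment> \<open>\<open>d\<close> counts the diagonals below \<open>T\<close>. The induction is
    strong because each diagonal is built from the two preceding ones.\<close>
  have D: "E (T + i) (i + d)" for d i
  proof (induction d arbitrary: i rule: less_induct)
    case (less d)
    show ?case
    proof (cases d)
      case 0
      then show ?thesis using base(1)[of i] by simp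
    next
      case (Suc e)
      have "E (T + i) (i + e)" using less[of e i] Suc by simp
      moreover have "E (Suc (T + i)) (i + e)"
      proof (cases e)
        case 0
        then show ?thesis using base(2)[of i] by simp
      next
        case (Suc e')
        then show ?thesis using less[of e' "Suc i"] \<open>d = Suc e\<close> by simp
      qed
      ultimately show ?thesis using down Suc by simp
    qed
  qed
  show ?thesis
    using U[of k "i - k"] D[of i "k - i"] by (cases "k \<le> i") simp_all
qed

text \<open>As soon as \<open>p + q >= 2 * T\<close>, one coordinate is at least \<open>T\<close>
  and \<open>nat_grid_ideal\<close> or its mirror image applies. The finitely many remaining points
  follow by descending on \<open>p + q\<close> through \<open>merge\<close>.\<close>

lemma nat_grid_closure:
  fixes E :: "nat \<Rightarrow> nat \<Rightarrow> bool"
  assumes up: "\<And>p q. E p q \<Longrightarrow> E p (Suc q) \<Longrightarrow> E (Suc p) q"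
    and down: "\<And>p q. E p q \<Longrightarrow> E (Suc p) q \<Longrightarrow> E p (Suc q)"
    and merge: "\<And>p q. E (Suc p) q \<Longrightarrow> E p (Suc q) \<Longrightarrow> E p q"
    and base: "\<And>i. E (T + i) i" "\<And>i. E (Suc (T + i)) i" "\<And>i. E i (T + i)" "\<And>i. E i (Suc (T + i))"
  shows "E p q"
proof (induction "2 * T - (p + q)" arbitrary: p q)
  case 0
  then consider "T \<le> p" | "T \<le> q" by linarith
  then show ?case
  proof cases
    case 1
    then show ?thesis
      using nat_grid_ideal[of E T "p - T" q, OF up down base(1,2)] by simp
  next
    case 2
    then show ?thesis
      using nat_grid_ideal[of "\<lambda>p q. E q p" T "q - T" p, OF down up base(3,4)] by simp
  qed
next
  case (Suc n)
  show ?case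
    by (rule merge; rule Suc.hyps(1)) (use Suc.hyps(2) in linarith)+
qed

text \<open>Brings the two terms of the \<open>k\<close>-sum in degree \<open>l + 1\<close> to a
  common denominator. The factors \<open>fact 0\<close> and \<open>fact 1\<close> keep the shape of
  Wigner's formula. The case \<open>m = l\<close> uses it directly, the case \<open>m = - l\<close>
  with \<open>a\<close> and \<open>b\<close> exchanged.\<close>

lemma two_term_sum:
  fixes R e C S :: real
  shows "R * (e * C ^ (a + 2) * S ^ b / (fact (Suc a) * fact 0 * fact b * fact 1)
        + e * (- 1) * C ^ a * S ^ (b + 2) / (fact a * fact 1 * fact (Suc b) * fact 0))
     = e * R / (fact (Suc a) * fact (Suc b)) * C ^ a * S ^ b * ((b + 1) * C\<^sup>2 - (a + 1) * S\<^sup>2)"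
proof -
  have cancel: "x / (A * B) = y * x / (A * (y * B))" "x / (A * B) = y * x / (y * A * B)" if "y \<noteq> 0" for x y A B :: real
    using that by simp_all
  have "C ^ (a + 2) * S ^ b / (fact (Suc a) * fact b) = (b + 1) * (C ^ (a + 2) * S ^ b) / (fact (Suc a) * fact (Suc b))"
    using cancel(1)[of "real (b + 1)" "C ^ (a + 2) * S ^ b" "fact (Suc a)" "fact b"] by (simp only: fact_Suc) simp
  moreover have "C ^ a * S ^ (b + 2) / (fact a * fact (Suc b)) = (a + 1) * (C ^ a * S ^ (b
      + 2)) / (fact (Suc a) * fact (Suc b))"
    using cancel(2)[of "real (a + 1)" "C ^ a * S ^ (b + 2)" "fact a" "fact (Suc b)"] by (simp only: fact_Suc) simp
  ultimately have "R * (e * (C ^ (a + 2) * S ^ b / (fact (Suc a) * fact b)) - e * (C ^ a * S ^ (b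
      + 2) / (fact a * fact (Suc b))))
     = R * (e * ((b + 1) * (C ^ (a + 2) * S ^ b) / (fact (Suc a) * fact (Suc b))) - e * ((a + 1) * (C ^ a
         * S ^ (b + 2)) / (fact (Suc a) * fact (Suc b))))"
    by (simp only:)
  also have "\<dots> = e * R / (fact (Suc a) * fact (Suc b)) * C ^ a * S ^ b * ((b + 1) * C\<^sup>2 - (a + 1) * S\<^sup>2)"
    by (simp add: algebra_simps diff_divide_distrib add_divide_distrib power2_eq_square del: fact_Suc)
  finally show ?thesis by (simp add: mult_ac add_ac del: fact_Suc)
qed

text \<open>For \<open>m = \<plusminus>l\<close> the \<open>k\<close>-sum has one term at degree \<open>l\<close> and two terms at degree \<open>l + 1\<close>.\<close>

lemma wigner_d_top:
  assumes "int a = int l + n" "int b = int l - n"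
  shows "wigner_d l (int l) n \<beta> = (-1) ^ b * sqrt (fact (2 * l) * fact a * fact b) / (fact a * fact b)
      * cos (\<beta> / 2) ^ a * sin (\<beta> / 2) ^ b"
proof -
  have set: "{max 0 (n - int l)..min (int l + n) (int l - int l)} = {0}"
    using assms by (auto simp: max_def min_def)
  have nats: "nat (int l + int l) = 2 * l" "nat (int l + n) = a" "nat (int l - n) = b"
      "nat (2 * int l + n - int l - 2 * 0) = a" "nat (int l - n + 0) = b" "nat (int l - n + 2 * 0)
          = b" "nat (int l + n - 0) = a"
    using assms by auto
  show ?thesis
    unfolding wigner_d_def Let_def set
    by (simp only: nats sum.insert sum.empty finite.emptyI empty_iff not_False_eq_True nat_0 diff_self) simp
qed

lemma wigner_d_top_Suc:
  assumes "int a = int l + n" "int b = int l - n"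
  shows "wigner_d (Suc l) (int l) n \<beta> = (-1) ^ b * sqrt (fact (2 * l + 1) * fact (Suc a)
      * fact (Suc b)) / (fact (Suc a) * fact (Suc b))
     * cos (\<beta> / 2) ^ a * sin (\<beta> / 2) ^ b * ((b + 1) * (cos (\<beta> / 2))\<^sup>2 - (a + 1) * (sin (\<beta> / 2))\<^sup>2)"
proof -
  have set: "{max 0 (n - int l)..min (int (Suc l) + n) (int (Suc l) - int l)} = {0, 1}"
    using assms by (auto simp: max_def min_def)
  have nats: "nat (int (Suc l) + int l) = 2 * l + 1" "nat (int (Suc l) - int l) = 1" "nat (int (Suc l) + n)
      = Suc a" "nat (int (Suc l) - n) = Suc b"
      "nat (2 * int (Suc l) + n - int l - 2 * 0) = a + 2" "nat (2 * int (Suc l) + n - int l - 2 * 1) = a"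
      "nat (int l - n + 0) = b" "nat (int l - n + 1) = b + 1" "nat (int l - n + 2 * 0) = b" "nat (int l - n
          + 2 * 1) = b + 2"
      "nat (int (Suc l) + n - 0) = Suc a" "nat (int (Suc l) + n - 1) = a" "nat (int (Suc l) - int l - 0) = 1"
      "nat (int (Suc l) - int l - 1) = 0"
    using assms by auto
  show ?thesis
    unfolding wigner_d_def Let_def set
    using two_term_sum[of "sqrt (fact (2 * l + 1) * fact 1 * fact (Suc a)
        * fact (Suc b))" "(- 1) ^ b" "cos (\<beta> / 2)" a "sin (\<beta> / 2)" b]
    by (subst sum.insert) (simp_all only: nats sum.insert sum.empty finite.emptyI empty_iff not_False_eq_True
        nat_0 nat_1,
        simp_all add: mult_ac add_ac del: fact_Suc)
qed

lemma wigner_d_bot: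
  assumes "int a = int l + n" "int b = int l - n"
  shows "wigner_d l (- int l) n \<beta> = sqrt (fact (2 * l) * fact a * fact b) / (fact a * fact b)
      * cos (\<beta> / 2) ^ b * sin (\<beta> / 2) ^ a"
proof -
  have set: "{max 0 (n - - int l)..min (int l + n) (int l - - int l)} = {int a}"
    using assms by (auto simp: max_def min_def)
  have nats: "nat (int l - - int l) = 2 * l" "nat (int l + - int l) = 0" "nat (int l + n) = a" "nat (int l - n) = b"
      "nat (2 * int l + n - - int l - 2 * int a) = b" "nat (- int l - n + int a) = 0" "nat (- int l - n + 2
          * int a) = a"
      "nat (int l + n - int a) = 0" "nat (int l - - int l - int a) = b"
    using assms by auto
  show ?thesis
    unfolding wigner_d_def Let_def set
    by (simp only: nats sum.insert sum.empty finite.emptyI empty_iff not_False_eq_True nat_int) (simp add: mult_ac)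
qed

lemma wigner_d_bot_Suc:
  assumes "int a = int l + n" "int b = int l - n"
  shows "wigner_d (Suc l) (- int l) n \<beta> = sqrt (fact (2 * l + 1) * fact (Suc a)
      * fact (Suc b)) / (fact (Suc a) * fact (Suc b))
     * cos (\<beta> / 2) ^ b * sin (\<beta> / 2) ^ a * ((a + 1) * (cos (\<beta> / 2))\<^sup>2 - (b + 1) * (sin (\<beta> / 2))\<^sup>2)"
proof -
  have set: "{max 0 (n - - int l)..min (int (Suc l) + n) (int (Suc l) - - int l)} = {int a, int a + 1}"
    using assms by (auto simp: max_def min_def)
  have nats: "nat (int (Suc l) - - int l) = 2 * l + 1" "nat (int (Suc l) + - int l) = 1" "nat (int (Suc l)
      + n) = Suc a" "nat (int (Suc l) - n) = Suc b"
      "nat (2 * int (Suc l) + n - - int l - 2 * int a) = b + 2" "nat (2 * int (Suc l) + n - - int l - 2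
          * (int a + 1)) = b"
      "nat (- int l - n + int a) = 0" "nat (- int l - n + (int a + 1)) = 1"
      "nat (- int l - n + 2 * int a) = a" "nat (- int l - n + 2 * (int a + 1)) = a + 2"
      "nat (int (Suc l) + n - int a) = 1" "nat (int (Suc l) + n - (int a + 1)) = 0"
      "nat (int (Suc l) - - int l - int a) = Suc b" "nat (int (Suc l) - - int l - (int a + 1))
          = b" "nat (int a + 1) = Suc a"
    using assms by auto
  show ?thesis
    unfolding wigner_d_def Let_def set
    using two_term_sum[of "sqrt (fact (2 * l + 1) * fact 1 * fact (Suc a)
        * fact (Suc b))" 1 "cos (\<beta> / 2)" b "sin (\<beta> / 2)" a]
    by (subst sum.insert) (simp_all only: nats sum.insert sum.empty finite.emptyI empty_iff not_False_eq_True nat_int,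
        simp_all add: mult_ac add_ac del: fact_Suc)
qed

text \<open>For equal orders the phases and signs cancel. Hence these cubature identities test
  functions of the colatitude alone, wherever the longitudes of the nodes lie.\<close>

lemma spin_harmonic_mult_cnj:
  "spin_harmonic s l m x * cnj (spin_harmonic s l' m x)
   = of_real (sqrt ((2 * real l + 1) / (4 * pi)) * sqrt ((2 * real l' + 1) / (4 * pi)) *
       (wigner_d l (- m) s (colatitude x) * wigner_d l' (- m) s (colatitude x)))"
proof -
  have sq: "(-1::real) powi m * (-1) powi m = 1"
    by (simp flip: power_int_mult_distrib)
  have c: "cis t * cis (- t) = 1" for t by (simp add: cis_mult)
  have "spin_harmonic s l m x * cnj (spin_harmonic s l' m x)
    = of_real ((-1) powi m * (-1) powi m) * (cis (of_int m * longitude x) * cis (- (of_int m * longitude x))) *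
      of_real (sqrt ((2 * real l + 1) / (4 * pi)) * sqrt ((2 * real l' + 1) / (4 * pi)) *
       (wigner_d l (- m) s (colatitude x) * wigner_d l' (- m) s (colatitude x)))"
    by (simp add: spin_harmonic_def cis_cnj mult_ac)
  then show ?thesis by (simp only: sq c of_real_1 mult_1_left)
qed

text \<open>All half-angle exponents of one Wigner function have the parity of \<open>m - n\<close>,
  so those of a product of two are even.\<close>

lemma wigner_d_mult_expand:
  assumes "\<bar>m\<bar> \<le> int l" "\<bar>m\<bar> \<le> int l'" "\<bar>n\<bar> \<le> int l" "\<bar>n\<bar> \<le> int l'"
  obtains I :: "(int \<times> int) set" and c :: "int \<times> int \<Rightarrow> real" and p q where "finite I"
    "\<And>\<beta>. wigner_d l m n \<beta> * wigner_d l' m n \<beta> = (\<Sum>i\<in>I. c i * half_angle_monomial (p i) (q i) \<beta>)"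
proof -
  define S where "S L = {max 0 (n - m)..min (int L + n) (int L - m)}" for L
  define coef where "coef L k = (-1) ^ nat (m - n + k) / (fact (nat (int L + n - k)) * fact (nat k)
      * fact (nat (m - n + k)) * fact (nat (int L - m - k)) :: real)" for L k
  define R where "R L = sqrt (fact (nat (int L + m)) * fact (nat (int L - m)) * fact (nat (int L + n))
      * fact (nat (int L - n)))" for L
  define g where "g L k \<beta> = cos (\<beta> / 2) ^ nat (2 * int L + n - m - 2 * k) * sin (\<beta> / 2) ^ nat (m - n + 2 * k)"
      for L k and \<beta> :: real
  have w: "wigner_d L m n \<beta> = R L * (\<Sum>k\<in>S L. coef L k * g L k \<beta>)" for L \<beta>
    unfolding wigner_d_def Let_def R_def S_def coef_def g_def by (simp add: mult_ac)
  define p where "p = (\<lambda>(k, k'). nat (int l + int l' + n - m - k - k'))"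
  define q where "q = (\<lambda>(k, k'). nat (m - n + k + k'))"
  have g: "g l k \<beta> * g l' k' \<beta> = half_angle_monomial (p (k, k')) (q (k, k')) \<beta>" if "k \<in> S l" "k' \<in> S l'" for k k' \<beta>
  proof -
    have nn: "nat (2 * int l + n - m - 2 * k) + nat (2 * int l' + n - m - 2 * k') = 2 * p (k, k')"
      "nat (m - n + 2 * k) + nat (m - n + 2 * k') = 2 * q (k, k')"
      using that assms by (auto simp: S_def p_def q_def)
    then show ?thesis
      unfolding g_def half_angle_monomial_def nn[symmetric] power_add by (simp only: mult_ac)
  qed
  have "wigner_d l m n \<beta> * wigner_d l' m n \<beta>
     = (\<Sum>i\<in>S l \<times> S l'. (R l * R l' * (case i of (k, k') \<Rightarrow> coef l k * coef l' k'))
         * half_angle_monomial (p i) (q i) \<beta>)" for \<beta>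
  proof -
    have "wigner_d l m n \<beta> * wigner_d l' m n \<beta>
       = R l * R l' * ((\<Sum>k\<in>S l. coef l k * g l k \<beta>) * (\<Sum>k'\<in>S l'. coef l' k' * g l' k' \<beta>))"
      unfolding w by (simp add: mult_ac)
    also have "\<dots> = (\<Sum>k\<in>S l. \<Sum>k'\<in>S l'. R l * R l' * (coef l k * coef l' k') * (g l k \<beta> * g l' k' \<beta>))"
      by (subst sum_product, unfold sum_distrib_left, intro sum.cong refl) (simp only: mult_ac)
    also have "\<dots> = (\<Sum>k\<in>S l. \<Sum>k'\<in>S l'. R l * R l' * (coef l k * coef l' k')
        * half_angle_monomial (p (k, k')) (q (k, k')) \<beta>)"
      by (intro sum.cong refl) (simp add: g)
    also have "\<dots> = (\<Sum>i\<in>S l \<times> S l'. (R l * R l' * (case i of (k, k') \<Rightarrow> coef l k * coef l' k'))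
        * half_angle_monomial (p i) (q i) \<beta>)"
      by (simp add: sum.cartesian_product case_prod_unfold)
    finally show ?thesis .
  qed
  then show thesis by (intro that[of "S l \<times> S l'"]) (auto simp: S_def)
qed

lemma cubature_exact:
  assumes "cubature_system s B K \<xi> w"
    and "\<bar>s\<bar> \<le> int l" "\<bar>s\<bar> \<le> int l'" "\<bar>m\<bar> \<le> int l" "\<bar>m'\<bar> \<le> int l'"
    and "sqrt (spin_eigenvalue s l) \<le> B ^ (j + 1)" "sqrt (spin_eigenvalue s l') \<le> B ^ (j + 1)"
  shows "(\<Sum>k<K j. of_real (w j k) * spin_harmonic s l m (\<xi> j k) * cnj (spin_harmonic s l' m' (\<xi> j k)))
    = (if l = l' \<and> m = m' then 1 else 0)"
proof -
  have "\<forall>j l l' m m'.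
        \<bar>s\<bar> \<le> int l \<and> \<bar>s\<bar> \<le> int l' \<and> \<bar>m\<bar> \<le> int l \<and> \<bar>m'\<bar> \<le> int l' \<and>
        sqrt (spin_eigenvalue s l) \<le> B ^ (j + 1) \<and> sqrt (spin_eigenvalue s l') \<le> B ^ (j + 1) \<longrightarrow>
        (\<Sum>k<K j. of_real (w j k) * spin_harmonic s l m (\<xi> j k) * cnj (spin_harmonic s l' m' (\<xi> j k)))
          = (if l = l' \<and> m = m' then 1 else 0)"
    using assms(1) unfolding cubature_system_def by (elim conjE)
  from this[rule_format, OF conjI[OF assms(2) conjI[OF assms(3) conjI[OF assms(4) conjI[OF assms(5) conjI[OF
      assms(6,7)]]]]]]
  show ?thesis .
qed

lemma two_pi_neq_0: "2 * pi \<noteq> 0"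
  by simp

section \<open>The cubature rule tested on functions of the colatitude\<close>

context
  fixes s :: int and B :: real and K :: "nat \<Rightarrow> nat" and \<xi> :: "nat \<Rightarrow> nat \<Rightarrow> real ^ 3" and w :: "nat \<Rightarrow> nat \<Rightarrow> real"
  assumes B: "1 < B" and cub: "cubature_system s B K \<xi> w"
begin

definition quadrature :: "nat \<Rightarrow> (real \<Rightarrow> real) \<Rightarrow> real" where
  "quadrature j f = (\<Sum>k<K j. w j k * f (colatitude (\<xi> j k)))"

lemma quadrature_linear:
  "quadrature j (\<lambda>\<theta>. f \<theta> + g \<theta>) = quadrature j f + quadrature j g"
  "quadrature j (\<lambda>\<theta>. c * f \<theta>) = c * quadrature j f"
  "quadrature j (\<lambda>\<theta>. \<Sum>i\<in>I. h i \<theta>) = (\<Sum>i\<in>I. quadrature j (h i))"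
  by (simp_all add: quadrature_def sum.distrib algebra_simps sum_distrib_left) (rule sum.swap)

text \<open>Two fixed degrees lie below the growing bound \<open>B ^ (j + 1)\<close> from some level
  on. The value \<open>4 * pi / (2 * l + 1)\<close> is the reciprocal of the squared normalising
  factor of the harmonics.\<close>

lemma eventually_quadrature_wigner:
  assumes "\<bar>m\<bar> \<le> int l" "\<bar>m\<bar> \<le> int l'" "\<bar>s\<bar> \<le> int l" "\<bar>s\<bar> \<le> int l'"
  shows "eventually (\<lambda>j. quadrature j (\<lambda>\<theta>. wigner_d l m s \<theta> * wigner_d l' m s \<theta>)
      = (if l = l' then 4 * pi / (2 * real l + 1) else 0)) sequentially"
proof -
  let ?e = "\<lambda>l. sqrt (spin_eigenvalue s l)"
  obtain n where n: "max (?e l) (?e l') < B ^ n"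
    using real_arch_pow[OF B] by blast
  show ?thesis
  proof (rule eventually_sequentiallyI[of n])
    fix j assume "n \<le> j"
    then have "B ^ n \<le> B ^ (j + 1)" using B by (intro power_increasing) auto
    then have le: "?e l \<le> B ^ (j + 1)" "?e l' \<le> B ^ (j + 1)" using n by auto
    define c where "c l = sqrt ((2 * real l + 1) / (4 * pi))" for l
    have c: "c l > 0" for l by (simp add: c_def)
    \<comment> \<open>Order \<open>- m\<close>, since the harmonic of order \<open>m\<close>
      contains the Wigner function of index \<open>- m\<close>.\<close>
    have "(\<Sum>k<K j. of_real (w j k) * spin_harmonic s l (- m) (\<xi> j k) * cnj (spin_harmonic s l' (- m) (\<xi> j k)))
       = (if l = l' then 1 else 0 :: complex)"
      using cubature_exact[OF cub, of l l' "- m" "- m" j] assms le by simp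
    also have "(\<Sum>k<K j. of_real (w j k) * spin_harmonic s l (- m) (\<xi> j k) * cnj (spin_harmonic s l' (- m) (\<xi> j k)))
       = of_real (c l * c l' * quadrature j (\<lambda>\<theta>. wigner_d l m s \<theta> * wigner_d l' m s \<theta>))"
      unfolding quadrature_def sum_distrib_left of_real_sum
      by (intro sum.cong refl, subst mult.assoc, subst spin_harmonic_mult_cnj) (simp add: c_def)
    finally have "complex_of_real (c l * c l' * quadrature j (\<lambda>\<theta>. wigner_d l m s \<theta> * wigner_d l' m s \<theta>))
        = of_real (if l = l' then 1 else 0)" by simp
    then have *: "c l * c l' * quadrature j (\<lambda>\<theta>. wigner_d l m s \<theta> * wigner_d l' m s \<theta>) = (if l = l' then 1 else 0)"
      unfolding of_real_eq_iff .
    have cc: "c l * c l = (2 * real l + 1) / (4 * pi)" by (simp add: c_def)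
    show "quadrature j (\<lambda>\<theta>. wigner_d l m s \<theta> * wigner_d l' m s \<theta>) = (if l = l' then 4 * pi / (2 * real l + 1) else 0)"
    proof (cases "l = l'")
      case True
      then show ?thesis using * unfolding True[symmetric] cc by (simp add: field_simps)
    next
      case False
      then show ?thesis using * c[of l] c[of l'] by simp
    qed
  qed
qed

text \<open>The right-hand side is the integral of the monomial over the sphere, with
  \<open>2 * pi\<close> from the longitude. The level from which equality holds may depend on
  \<open>p\<close> and \<open>q\<close>.\<close>

definition exact_eventually :: "nat \<Rightarrow> nat \<Rightarrow> bool" where
  "exact_eventually p q \<longleftrightarrow> eventually (\<lambda>j. quadrature j (half_angle_monomial p q)
     = 2 * pi * (2 * fact p * fact q / fact (p + q + 1))) sequentially"

text \<open>The exact integrals split like the quadrature values. So exactness at two of the points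
  \<open>(p, q)\<close>, \<open>(p + 1, q)\<close> and \<open>(p, q + 1)\<close> forces it at the
  third, which supplies the closure rules on the grid.\<close>

lemma moment_split:
  "(2 * fact p * fact q / fact (p + q + 1) :: real) = 2 * fact (Suc p) * fact q / fact (Suc p + q + 1) + 2
      * fact p * fact (Suc q) / fact (p + Suc q + 1)"
  (is "?L = ?R")
proof -
  have "fact (Suc p + q + 1) = (real p + real q + 2) * fact (p + q + 1)" by simp
  moreover have "fact (p + Suc q + 1) = (real p + real q + 2) * fact (p + q + 1)" by simp
  ultimately have "?R = (2 * fact p * fact q * (real p + real q + 2)) / ((real p + real q + 2) * fact (p + q + 1))"
    by (simp only: add_divide_distrib[symmetric] fact_Suc) (simp add: algebra_simps)
  also have "\<dots> = ?L" by (simp del: fact_Suc)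
  finally show ?thesis ..
qed

lemma quadrature_split:
  "quadrature j (half_angle_monomial p q) = quadrature j (half_angle_monomial (Suc p) q)
      + quadrature j (half_angle_monomial p (Suc q))"
  unfolding quadrature_linear(1)[symmetric]
  by (rule arg_cong[where f="quadrature j"]) (rule ext, rule half_angle_monomial_split)

text \<open>The square of an extreme Wigner function is a single monomial: for \<open>m = l\<close>
  it is the binomial coefficient of \<open>a + b\<close> over \<open>a\<close> times the monomial
  with exponents \<open>a\<close> and \<open>b\<close>; for \<open>m = - l\<close> the exponents
  swap. Normalisation under the cubature fixes its quadrature value, which turns out to be the Beta
  value.\<close>

lemma exact_eventually_top:
  assumes "int a = int l + s" "int b = int l - s"
  shows "exact_eventually a b" "exact_eventually b a"
proof -
  have l: "2 * l = a + b" and s: "\<bar>s\<bar> \<le> int l" using assms by auto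
  have r: "real l = (real a + real b) / 2" using arg_cong[OF l, of real] by simp
  define c where "c = fact (a + b) / (fact a * fact b :: real)"
  have c: "c \<noteq> 0" by (simp add: c_def)
  have top: "wigner_d l (int l) s \<theta> * wigner_d l (int l) s \<theta> = c * half_angle_monomial a b \<theta>"
    and bot: "wigner_d l (- int l) s \<theta> * wigner_d l (- int l) s \<theta> = c * half_angle_monomial b a \<theta>" for \<theta>
  proof -
    have sq: "sqrt (fact (2 * l) * fact a * fact b) * sqrt (fact (2 * l) * fact a * fact b) = fact (a + b)
        * fact a * fact b"
      unfolding l by simp
    have sg: "(-1::real) ^ b * (-1) ^ b = 1" by (simp flip: power_mult_distrib)
    have arr: "(e * R / (f * g) * x ^ a * y ^ b) * (e * R / (f * g) * x ^ a * y ^ b) = (e * e) * (R * R) / (f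
        * g * (f * g)) * (x ^ (2 * a) * y ^ (2 * b))"
      for e R f g x y :: real and a b by (simp add: power_mult power2_eq_square power_mult_distrib mult_ac)
    show "wigner_d l (int l) s \<theta> * wigner_d l (int l) s \<theta> = c * half_angle_monomial a b \<theta>"
      unfolding wigner_d_top[OF assms] arr sq sg half_angle_monomial_def c_def by simp
    show "wigner_d l (- int l) s \<theta> * wigner_d l (- int l) s \<theta> = c * half_angle_monomial b a \<theta>"
      using arr[of 1 "sqrt (fact (2 * l) * fact a * fact b)" "fact a" "fact b" "cos (\<theta> / 2)" b "sin (\<theta> / 2)" a]
      unfolding wigner_d_bot[OF assms] sq half_angle_monomial_def c_def by simp
  qed
  have val: "q = 2 * pi * (2 * fact a * fact b / fact (a + b + 1))" if "c * q = 4 * pi / (2 * real l + 1)" for q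
  proof -
    have "q = 4 * pi / (2 * real l + 1) / c" using that c by (simp add: nonzero_eq_divide_eq mult_ac)
    also have "\<dots> = 2 * pi * (2 * fact a * fact b / fact (a + b + 1))"
    proof -
      define N where "N = 2 * real l + 1"
      have N: "N > 0" "fact (a + b + 1) = N * fact (a + b)"
        by (simp add: N_def, simp add: N_def r)
      show ?thesis unfolding c_def N_def[symmetric] N(2) using N(1) by (simp add: field_simps)
    qed
    finally show ?thesis .
  qed
  have "eventually (\<lambda>j. c * quadrature j (half_angle_monomial a b) = 4 * pi / (2 * real l + 1)) sequentially"
    using eventually_quadrature_wigner[of "int l" l l] s unfolding top quadrature_linear(2) by simp
  then show "exact_eventually a b"
    unfolding exact_eventually_def by (rule eventually_mono) (rule val)
  have val': "q = 2 * pi * (2 * fact b * fact a / fact (b + a + 1))" if "c * q = 4 * pi / (2 * real l + 1)" for q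
    using val[OF that] by (simp only: mult_ac add_ac)
  have "eventually (\<lambda>j. c * quadrature j (half_angle_monomial b a) = 4 * pi / (2 * real l + 1)) sequentially"
    using eventually_quadrature_wigner[of "- int l" l l] s unfolding bot quadrature_linear(2) by simp
  then show "exact_eventually b a"
    unfolding exact_eventually_def by (rule eventually_mono) (rule val')
qed

text \<open>The extreme function of degree \<open>l\<close> and the function of degree
  \<open>l + 1\<close> with the same order are orthogonal under the rule. This is one linear
  relation between the quadratures at \<open>(a + 1, b)\<close> and \<open>(a, b + 1)\<close>. Their
  sum is the quadrature at \<open>(a, b)\<close>, already known to be exact, so both are
  determined.\<close>

lemma exact_eventually_top_Suc:
  assumes "int a = int l + s" "int b = int l - s"
  shows "exact_eventually (Suc a) b" "exact_eventually a (Suc b)" "exact_eventually (Suc b) a"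
      "exact_eventually b (Suc a)"
proof -
  have s: "\<bar>s\<bar> \<le> int l" using assms by auto
  define R where "R = sqrt (fact (2 * l) * fact a * fact b) * sqrt (fact (2 * l + 1) * fact (Suc a)
      * fact (Suc b)) / (fact a * fact b * (fact (Suc a) * fact (Suc b)) :: real)"
  have R: "R \<noteq> 0" by (simp add: R_def)
  have sg: "(-1::real) ^ b * (-1) ^ b = 1" by (simp flip: power_mult_distrib)
  have arr: "(e * r / (f * g) * x ^ a * y ^ b) * (e * r' / (f' * g') * x ^ a * y ^ b * (u * x\<^sup>2 - v * y\<^sup>2))
      = (e * e) * (r * r' / (f * g * (f' * g'))) * (u * (x ^ (2 * Suc a) * y ^ (2 * b)) + (- v) * (x ^ (2 * a)
          * y ^ (2 * Suc b)))"
    for e r f g r' f' g' x y u v :: real and a b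
  proof -
    have "(e * q * x ^ a * y ^ b) * (e * q' * x ^ a * y ^ b * (u * x\<^sup>2 - v * y\<^sup>2))
      = (e * e) * (q * q') * (u * (x ^ (2 * Suc a) * y ^ (2 * b)) + (- v) * (x ^ (2 * a) * y ^ (2 * Suc b)))" for q q'
      by (simp add: power_mult power2_eq_square power_mult_distrib algebra_simps)
    from this[of "r / (f * g)" "r' / (f' * g')"] show ?thesis by simp
  qed
  have top: "wigner_d l (int l) s \<theta> * wigner_d (Suc l) (int l) s \<theta>
     = R * ((b + 1) * half_angle_monomial (Suc a) b \<theta> + (- real (a + 1)) * half_angle_monomial a (Suc b) \<theta>)" for \<theta>
    unfolding wigner_d_top[OF assms] wigner_d_top_Suc[OF assms] arr sg half_angle_monomial_def R_def
        by (simp add: algebra_simps del: fact_Suc)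
  have bot: "wigner_d l (- int l) s \<theta> * wigner_d (Suc l) (- int l) s \<theta>
     = R * ((a + 1) * half_angle_monomial (Suc b) a \<theta> + (- real (b + 1)) * half_angle_monomial b (Suc a) \<theta>)" for \<theta>
    using arr[of 1 "sqrt (fact (2 * l) * fact a * fact b)" "fact a" "fact b" "cos (\<theta> / 2)" b "sin (\<theta> / 2)" a
        "sqrt (fact (2 * l + 1) * fact (Suc a) * fact (Suc b))" "fact (Suc a)" "fact (Suc b)" "a + 1" "b + 1"]
    unfolding wigner_d_bot[OF assms] wigner_d_bot_Suc[OF assms] half_angle_monomial_def R_def
        by (simp add: algebra_simps del: fact_Suc)
  have solve: "exact_eventually (Suc p) q \<and> exact_eventually p (Suc q)"
    if E: "exact_eventually p q"
      and cross: "eventually (\<lambda>j. real (q + 1) * quadrature j (half_angle_monomial (Suc p) q) = real (p + 1)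
          * quadrature j (half_angle_monomial p (Suc q))) sequentially" for p q
  proof -
    define Z :: real where "Z = fact (p + q + 1)"
    have "Z > 0" by (simp add: Z_def)
    have vals: "2 * fact (Suc p) * fact q / fact (Suc p + q + 1) = 2 * (real p + 1) * fact p
        * fact q / ((real p + real q + 2) * Z)"
      "2 * fact p * fact (Suc q) / fact (p + Suc q + 1) = 2 * (real q + 1) * fact p * fact q / ((real p
          + real q + 2) * Z)"
      by (simp_all add: Z_def mult_ac add_ac)
    have "eventually (\<lambda>j. quadrature j (half_angle_monomial (Suc p) q) = 2 * pi * (2 * fact (Suc p)
        * fact q / fact (Suc p + q + 1))
       \<and> quadrature j (half_angle_monomial p (Suc q)) = 2 * pi * (2 * fact p * fact (Suc q) / fact (p + Suc q
           + 1))) sequentially"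
      using E[unfolded exact_eventually_def] cross
    proof eventually_elim
      case (elim j)
      let ?X = "quadrature j (half_angle_monomial (Suc p) q)" and ?Y = "quadrature j (half_angle_monomial p (Suc q))"
      have sum: "?X + ?Y = 4 * pi * fact p * fact q / Z"
        using elim(1) unfolding quadrature_split[of j p q] by (simp add: Z_def)
      have cr: "(real q + 1) * ?X = (real p + 1) * ?Y" using elim(2) by (simp add: add_ac)
      have N: "x = r / (real p + real q + 2)" if "(real p + real q + 2) * x = r" for x r
      proof -
        have "real p + real q + 2 \<noteq> 0" by linarith
        then show ?thesis using that by (simp add: nonzero_eq_divide_eq mult.commute)
      qed
      have "(real p + real q + 2) * ?X = (real p + 1) * (?X + ?Y)" using cr by (simp add: algebra_simps)
      then have X: "?X = (real p + 1) * (4 * pi * fact p * fact q / Z) / (real p + real q + 2)"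
        unfolding sum by (rule N)
      have "(real p + real q + 2) * ?Y = (real q + 1) * (?X + ?Y)" using cr by (simp add: algebra_simps)
      then have Y: "?Y = (real q + 1) * (4 * pi * fact p * fact q / Z) / (real p + real q + 2)"
        unfolding sum by (rule N)
      define P' Q' N' where "P' = real p + 1" and "Q' = real q + 1" and "N' = real p + real q + 2"
      show ?case
        unfolding X Y vals P'_def[symmetric] Q'_def[symmetric] N'_def[symmetric] by (simp add: mult_ac)
    qed
    then show ?thesis unfolding exact_eventually_def by (auto elim: eventually_mono)
  qed
  have lin: "x = v * y" if "R * (x + (- v) * y) = 0" for x y v using R that by simp
  have "eventually (\<lambda>j. R * ((b + 1) * quadrature j (half_angle_monomial (Suc a) b) + (- real (a + 1))
      * quadrature j (half_angle_monomial a (Suc b))) = 0) sequentially"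
    using eventually_quadrature_wigner[of "int l" l "Suc l"] s unfolding top quadrature_linear by simp
  then have "eventually (\<lambda>j. (b + 1) * quadrature j (half_angle_monomial (Suc a) b) = (a + 1)
      * quadrature j (half_angle_monomial a (Suc b))) sequentially"
    by (rule eventually_mono) (rule lin)
  from solve[OF exact_eventually_top(1)[OF assms] this] show "exact_eventually (Suc a) b" "exact_eventually a
      (Suc b)" by auto
  have "eventually (\<lambda>j. R * ((a + 1) * quadrature j (half_angle_monomial (Suc b) a) + (- real (b + 1))
      * quadrature j (half_angle_monomial b (Suc a))) = 0) sequentially"
    using eventually_quadrature_wigner[of "- int l" l "Suc l"] s unfolding bot quadrature_linear by simp
  then have "eventually (\<lambda>j. (a + 1) * quadrature j (half_angle_monomial (Suc b) a) = (b + 1)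
      * quadrature j (half_angle_monomial b (Suc a))) sequentially"
    by (rule eventually_mono) (rule lin)
  from solve[OF exact_eventually_top(2)[OF assms] this] show "exact_eventually (Suc b) a" "exact_eventually b
      (Suc a)" by auto
qed

text \<open>The extreme products in degree \<open>l = |s| + i\<close> supply exponents that differ
  by \<open>2 * |s|\<close> or \<open>2 * |s| + 1\<close>; taking both signs of \<open>m\<close>
  gives each such point together with its mirror image. These are the base diagonals for
  \<open>T = 2 * |s|\<close>.\<close>

lemma exact_eventually_all: "exact_eventually p q"
proof (rule nat_grid_closure[of exact_eventually "nat (2 * \<bar>s\<bar>)"])
  fix p q
  have m: "2 * pi * (2 * fact p * fact q / fact (p + q + 1))
     = 2 * pi * (2 * fact (Suc p) * fact q / fact (Suc p + q + 1)) + 2 * pi * (2 * fact p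
         * fact (Suc q) / fact (p + Suc q + 1))"
    unfolding moment_split[of p q] by (rule distrib_left)
  show "exact_eventually (Suc p) q" if "exact_eventually p q" "exact_eventually p (Suc q)"
    using that unfolding exact_eventually_def quadrature_split[of _ p q] m
        by eventually_elim (simp only: add_right_cancel)
  show "exact_eventually p (Suc q)" if "exact_eventually p q" "exact_eventually (Suc p) q"
    using that unfolding exact_eventually_def quadrature_split[of _ p q] m
        by eventually_elim (simp only: add_left_cancel)
  show "exact_eventually p q" if "exact_eventually (Suc p) q" "exact_eventually p (Suc q)"
    using that unfolding exact_eventually_def quadrature_split[of _ p q] m by eventually_elim (simp only:)
next
  fix i
  let ?T = "nat (2 * \<bar>s\<bar>)"
  have "exact_eventually (?T + i) i \<and> exact_eventually (Suc (?T + i)) i \<and> exact_eventually i (?T + i)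
      \<and> exact_eventually i (Suc (?T + i))"
  proof (cases "0 \<le> s")
    case True
    then have "int (?T + i) = int (nat \<bar>s\<bar> + i) + s" "int i = int (nat \<bar>s\<bar> + i) - s" by auto
    then show ?thesis by (intro conjI exact_eventually_top exact_eventually_top_Suc)
  next
    case False
    then have "int i = int (nat \<bar>s\<bar> + i) + s" "int (?T + i) = int (nat \<bar>s\<bar> + i) - s" by auto
    then show ?thesis by (intro conjI exact_eventually_top exact_eventually_top_Suc)
  qed
  then show "exact_eventually (?T + i) i" "exact_eventually (Suc (?T + i)) i"
    "exact_eventually i (?T + i)" "exact_eventually i (Suc (?T + i))"
    by blast+
qed

text \<open>One level \<open>j\<close> is picked at which the rule is exact for the finitely many
  monomials of the product and also reproduces the orthogonality. Quadrature and integral are then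
  the same combination of the same values, up to the factor \<open>2 * pi\<close>.\<close>

theorem wigner_d_orthogonal:
  assumes "\<bar>m\<bar> \<le> int l" "\<bar>m\<bar> \<le> int l'" "\<bar>s\<bar> \<le> int l" "\<bar>s\<bar> \<le> int l'"
  shows "(LBINT \<theta>:{0..pi}. wigner_d l m s \<theta> * wigner_d l' m s \<theta> * sin \<theta>) = (if l = l' then 2 / (2 * real l + 1) else 0)"
proof -
  obtain I :: "(int \<times> int) set" and c p q where I: "finite I"
    and ex: "\<And>\<beta>. wigner_d l m s \<beta> * wigner_d l' m s \<beta> = (\<Sum>i\<in>I. c i * half_angle_monomial (p i) (q i) \<beta>)"
    using wigner_d_mult_expand[OF assms] by metis
  have "has_bochner_integral lborel (\<lambda>\<theta>. \<Sum>i\<in>I. c i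
      * (indicator {0..pi} \<theta> *\<^sub>R (half_angle_monomial (p i) (q i) \<theta> * sin \<theta>)))
     (\<Sum>i\<in>I. c i * (2 * fact (p i) * fact (q i) / fact (p i + q i + 1)))"
    by (intro has_bochner_integral_sum has_bochner_integral_mult_right has_integral_half_angle_monomial)
  then have int: "(LBINT \<theta>:{0..pi}. wigner_d l m s \<theta> * wigner_d l' m s \<theta> * sin \<theta>)
     = (\<Sum>i\<in>I. c i * (2 * fact (p i) * fact (q i) / fact (p i + q i + 1)))"
    unfolding set_lebesgue_integral_def ex
    by (subst has_bochner_integral_integral_eq[symmetric])
      (auto simp: sum_distrib_left sum_distrib_right mult_ac)
  have "eventually (\<lambda>j. \<forall>i\<in>I. quadrature j (half_angle_monomial (p i) (q i)) = 2 * pi * (2 * fact (p i)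
      * fact (q i) / fact (p i + q i + 1))) sequentially"
    using I exact_eventually_all unfolding exact_eventually_def by (intro eventually_ball_finite) auto
  from eventually_happens'[OF sequentially_bot eventually_conj[OF this eventually_quadrature_wigner[OF assms]]]
  obtain j where j: "\<And>i. i \<in> I \<Longrightarrow> quadrature j (half_angle_monomial (p i) (q i)) = 2 * pi * (2 * fact (p i)
      * fact (q i) / fact (p i + q i + 1))"
    and v: "quadrature j (\<lambda>\<theta>. wigner_d l m s \<theta> * wigner_d l' m s \<theta>) = (if l = l' then 4 * pi / (2 * real l + 1) else 0)"
    by blast
  have "quadrature j (\<lambda>\<theta>. wigner_d l m s \<theta> * wigner_d l' m s \<theta>)
     = (\<Sum>i\<in>I. c i * (2 * pi * (2 * fact (p i) * fact (q i) / fact (p i + q i + 1))))"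
    unfolding ex quadrature_linear using j by (intro sum.cong) auto
  also have "\<dots> = 2 * pi * (LBINT \<theta>:{0..pi}. wigner_d l m s \<theta> * wigner_d l' m s \<theta> * sin \<theta>)"
    unfolding int by (simp add: sum_distrib_left mult_ac)
  finally have eq: "(if l = l' then 4 * pi / (2 * real l + 1) else 0) = 2 * pi
      * (LBINT \<theta>:{0..pi}. wigner_d l m s \<theta> * wigner_d l' m s \<theta> * sin \<theta>)"
    unfolding v .
  have "2 * pi * (LBINT \<theta>:{0..pi}. wigner_d l m s \<theta> * wigner_d l' m s \<theta> * sin \<theta>)
      = 2 * pi * (if l = l' then 2 / (2 * real l + 1) else 0)"
    unfolding eq[symmetric] by simp
  then show ?thesis unfolding mult_left_cancel[OF two_pi_neq_0] .
qed

end

section \<open>Surface measure and separation of the two angles\<close>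

lemma sph_point_alt:
  "sph_point \<theta> \<phi> = (sin \<theta> * cos \<phi>) *\<^sub>R axis 1 1 + (sin \<theta> * sin \<phi>) *\<^sub>R axis 2 1 + cos \<theta> *\<^sub>R axis 3 1"
  by (simp add: sph_point_def vec_eq_iff forall_3 axis_def)

lemma norm_sph_point: "norm (sph_point \<theta> \<phi>) = 1"
proof -
  have "(sin \<theta> * cos \<phi>)\<^sup>2 + (sin \<theta> * sin \<phi>)\<^sup>2 + (cos \<theta>)\<^sup>2 = (sin \<theta>)\<^sup>2 * ((cos \<phi>)\<^sup>2 + (sin \<phi>)\<^sup>2) + (cos \<theta>)\<^sup>2"
    by (simp only: power_mult_distrib distrib_left)
  then have "(sin \<theta> * cos \<phi>)\<^sup>2 + (sin \<theta> * sin \<phi>)\<^sup>2 + (cos \<theta>)\<^sup>2 = 1" by simp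
  then show ?thesis
    by (simp add: norm_eq_sqrt_inner inner_vec_def sum_3 sph_point_def power2_eq_square)
qed

lemma measurable_sph_point [measurable]:
  "(\<lambda>(\<theta>, \<phi>). sph_point \<theta> \<phi>) \<in> borel \<rightarrow>\<^sub>M restrict_space borel (sphere 0 1)"
proof (rule measurable_restrict_space2)
  show "(\<lambda>(\<theta>, \<phi>). sph_point \<theta> \<phi>) \<in> borel_measurable borel"
    unfolding sph_point_alt case_prod_unfold
    by (intro borel_measurable_continuous_onI continuous_intros)
qed (auto simp: norm_sph_point)

lemma colatitude_sph_point: "0 \<le> \<theta> \<Longrightarrow> \<theta> \<le> pi \<Longrightarrow> colatitude (sph_point \<theta> \<phi>) = \<theta>"
  by (simp add: colatitude_def sph_point_def arccos_cos)

lemma longitude_sph_point: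
  assumes "0 < \<theta>" "\<theta> < pi" "- pi < \<phi>" "\<phi> \<le> pi"
  shows "longitude (sph_point \<theta> \<phi>) = \<phi>"
proof -
  have "Complex (sin \<theta> * cos \<phi>) (sin \<theta> * sin \<phi>) = rcis (sin \<theta>) \<phi>"
    by (simp add: complex_eq_iff)
  then show ?thesis
    using assms Arg_rcis[of \<phi> "sin \<theta>"] by (simp add: longitude_def sph_point_def sin_gt_zero)
qed

lemma sets_S2: "sets S2 = sets (restrict_space borel (sphere 0 1))"
  by (simp add: S2_def)

lemma space_S2: "space S2 = sphere 0 1"
  by (simp add: S2_def space_restrict_space)

lemma measurable_S2_iff: "f \<in> S2 \<rightarrow>\<^sub>M N \<longleftrightarrow> f \<in> restrict_space borel (sphere 0 1) \<rightarrow>\<^sub>M N"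
  by (rule measurable_cong_sets[THEN arg_cong[where f="\<lambda>A. f \<in> A"]]) (simp_all add: sets_S2)

lemma measurable_colatitude [measurable]: "colatitude \<in> borel_measurable S2"
  unfolding measurable_S2_iff colatitude_def
proof (rule borel_measurable_continuous_on_restrict, rule continuous_on_arccos)
  show "continuous_on (sphere 0 1) (\<lambda>x :: real ^ 3. x $ 3)"
    by (intro continuous_intros)
  show "\<forall>x\<in>sphere 0 1. - 1 \<le> x $ (3 :: 3) \<and> x $ (3 :: 3) \<le> (1 :: real)"
  proof
    fix x :: "real ^ 3" assume "x \<in> sphere 0 1"
    then have "norm x = 1" by simp
    then show "- 1 \<le> x $ 3 \<and> x $ 3 \<le> 1"
      using component_le_norm_cart[of x 3] by (auto simp: abs_le_iff)
  qed
qed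

text \<open>Continuity fails only on the closed negative real half-axis, where the argument takes
  just the values 0 and pi.\<close>

lemma borel_measurable_Arg: "Arg \<in> borel_measurable borel"
proof -
  have "Arg z = (if z \<in> \<real>\<^sub>\<le>\<^sub>0 then (if z = 0 then 0 else pi) else Arg z)" for z
  proof (cases "z = 0")
    case False
    then show ?thesis
      using Arg_eq_pi[of z] by (auto simp: complex_nonpos_Reals_iff complex_eq_iff less_le)
  qed (simp add: Arg_zero)
  moreover have "(\<lambda>z. if z \<in> \<real>\<^sub>\<le>\<^sub>0 then (if z = 0 then 0 else pi) else Arg z) \<in> borel_measurable borel"
  proof (rule measurable_If_restrict_space_iff[THEN iffD2])
    show "{x \<in> space borel. x \<in> \<real>\<^sub>\<le>\<^sub>0} \<in> sets (borel :: complex measure)" by (simp add: closed_nonpos_Reals_complex)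
    have "Arg \<in> borel_measurable (restrict_space borel (- \<real>\<^sub>\<le>\<^sub>0))"
      by (rule borel_measurable_continuous_on_restrict[OF continuous_on_Arg])
    moreover have "(\<lambda>z :: complex. if z = 0 then 0 else pi) \<in> borel_measurable borel"
      by measurable
    ultimately show "(\<lambda>z :: complex. if z = 0 then 0 else pi) \<in> borel_measurable (restrict_space borel {x. x \<in> \<real>\<^sub>\<le>\<^sub>0})
       \<and> Arg \<in> borel_measurable (restrict_space borel {x. x \<notin> \<real>\<^sub>\<le>\<^sub>0})"
      by (auto simp: Compl_eq intro!: measurable_restrict_space1)
  qed
  ultimately show ?thesis by simp
qed

lemma measurable_longitude [measurable]: "longitude \<in> borel_measurable S2"
proof -
  have "(\<lambda>x :: real ^ 3. Complex (x $ 1) (x $ 2)) \<in> borel_measurable borel"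
    unfolding Complex_eq by (intro borel_measurable_continuous_onI continuous_intros)
  then have "longitude \<in> borel_measurable borel"
    unfolding longitude_def by (rule measurable_compose[OF _ borel_measurable_Arg])
  then show ?thesis
    unfolding measurable_S2_iff by (rule measurable_restrict_space1)
qed

lemma continuous_wigner_d: "continuous_on A (wigner_d l m n)"
  unfolding wigner_d_def Let_def by (intro continuous_intros) auto

lemma wigner_d_bounded: obtains c where "\<And>\<beta>. \<bar>wigner_d l m n \<beta>\<bar> \<le> c"
proof -
  define R where "R = sqrt (fact (nat (int l + m)) * fact (nat (int l - m)) * fact (nat (int l + n))
      * fact (nat (int l - n)))"
  define S where "S = {max 0 (n - m)..min (int l + n) (int l - m)}"
  have "\<bar>wigner_d l m n \<beta>\<bar> \<le> R * (\<Sum>k\<in>S. 1)" for \<beta>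
  proof -
    have R: "0 \<le> R" by (simp add: R_def)
    have "\<bar>(-1) ^ nat (m - n + k) * cos (\<beta> / 2) ^ p * sin (\<beta> / 2) ^ q / (fact a * fact b * fact c * fact d)\<bar> \<le> 1"
      for p q a b c d k
    proof -
      have "\<bar>cos (\<beta> / 2)\<bar> ^ p * \<bar>sin (\<beta> / 2)\<bar> ^ q \<le> 1 * 1"
        by (intro mult_mono power_le_one) auto
      moreover have "(1::real) \<le> fact a * fact b * fact c * fact d"
        using mult_mono[of "1::real" "fact a * fact b" 1 "fact c
            * fact d"] mult_mono[of "1::real" "fact a" 1 "fact b"] mult_mono[of "1::real" "fact c" 1 "fact d"]
        by (simp add: fact_ge_1 mult.assoc)
      ultimately have "\<bar>cos (\<beta> / 2)\<bar> ^ p * \<bar>sin (\<beta> / 2)\<bar> ^ q / (fact a * fact b * fact c * fact d) \<le> 1"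
        by (subst divide_le_eq_1_pos) auto
      then show ?thesis by (simp add: abs_mult power_abs)
    qed
    then have "\<bar>\<Sum>k\<in>S. (-1) ^ nat (m - n + k) * cos (\<beta> / 2) ^ nat (2 * int l + n - m - 2 * k)
        * sin (\<beta> / 2) ^ nat (m - n + 2 * k) /
        (fact (nat (int l + n - k)) * fact (nat k) * fact (nat (m - n + k)) * fact (nat (int l - m - k)))\<bar> \<le> (\<Sum>k\<in>S. 1)"
      by (intro order_trans[OF sum_abs] sum_mono)
    then show ?thesis
      unfolding wigner_d_def Let_def R_def[symmetric] S_def[symmetric] abs_mult using R by (simp add: mult_left_mono)
  qed
  then show ?thesis by (rule that)
qed

lemma measurable_spin_harmonic [measurable]: "spin_harmonic s l m \<in> borel_measurable S2"
proof -
  have [measurable]: "wigner_d l m n \<in> borel_measurable borel" for l m n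
    by (rule borel_measurable_continuous_onI[OF continuous_wigner_d])
  have [measurable]: "cis \<in> borel_measurable borel"
    by (intro borel_measurable_continuous_onI continuous_intros)
  show ?thesis
    unfolding spin_harmonic_def[abs_def] by measurable
qed

lemma spin_harmonic_bounded: obtains c where "\<And>x. cmod (spin_harmonic s l m x) \<le> c"
proof -
  obtain c where c: "\<And>\<beta>. \<bar>wigner_d l (- m) s \<beta>\<bar> \<le> c" using wigner_d_bounded by blast
  have "cmod (spin_harmonic s l m x) \<le> \<bar>(-1) powi m * sqrt ((2 * real l + 1) / (4 * pi))\<bar> * c" for x
    unfolding spin_harmonic_def norm_mult norm_of_real norm_cis mult_1_right
    by (rule mult_left_mono[OF c]) simp
  then show ?thesis by (rule that)
qed

text \<open>Arranged as a function of the colatitude times a function of the longitude, so that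
  Fubini's theorem separates them.\<close>

definition S2_density :: "real \<times> real \<Rightarrow> real" where
  "S2_density = (\<lambda>(\<theta>, \<phi>). (indicator {0..pi} \<theta> * sin \<theta>) * indicator {-pi<..pi} \<phi>)"

lemma S2_density_nonneg: "0 \<le> S2_density p"
  by (auto simp: S2_density_def indicator_def sin_ge_zero split: prod.split)

lemma measurable_S2_density [measurable]: "S2_density \<in> borel_measurable borel"
  unfolding S2_density_def borel_prod[symmetric] by measurable

lemma S2_alt:
  "S2 = distr (density lborel (\<lambda>p. ennreal (S2_density p))) (restrict_space borel (sphere 0 1)) (\<lambda>(\<theta>, \<phi>).
      sph_point \<theta> \<phi>)"
proof -
  have "(\<lambda>(\<theta>, \<phi>). ennreal (sin \<theta>) * indicator ({0..pi} \<times> {-pi<..pi}) (\<theta>, \<phi>)) = (\<lambda>p. ennreal (S2_density p))"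
    by (auto simp: S2_density_def indicator_def)
  then show ?thesis unfolding S2_def by simp
qed

lemma integrable_S2_density: "integrable lborel S2_density"
proof (rule integrableI_bounded_set[where A="cbox (0, -pi) (pi, pi)" and B=1])
  show "emeasure lborel (cbox (0, -pi) (pi, pi :: real)) < \<infinity>" by (rule emeasure_lborel_cbox_finite)
  show "AE p in lborel. p \<in> cbox (0, -pi) (pi, pi) \<longrightarrow> norm (S2_density p) \<le> 1"
    by (auto simp: S2_density_def indicator_def)
  show "AE p in lborel. p \<notin> cbox (0, -pi) (pi, pi) \<longrightarrow> S2_density p = 0" 
    by (intro AE_I2) (auto simp: S2_density_def indicator_def cbox_Pair_eq)
qed auto

lemma finite_measure_S2: "finite_measure S2"
proof
  have "emeasure S2 (space S2) = (\<integral>\<^sup>+p. ennreal (S2_density p) \<partial>lborel)"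
  proof -
    let ?D = "density lborel (\<lambda>p. ennreal (S2_density p))"
    have "emeasure S2 (space S2) = emeasure ?D ((\<lambda>(\<theta>, \<phi>). sph_point \<theta> \<phi>) -` sphere 0 1 \<inter> space ?D)"
      unfolding space_S2 by (subst S2_alt, rule emeasure_distr) (auto simp: sets_restrict_space_iff)
    also have "(\<lambda>(\<theta>, \<phi>). sph_point \<theta> \<phi>) -` sphere 0 1 \<inter> space ?D = UNIV"
      by (auto simp: norm_sph_point)
    finally show ?thesis by (simp add: emeasure_density)
  qed
  also have "\<dots> = ennreal (integral\<^sup>L lborel S2_density)"
    by (rule nn_integral_eq_integral[OF integrable_S2_density]) (simp add: S2_density_nonneg)
  finally show "emeasure S2 (space S2) \<noteq> \<infinity>" by simp
qed

lemma integral_cis_period: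
  fixes k :: int
  shows "has_bochner_integral lborel (\<lambda>\<phi>. indicator {-pi<..pi} \<phi> *\<^sub>R cis (of_int k * \<phi>)) (if k
      = 0 then of_real (2 * pi) else 0)"
proof -
  have "has_bochner_integral lborel (\<lambda>\<phi>. indicator {-pi..pi} \<phi> *\<^sub>R cis (of_int k * \<phi>)) (if k
      = 0 then of_real (2 * pi) else 0)"
  proof (cases "k = 0")
    case True
    have "has_bochner_integral lborel (\<lambda>\<phi>. indicator {-pi..pi} \<phi> *\<^sub>R (1::complex)) (of_real pi - of_real (- pi))"
      by (rule has_bochner_integral_FTC_Icc) (auto intro!: derivative_eq_intros simp: has_vector_derivative_of_real)
    then show ?thesis using True by simp
  next
    case False
    let ?F = "\<lambda>\<phi>. cis (of_int k * \<phi>) / (\<i> * of_int k)"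
    have "has_bochner_integral lborel (\<lambda>\<phi>. indicator {-pi..pi} \<phi> *\<^sub>R cis (of_int k * \<phi>)) (?F pi - ?F (- pi))"
    proof (rule has_bochner_integral_FTC_Icc)
      fix x :: real
      show "(?F has_vector_derivative cis (of_int k * x)) (at x within {-pi..pi})"
        unfolding cis_conv_exp
        by (auto intro!: derivative_eq_intros has_vector_derivative_real_field simp: False mult.commute[of _ \<i>])
    qed (auto intro!: continuous_intros)
    moreover have "cis (of_int k * pi) = cis (of_int k * (- pi))"
      by (simp add: complex_eq_iff sin_int_times_real mult.commute)
    ultimately show ?thesis using False by simp
  qed
  then show ?thesis
  \<comment> \<open>The fundamental theorem of calculus wants a closed interval, the chart a
    half-open one; they differ by a null set.\<close>
  proof (rule has_bochner_integral_cong_AE[THEN iffD1, rotated -1])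
    show "AE \<phi> in lborel. indicator {-pi..pi} \<phi> *\<^sub>R cis (of_int k * \<phi>) = indicator {-pi<..pi} \<phi> *\<^sub>R cis (of_int k * \<phi>)"
      using AE_lborel_singleton[of "-pi"] by eventually_elim (auto simp: indicator_def)
    have [measurable]: "cis \<in> borel_measurable borel"
      by (intro borel_measurable_continuous_onI continuous_intros)
    show "(\<lambda>\<phi>. indicator {-pi..pi} \<phi> *\<^sub>R cis (of_int k * \<phi>)) \<in> borel_measurable lborel"
      "(\<lambda>\<phi>. indicator {-pi<..pi} \<phi> *\<^sub>R cis (of_int k * \<phi>)) \<in> borel_measurable lborel" by measurable
  qed
qed

lemma integral_S2_separated:
  assumes A: "continuous_on UNIV A"
  shows "(LINT x|S2. of_real (A (colatitude x)) * cis (of_int k * longitude x))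
     = of_real (LBINT \<theta>:{0..pi}. A \<theta> * sin \<theta>) * (if k = 0 then of_real (2 * pi) else 0)"
proof -
  have [measurable]: "A \<in> borel_measurable borel" by (rule borel_measurable_continuous_onI[OF A])
  have [measurable]: "cis \<in> borel_measurable borel"
    by (intro borel_measurable_continuous_onI continuous_intros)
  let ?g = "\<lambda>x. of_real (A (colatitude x)) * cis (of_int k * longitude x)"
  have g [measurable]: "?g \<in> borel_measurable (restrict_space borel (sphere 0 1))"
    unfolding measurable_S2_iff[symmetric] by measurable
  have gs [measurable]: "(\<lambda>(\<theta>, \<phi>). ?g (sph_point \<theta> \<phi>)) \<in> borel_measurable borel"
    using measurable_compose[OF measurable_sph_point g] by (simp add: case_prod_unfold)
  let ?F = "\<lambda>\<theta>. complex_of_real (indicator {0..pi} \<theta> *\<^sub>R (A \<theta> * sin \<theta>))"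
  let ?G = "\<lambda>\<phi>. indicator {-pi<..pi} \<phi> *\<^sub>R cis (of_int k * \<phi>)"
  have "(LINT x|S2. ?g x)
      = (LINT p|density lborel (\<lambda>p. ennreal (S2_density p)). (case p of (\<theta>, \<phi>) \<Rightarrow> ?g (sph_point \<theta> \<phi>)))"
    unfolding S2_alt by (subst integral_distr) (auto intro!: Bochner_Integration.integral_cong)
  also have "\<dots> = (LINT p|lborel. S2_density p *\<^sub>R (case p of (\<theta>, \<phi>) \<Rightarrow> ?g (sph_point \<theta> \<phi>)))"
    by (rule integral_density) (auto simp: S2_density_nonneg)
  also have "\<dots> = (LINT p|lborel. ?F (fst p) * ?G (snd p))"
  proof (intro Bochner_Integration.integral_cong refl)
    fix p :: "real \<times> real"
    obtain \<theta> \<phi> where p: "p = (\<theta>, \<phi>)" by (cases p)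
    show "S2_density p *\<^sub>R (case p of (\<theta>, \<phi>) \<Rightarrow> ?g (sph_point \<theta> \<phi>)) = ?F (fst p) * ?G (snd p)"
    \<comment> \<open>Inside this range the chart returns \<open>\<theta>\<close> and
      \<open>\<phi>\<close>; outside it \<open>sin \<theta>\<close> or an indicator makes both sides
      vanish.\<close>
    proof (cases "0 < \<theta> \<and> \<theta> < pi \<and> - pi < \<phi> \<and> \<phi> \<le> pi")
      case True
      then show ?thesis
        by (simp add: p S2_density_def colatitude_sph_point longitude_sph_point scaleR_conv_of_real)
    next
      case False
      then have "S2_density p = 0" "?F \<theta> = 0 \<or> ?G \<phi> = 0"
        by (auto simp: p S2_density_def indicator_def le_less)
      then show ?thesis by (auto simp: p)
    qed
  qed
  also have "\<dots> = (LINT p|(lborel \<Otimes>\<^sub>M lborel). ?F (fst p) * ?G (snd p))"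
    by (simp only: lborel_prod)
  also have "\<dots> = (LINT \<theta>|lborel. LINT \<phi>|lborel. ?F \<theta> * ?G \<phi>)"
  proof -
    have iF: "integrable lborel ?F"
    proof -
      have "integrable lborel (\<lambda>\<theta>. indicator {0..pi} \<theta> *\<^sub>R (A \<theta> * sin \<theta>))"
      proof -
        have "continuous_on {0..pi} (\<lambda>\<theta>. A \<theta> * sin \<theta>)"
          by (intro continuous_intros continuous_on_subset[OF A]) auto
        then show ?thesis using borel_integrable_compact[of "{0..pi}" "\<lambda>\<theta>. A \<theta> * sin \<theta>"] by simp
      qed
      then show ?thesis by (rule integrable_of_real)
    qed
    have iG: "integrable lborel ?G"
      using integral_cis_period[of k] by (rule integrable.intros)
    have "integrable (lborel \<Otimes>\<^sub>M lborel) (\<lambda>p. ?F (fst p) * ?G (snd p))"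
    proof (rule lborel_pair.Fubini_integrable)
      show "integrable lborel (\<lambda>x. LINT y|lborel. norm (?F (fst (x, y)) * ?G (snd (x, y))))"
        using integrable_norm[OF iF]
            by (simp only: fst_conv snd_conv norm_mult integral_mult_right_zero) (rule integrable_mult_left)
      show "AE x in lborel. integrable lborel (\<lambda>y. ?F (fst (x, y)) * ?G (snd (x, y)))"
        by (intro AE_I2, simp only: fst_conv snd_conv) (rule integrable_mult_right, rule iG)
    qed measurable
    from lborel_pair.integral_fst'[OF this] show ?thesis by simp
  qed
  also have "\<dots> = (LINT \<theta>|lborel. ?F \<theta>) * (LINT \<phi>|lborel. ?G \<phi>)"
    by (simp only: integral_mult_right_zero integral_mult_left_zero)
  also have "(LINT \<phi>|lborel. ?G \<phi>) = (if k = 0 then of_real (2 * pi) else 0)"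
    using integral_cis_period[of k] by (rule has_bochner_integral_integral_eq)
  also have "(LINT \<theta>|lborel. ?F \<theta>) = of_real (LBINT \<theta>:{0..pi}. A \<theta> * sin \<theta>)"
    unfolding set_lebesgue_integral_def by (rule integral_complex_of_real)
  finally show ?thesis .
qed

text \<open>The longitude integral forces \<open>m = m'\<close>; the rest is the orthogonality of
  Wigner functions. A cubature system appears among the hypotheses because that orthogonality is
  derived from its exactness.\<close>

theorem spin_harmonic_orthonormal:
  assumes "1 < B" "cubature_system s B K \<xi> w"
    and "\<bar>s\<bar> \<le> int l" "\<bar>s\<bar> \<le> int l'" "\<bar>m\<bar> \<le> int l" "\<bar>m'\<bar> \<le> int l'"
  shows "(LINT x|S2. spin_harmonic s l m x * cnj (spin_harmonic s l' m' x)) = (if l = l' \<and> m = m' then 1 else 0)"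
proof -
  define c where "c l m = (-1) powi m * sqrt ((2 * real l + 1) / (4 * pi))" for l and m :: int
  let ?A = "\<lambda>\<theta>. c l m * c l' m' * (wigner_d l (- m) s \<theta> * wigner_d l' (- m') s \<theta>)"
  have "spin_harmonic s l m x * cnj (spin_harmonic s l' m' x)
    = of_real (?A (colatitude x)) * cis (of_int (m - m') * longitude x)" for x
  proof -
    have "cis (of_int (m - m') * longitude x) = cis (of_int m * longitude x) * cis (- (of_int m' * longitude x))"
      by (simp add: cis_mult left_diff_distrib)
    then show ?thesis
      by (simp add: spin_harmonic_def c_def cis_cnj mult_ac)
  qed
  then have "(LINT x|S2. spin_harmonic s l m x * cnj (spin_harmonic s l' m' x))
    = of_real (LBINT \<theta>:{0..pi}. ?A \<theta> * sin \<theta>) * (if m - m' = 0 then of_real (2 * pi) else 0)"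
    by (simp only:) (rule integral_S2_separated, intro continuous_intros continuous_wigner_d)
  also have "\<dots> = (if l = l' \<and> m = m' then 1 else 0)"
  proof (cases "m = m'")
    case True
    have cc: "c l m * c l m = (2 * real l + 1) / (4 * pi)" 
      by (simp add: c_def mult_ac flip: power_int_mult_distrib)
    have "(LBINT \<theta>:{0..pi}. ?A \<theta> * sin \<theta>) = c l m * c l' m' * (LBINT \<theta>:{0..pi}. wigner_d l (- m) s \<theta>
        * wigner_d l' (- m) s \<theta> * sin \<theta>)"
      unfolding True by (simp only: mult.assoc set_integral_mult_right)
    also have "(LBINT \<theta>:{0..pi}. wigner_d l (- m) s \<theta> * wigner_d l' (- m) s \<theta> * sin \<theta>) = (if l
        = l' then 2 / (2 * real l + 1) else 0)"
      using assms True by (intro wigner_d_orthogonal[OF assms(1,2)]) auto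
    also have "c l m * c l' m' * (if l = l' then 2 / (2 * real l + 1) else 0) = (if l = l' then 1 / (2 * pi) else 0)"
    proof (cases "l = l'")
      case T: True
      have frac: "N / (4 * pi) * (2 / N) = 1 / (2 * pi)" if "N \<noteq> 0" for N
        using that by simp
      have n: "2 * real l + 1 \<noteq> 0" by linarith
      then show ?thesis
        unfolding T[symmetric] True[symmetric] cc using frac[OF n] by simp
    qed simp
    finally show ?thesis using True by simp
  qed simp
  finally show ?thesis .
qed

section \<open>Harmonic coefficients of Gaussian spin fields\<close>

context prob_space begin

lemma gaussian_rv_measurable: "gaussian_rv M X \<Longrightarrow> X \<in> borel_measurable M"
  by (auto simp: gaussian_rv_def dest: distributed_measurable)

lemma gaussian_rv_integrable:
  assumes "gaussian_rv M X"
  shows "integrable M X"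
  using assms unfolding gaussian_rv_def
proof (elim disjE exE conjE)
  fix \<mu> \<sigma> :: real assume \<sigma>: "0 < \<sigma>" and d: "distributed M lborel X (normal_density \<mu> \<sigma>)"
  then show ?thesis
    using distributed_integrable[OF d, of "\<lambda>x. x"] integrable_normal_moment_nz_1[OF \<sigma>, of \<mu>] by simp
next
  fix \<mu> assume "X \<in> borel_measurable M" and "AE \<omega> in M. X \<omega> = \<mu>"
  then show ?thesis by (subst integrable_cong_AE[of _ _ "\<lambda>_. \<mu>"]) auto
qed

lemma gaussian_rv_cong_AE:
  assumes "gaussian_rv M X" and [measurable]: "Y \<in> borel_measurable M" and ae: "AE \<omega> in M. X \<omega> = Y \<omega>"
  shows "gaussian_rv M Y"
proof -
  note [measurable] = gaussian_rv_measurable[OF assms(1)]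
  have "distr M lborel X = distr M lborel Y"
    by (rule distr_cong_AE[OF refl refl ae]) auto
  then have "distributed M lborel Y f" if "distributed M lborel X f" for f
    using that unfolding distributed_def by auto
  moreover have "AE \<omega> in M. Y \<omega> = \<mu>" if "AE \<omega> in M. X \<omega> = \<mu>" for \<mu>
    using that ae by eventually_elim simp
  ultimately show ?thesis using assms(1,2) unfolding gaussian_rv_def by blast
qed

lemma gaussian_rv_centred_cases:
  assumes "gaussian_rv M X" "expectation X = 0"
  obtains \<sigma> where "0 < \<sigma>" "distributed M lborel X (normal_density 0 \<sigma>)" "expectation (\<lambda>\<omega>. (X \<omega>)\<^sup>2) = \<sigma>\<^sup>2"
  | "AE \<omega> in M. X \<omega> = 0"
  using assms(1) unfolding gaussian_rv_def
proof (elim disjE exE conjE)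
  fix \<mu> \<sigma> :: real assume \<sigma>: "0 < \<sigma>" and d: "distributed M lborel X (normal_density \<mu> \<sigma>)"
  have "\<mu> = 0" using normal_distributed_expectation[OF \<sigma> d] assms(2) by simp
  then show thesis
    using \<sigma> d normal_distributed_variance[OF \<sigma> d] assms(2) by (intro that(1)[of \<sigma>]) auto
next
  fix \<mu> assume X: "X \<in> borel_measurable M" and ae: "AE \<omega> in M. X \<omega> = \<mu>"
  then have "expectation X = expectation (\<lambda>_. \<mu>)" by (intro integral_cong_AE) auto
  then have "\<mu> = 0" using assms(2) by (simp add: prob_space)
  then show thesis using ae by (intro that(2)) simp
qed

lemma gaussian_rv_char:
  assumes "gaussian_rv M X" "expectation X = 0"
  shows "expectation (\<lambda>\<omega>. iexp (X \<omega>)) = of_real (exp (- expectation (\<lambda>\<omega>. (X \<omega>)\<^sup>2) / 2))"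
proof -
  note [measurable] = gaussian_rv_measurable[OF assms(1)]
  from assms show ?thesis
  proof (cases rule: gaussian_rv_centred_cases)
    case (1 \<sigma>)
    define Y where "Y \<omega> = (X \<omega> - 0) / \<sigma>" for \<omega>
    have Y: "distributed M lborel Y std_normal_density"
      using 1 normal_standard_normal_convert[of \<sigma> X 0] by (simp add: Y_def[abs_def])
    have "distr M borel Y = distr M lborel Y" by (rule distr_cong) auto
    also have "\<dots> = std_normal_distribution" using distributed_distr_eq_density[OF Y] by simp
    finally have d: "distr M borel Y = std_normal_distribution" .
    have [measurable]: "Y \<in> borel_measurable M" unfolding Y_def by measurable
    have "expectation (\<lambda>\<omega>. iexp (X \<omega>)) = expectation (\<lambda>\<omega>. iexp (\<sigma> * Y \<omega>))"
      using \<open>0 < \<sigma>\<close> by (simp add: Y_def)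
    also have "\<dots> = char (distr M borel Y) \<sigma>"
      unfolding char_def by (subst integral_distr) auto
    finally show ?thesis unfolding d char_std_normal_distribution using 1 by simp
  next
    case 2
    have "expectation (\<lambda>\<omega>. iexp (X \<omega>)) = expectation (\<lambda>\<omega>. 1)"
      using 2 by (intro integral_cong_AE) auto
    moreover have "expectation (\<lambda>\<omega>. (X \<omega>)\<^sup>2) = expectation (\<lambda>\<omega>. 0)"
      using 2 by (intro integral_cong_AE) auto
    ultimately show ?thesis by (simp add: prob_space)
  qed
qed

lemma gaussian_rv_moments:
  assumes "gaussian_rv M X" "expectation X = 0"
  defines "v \<equiv> expectation (\<lambda>\<omega>. (X \<omega>)\<^sup>2)"
  shows "integrable M (\<lambda>\<omega>. X \<omega> ^ k)" "expectation (\<lambda>\<omega>. X \<omega> ^ 4) = 3 * v\<^sup>2" "expectation (\<lambda>\<omega>. X \<omega> ^ 8) = 105 * v ^ 4"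
proof -
  note [measurable] = gaussian_rv_measurable[OF assms(1)]
  from assms(1,2) have "integrable M (\<lambda>\<omega>. X \<omega> ^ k) \<and> expectation (\<lambda>\<omega>. X \<omega> ^ 4) = 3 * v\<^sup>2
      \<and> expectation (\<lambda>\<omega>. X \<omega> ^ 8) = 105 * v ^ 4"
  proof (cases rule: gaussian_rv_centred_cases)
    case (1 \<sigma>)
    have int: "integrable M (\<lambda>\<omega>. X \<omega> ^ k)"
      using distributed_integrable[OF 1(2), of "\<lambda>x. x ^ k"] integrable_normal_moment[OF 1(1), of 0 k] by simp
    \<comment> \<open>The even moments of a normal variable are \<open>(2k)! / (2^k * k!)\<close>
      times \<open>\<sigma>^(2k)\<close>; the factor is 3 for \<open>k = 2\<close> and 105 for
      \<open>k = 4\<close>.\<close>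
    have mom: "expectation (\<lambda>\<omega>. X \<omega> ^ (2 * k)) = fact (2 * k) / ((2 / \<sigma>\<^sup>2) ^ k * fact k)" for k
      using distributed_integral[OF 1(2), of "\<lambda>x. x ^ (2 * k)"] integral_normal_moment_even[OF 1(1), of 0 k] by simp
    have "v = \<sigma>\<^sup>2" using 1 by (simp add: v_def)
    then show ?thesis
      using int mom[of 2] mom[of 4] 1(1) by (simp add: fact_numeral field_simps power_divide)
  next
    case 2
    have z: "AE \<omega> in M. X \<omega> ^ n = 0" if "n > 0" for n using 2 by eventually_elim (use that in simp)
    have e: "expectation (\<lambda>\<omega>. X \<omega> ^ n) = 0" if "n > 0" for n
      using z[OF that] by (subst integral_cong_AE[of _ _ "\<lambda>_. 0"]) auto
    have "integrable M (\<lambda>\<omega>. X \<omega> ^ k)"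
    proof (cases "k = 0")
      case False
      then show ?thesis using z[of k] by (subst integrable_cong_AE[of _ _ "\<lambda>_. 0"]) auto
    qed simp
    then show ?thesis using e[of 2] e[of 4] e[of 8] by (simp add: v_def)
  qed
  then show "integrable M (\<lambda>\<omega>. X \<omega> ^ k)" "expectation (\<lambda>\<omega>. X \<omega> ^ 4) = 3 * v\<^sup>2" "expectation (\<lambda>\<omega>. X \<omega> ^ 8) = 105 * v ^ 4"
    by auto
qed


section \<open>Linear combinations of the random coefficients\<close>

context
  fixes s C a
  assumes a: "gaussian_spin_coefficients M s C a"
begin

lemma spin_coefficient_measurable [measurable]: "i \<in> multipole_indices s \<Longrightarrow> a i \<in> borel_measurable M"
  using a by (simp add: gaussian_spin_coefficients_def jointly_gaussian_def)

lemma spin_coefficients_gaussian: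
  "finite J \<Longrightarrow> J \<subseteq> multipole_indices s \<Longrightarrow> gaussian_rv M (\<lambda>\<omega>. Re (\<Sum>i\<in>J. c i * a i \<omega>))"
  using a by (simp add: gaussian_spin_coefficients_def jointly_gaussian_def)

text \<open>A Bochner integral without integrability has the value 0, so the prescribed means and
  covariances do not yield integrability by themselves. It comes from the Gaussian law of the real
  and imaginary parts, the latter being the real part of \<open>- \<i> * a i\<close>.\<close>

lemma spin_coefficient_integrable:
  assumes i: "i \<in> multipole_indices s"
  shows "integrable M (a i)" "integrable M (\<lambda>\<omega>. (cmod (a i \<omega>))\<^sup>2)"
proof -
  have re: "gaussian_rv M (\<lambda>\<omega>. Re (a i \<omega>))"
    using spin_coefficients_gaussian[of "{i}" "\<lambda>_. 1"] i by simp
  have im: "gaussian_rv M (\<lambda>\<omega>. Im (a i \<omega>))"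
    using spin_coefficients_gaussian[of "{i}" "\<lambda>_. - \<i>"] i by simp
  have "integrable M (\<lambda>\<omega>. of_real (Re (a i \<omega>)) + \<i> * of_real (Im (a i \<omega>)))"
    by (intro Bochner_Integration.integrable_add integrable_mult_right integrable_of_real gaussian_rv_integrable re im)
  then show ai: "integrable M (a i)"
    by (simp only: complex_eq[symmetric])
  have "expectation (a i) = 0" using a i by (simp add: gaussian_spin_coefficients_def)
  then have "expectation (\<lambda>\<omega>. Re (a i \<omega>)) = 0" "expectation (\<lambda>\<omega>. Im (a i \<omega>)) = 0"
    using ai by simp_all
  then show "integrable M (\<lambda>\<omega>. (cmod (a i \<omega>))\<^sup>2)"
    unfolding cmod_power2 by (intro Bochner_Integration.integrable_add gaussian_rv_moments re im)
qed

lemma spin_coefficient_mult_integrable: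
  assumes "i \<in> multipole_indices s" "j \<in> multipole_indices s"
  shows "integrable M (\<lambda>\<omega>. a i \<omega> * a j \<omega>)" "integrable M (\<lambda>\<omega>. a i \<omega> * cnj (a j \<omega>))"
proof -
  have [measurable]: "(\<lambda>\<omega>. cnj (a j \<omega>)) \<in> borel_measurable M"
    by (rule borel_measurable_continuous_on[OF _ spin_coefficient_measurable[OF assms(2)]]) (intro continuous_intros)
  have sq: "integrable M (\<lambda>\<omega>. (cmod (a i \<omega>))\<^sup>2 + (cmod (a j \<omega>))\<^sup>2)"
    using assms by (intro Bochner_Integration.integrable_add spin_coefficient_integrable)
  have bound: "cmod u * cmod v \<le> (cmod u)\<^sup>2 + (cmod v)\<^sup>2" for u v
    using sum_squares_bound[of "cmod u" "cmod v"] mult_nonneg_nonneg[of "cmod u" "cmod v"] norm_ge_zero[of u]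
        norm_ge_zero[of v] by linarith
  show "integrable M (\<lambda>\<omega>. a i \<omega> * a j \<omega>)"
    by (rule Bochner_Integration.integrable_bound[OF sq]) (use assms bound in \<open>auto simp: norm_mult\<close>)
  show "integrable M (\<lambda>\<omega>. a i \<omega> * cnj (a j \<omega>))"
    by (rule Bochner_Integration.integrable_bound[OF sq]) (use assms bound in \<open>auto simp: norm_mult\<close>)
qed

text \<open>\<open>(Re z)^2 = (|z|^2 + Re (z^2)) / 2\<close>. The vanishing of the mean of
  \<open>a i * a j\<close> removes the second term, and the diagonal covariance reduces the first to
  a single sum; the factor 1/2 remains.\<close>

lemma spin_coefficients_linear:
  fixes c :: "nat \<times> int \<Rightarrow> complex"
  assumes J: "finite J" "J \<subseteq> multipole_indices s"
  defines "X \<equiv> \<lambda>\<omega>. Re (\<Sum>i\<in>J. c i * a i \<omega>)"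
  shows "gaussian_rv M X" "expectation X = 0" "expectation (\<lambda>\<omega>. (X \<omega>)\<^sup>2) = (\<Sum>i\<in>J. (cmod (c i))\<^sup>2 * C (fst i)) / 2"
proof -
  show "gaussian_rv M X" unfolding X_def by (rule spin_coefficients_gaussian[OF J])
  have J': "i \<in> multipole_indices s" if "i \<in> J" for i using J that by auto
  have iz: "integrable M (\<lambda>\<omega>. \<Sum>i\<in>J. c i * a i \<omega>)"
    by (intro Bochner_Integration.integrable_sum integrable_mult_right spin_coefficient_integrable J')
  have "expectation (\<lambda>\<omega>. \<Sum>i\<in>J. c i * a i \<omega>) = (\<Sum>i\<in>J. c i * expectation (a i))"
    using J' by (subst Bochner_Integration.integral_sum) (auto intro: spin_coefficient_integrable)
  also have "\<dots> = 0" using a J' by (intro sum.neutral) (auto simp: gaussian_spin_coefficients_def)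
  finally have ez: "expectation (\<lambda>\<omega>. \<Sum>i\<in>J. c i * a i \<omega>) = 0" .
  have "expectation X = Re (expectation (\<lambda>\<omega>. \<Sum>i\<in>J. c i * a i \<omega>))"
    unfolding X_def by (rule integral_Re[OF iz])
  then show "expectation X = 0" by (simp only: ez zero_complex.sel)
  have sq: "(X \<omega>)\<^sup>2 = Re ((\<Sum>i\<in>J. \<Sum>j\<in>J. c i * cnj (c j) * (a i \<omega> * cnj (a j \<omega>))) + (\<Sum>i\<in>J. \<Sum>j\<in>J. c i * c j
      * (a i \<omega> * a j \<omega>))) / 2" for \<omega>
  proof -
    define z where "z = (\<Sum>i\<in>J. c i * a i \<omega>)"
    have "(\<Sum>i\<in>J. \<Sum>j\<in>J. c i * cnj (c j) * (a i \<omega> * cnj (a j \<omega>))) = z * cnj z"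
      unfolding z_def cnj_sum sum_product by (intro sum.cong refl) simp
    moreover have "(\<Sum>i\<in>J. \<Sum>j\<in>J. c i * c j * (a i \<omega> * a j \<omega>)) = z * z"
      unfolding z_def sum_product by (intro sum.cong refl) simp
    moreover have "X \<omega> = Re z" by (simp only: X_def z_def)
    ultimately show ?thesis by (simp add: power2_eq_square)
  qed
  have i1: "integrable M (\<lambda>\<omega>. \<Sum>i\<in>J. \<Sum>j\<in>J. c i * cnj (c j) * (a i \<omega> * cnj (a j \<omega>)))"
    by (intro Bochner_Integration.integrable_sum integrable_mult_right spin_coefficient_mult_integrable J')
  have i2: "integrable M (\<lambda>\<omega>. \<Sum>i\<in>J. \<Sum>j\<in>J. c i * c j * (a i \<omega> * a j \<omega>))"
    by (intro Bochner_Integration.integrable_sum integrable_mult_right spin_coefficient_mult_integrable J')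
  have e1: "expectation (\<lambda>\<omega>. \<Sum>i\<in>J. \<Sum>j\<in>J. c i * cnj (c j) * (a i \<omega> * cnj (a j \<omega>)))
      = of_real (\<Sum>i\<in>J. (cmod (c i))\<^sup>2 * C (fst i))"
  proof -
    have "expectation (\<lambda>\<omega>. \<Sum>i\<in>J. \<Sum>j\<in>J. c i * cnj (c j) * (a i \<omega> * cnj (a j \<omega>)))
        = (\<Sum>i\<in>J. expectation (\<lambda>\<omega>. \<Sum>j\<in>J. c i * cnj (c j) * (a i \<omega> * cnj (a j \<omega>))))"
      by (intro Bochner_Integration.integral_sum Bochner_Integration.integrable_sum integrable_mult_right
          spin_coefficient_mult_integrable J')
    also have "\<dots> = (\<Sum>i\<in>J. \<Sum>j\<in>J. expectation (\<lambda>\<omega>. c i * cnj (c j) * (a i \<omega> * cnj (a j \<omega>))))"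
      by (intro sum.cong refl Bochner_Integration.integral_sum integrable_mult_right
          spin_coefficient_mult_integrable J')
    also have "\<dots> = (\<Sum>i\<in>J. \<Sum>j\<in>J. if i = j then c i * cnj (c i) * of_real (C (fst i)) else 0)"
      using a J' by (intro sum.cong refl) (auto simp: gaussian_spin_coefficients_def)
    also have "\<dots> = (\<Sum>i\<in>J. c i * cnj (c i) * of_real (C (fst i)))" using J by (simp add: sum.delta)
    finally show ?thesis by (simp add: complex_norm_square[symmetric])
  qed
  have e2: "expectation (\<lambda>\<omega>. \<Sum>i\<in>J. \<Sum>j\<in>J. c i * c j * (a i \<omega> * a j \<omega>)) = 0"
  proof -
    have "expectation (\<lambda>\<omega>. \<Sum>i\<in>J. \<Sum>j\<in>J. c i * c j * (a i \<omega> * a j \<omega>))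
        = (\<Sum>i\<in>J. expectation (\<lambda>\<omega>. \<Sum>j\<in>J. c i * c j * (a i \<omega> * a j \<omega>)))"
      by (intro Bochner_Integration.integral_sum Bochner_Integration.integrable_sum integrable_mult_right
          spin_coefficient_mult_integrable J')
    also have "\<dots> = (\<Sum>i\<in>J. \<Sum>j\<in>J. expectation (\<lambda>\<omega>. c i * c j * (a i \<omega> * a j \<omega>)))"
      by (intro sum.cong refl Bochner_Integration.integral_sum integrable_mult_right
          spin_coefficient_mult_integrable J')
    also have "\<dots> = 0"
      using a J' by (intro sum.neutral ballI) (auto simp: gaussian_spin_coefficients_def)
    finally show ?thesis .
  qed
  have "expectation (\<lambda>\<omega>. (X \<omega>)\<^sup>2) = Re (expectation (\<lambda>\<omega>. (\<Sum>i\<in>J. \<Sum>j\<in>J. c i * cnj (c j) * (a i \<omega> * cnj (a j \<omega>)))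
      + (\<Sum>i\<in>J. \<Sum>j\<in>J. c i * c j * (a i \<omega> * a j \<omega>)))) / 2"
    unfolding sq using Bochner_Integration.integrable_add[OF i1 i2] by (subst integral_Re[symmetric]) auto
  also have "\<dots> = (\<Sum>i\<in>J. (cmod (c i))\<^sup>2 * C (fst i)) / 2"
    unfolding Bochner_Integration.integral_add[OF i1 i2] e1 e2 by simp
  finally show "expectation (\<lambda>\<omega>. (X \<omega>)\<^sup>2) = (\<Sum>i\<in>J. (cmod (c i))\<^sup>2 * C (fst i)) / 2" .
qed

end

declare spin_coefficient_measurable [measurable del]

end

section \<open>Pathwise coefficients against the coefficients of the expansion\<close>

lemma borel_measurable_cnj [measurable (raw)]:
  "f \<in> borel_measurable M \<Longrightarrow> (\<lambda>x. cnj (f x)) \<in> borel_measurable M"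
  by (rule borel_measurable_continuous_on[where f=cnj]) (intro continuous_intros)

text \<open>A function of the path of the field, unlike the coefficient in the mean-square
  expansion, so that independence of the fields can be transferred to it.\<close>

definition harmonic_coefficient :: "int \<Rightarrow> ('w \<Rightarrow> real ^ 3 \<Rightarrow> complex) \<Rightarrow> nat \<times> int \<Rightarrow> 'w \<Rightarrow> complex" where
  "harmonic_coefficient s T i \<omega> = (LINT x|S2. T \<omega> x * cnj (spin_harmonic s (fst i) (snd i) x))"

interpretation S2: finite_measure S2
  by (rule finite_measure_S2)

lemma integrable_S2_bounded:
  fixes f :: "real ^ 3 \<Rightarrow> complex"
  assumes "integrable S2 f" and [measurable]: "h \<in> borel_measurable S2" and h: "\<And>x. cmod (h x) \<le> c"
  shows "integrable S2 (\<lambda>x. f x * h x)"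
proof (rule Bochner_Integration.integrable_bound)
  show "integrable S2 (\<lambda>x. c *\<^sub>R f x)" using assms(1) by simp
  have [measurable]: "f \<in> borel_measurable S2" using assms(1) by simp
  show "(\<lambda>x. f x * h x) \<in> borel_measurable S2" by measurable
  have "0 \<le> c" using norm_ge_zero h by (rule order_trans)
  then show "AE x in S2. cmod (f x * h x) \<le> cmod (c *\<^sub>R f x)"
    using h by (auto simp: norm_mult mult.commute[of c] intro!: AE_I2 mult_left_mono)
qed

lemma finite_truncation: "finite (SIGMA l : {l \<in> multipoles s. l \<le> L}. {- int l..int l})"
  by (rule finite_SigmaI) (auto intro: finite_subset[of _ "{..L}"])

context prob_space begin

lemma pair_S2: "pair_sigma_finite M S2" "finite_measure (M \<Otimes>\<^sub>M S2)"
proof -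
  show "pair_sigma_finite M S2" ..
  show "finite_measure (M \<Otimes>\<^sub>M S2)" by (rule finite_measure_pair_measure) unfold_locales
qed

context
  fixes s :: int and C :: "nat \<Rightarrow> real" and T :: "'a \<Rightarrow> real ^ 3 \<Rightarrow> complex" and a :: "nat \<times> int \<Rightarrow> 'a \<Rightarrow> complex"
  assumes T [measurable]: "(\<lambda>(\<omega>, x). T \<omega> x) \<in> borel_measurable (M \<Otimes>\<^sub>M S2)"
    and a: "gaussian_spin_coefficients M s C a"
    and lim: "(\<lambda>L. \<integral>\<^sup>+ (\<omega>, x). ennreal ((cmod (T \<omega> x -
                (\<Sum>l\<in>{l \<in> multipoles s. l \<le> L}. \<Sum>m\<in>{- int l..int l}.
                   a (l, m) \<omega> * spin_harmonic s l m x)))\<^sup>2) \<partial>(M \<Otimes>\<^sub>M S2))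
          \<longlonglongrightarrow> 0"
begin

definition truncation :: "nat \<Rightarrow> (nat \<times> int) set" where
  "truncation L = (SIGMA l : {l \<in> multipoles s. l \<le> L}. {- int l..int l})"

definition truncated :: "nat \<Rightarrow> 'a \<Rightarrow> real ^ 3 \<Rightarrow> complex" where
  "truncated L \<omega> x = (\<Sum>i\<in>truncation L. a i \<omega> * spin_harmonic s (fst i) (snd i) x)"

lemma truncation_simps: "finite (truncation L)" "truncation L \<subseteq> multipole_indices s"
  "i \<in> multipole_indices s \<Longrightarrow> fst i \<le> L \<Longrightarrow> i \<in> truncation L"
  using finite_truncation[of s L] by (auto simp: truncation_def multipole_indices_def)

lemma truncated_alt: "(\<Sum>l\<in>{l \<in> multipoles s. l \<le> L}. \<Sum>m\<in>{- int l..int l}. a (l, m) \<omega> * spin_harmonic s l m x)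
    = truncated L \<omega> x"
  unfolding truncated_def truncation_def
  by (subst sum.Sigma) (auto simp: case_prod_unfold intro: finite_subset[of _ "{..L}"])

lemma coefficient_measurable [measurable]: "i \<in> truncation L \<Longrightarrow> a i \<in> borel_measurable M"
  using spin_coefficient_measurable[OF a] truncation_simps(2)[of L] by blast

lemma truncated_measurable [measurable]: "(\<lambda>(\<omega>, x). truncated L \<omega> x) \<in> borel_measurable (M \<Otimes>\<^sub>M S2)"
  unfolding truncated_def by measurable

lemma error_limit: "(\<lambda>L. \<integral>\<^sup>+ (\<omega>, x). ennreal ((cmod (T \<omega> x - truncated L \<omega> x))\<^sup>2) \<partial>(M \<Otimes>\<^sub>M S2)) \<longlonglongrightarrow> 0"
  using lim unfolding truncated_alt .

lemma truncated_second_moment: "(\<integral>\<^sup>+ (\<omega>, x). ennreal ((cmod (truncated L \<omega> x))\<^sup>2) \<partial>(M \<Otimes>\<^sub>M S2)) < \<infinity>"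
proof -
  have "\<exists>c. \<forall>x. cmod (spin_harmonic s (fst i) (snd i) x) \<le> c" for i :: "nat \<times> int"
    using spin_harmonic_bounded[of s "fst i" "snd i"] by metis
  then obtain c where c: "\<And>i x. cmod (spin_harmonic s (fst i) (snd i) x) \<le> c i" by metis
  define h where "h \<omega> = card (truncation L) * (\<Sum>i\<in>truncation L. (cmod (a i \<omega>))\<^sup>2 * (c i)\<^sup>2)" for \<omega>
  have bound: "(cmod (truncated L \<omega> x))\<^sup>2 \<le> h \<omega>" for \<omega> x
  proof -
    have "cmod (truncated L \<omega> x) \<le> (\<Sum>i\<in>truncation L. 1 * (cmod (a i \<omega>) * c i))"
      unfolding truncated_def using c
      by (intro order_trans[OF norm_sum] sum_mono) (simp add: norm_mult mult_left_mono)
    then have "(cmod (truncated L \<omega> x))\<^sup>2 \<le> (\<Sum>i\<in>truncation L. 1 * (cmod (a i \<omega>) * c i))\<^sup>2"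
      by (intro power_mono) auto
    also have "\<dots> \<le> (\<Sum>i\<in>truncation L. 1\<^sup>2) * (\<Sum>i\<in>truncation L. (cmod (a i \<omega>) * c i)\<^sup>2)"
      by (rule Cauchy_Schwarz_ineq_sum)
    finally show ?thesis by (simp add: h_def power_mult_distrib)
  qed
  have ih: "integrable M h"
    unfolding h_def using truncation_simps(2)
    by (intro integrable_mult_right Bochner_Integration.integrable_sum integrable_mult_left
        spin_coefficient_integrable[OF a]) auto
  then have [measurable]: "h \<in> borel_measurable M" by simp
  have h0: "0 \<le> h \<omega>" for \<omega> unfolding h_def by (intro mult_nonneg_nonneg sum_nonneg) auto
  have "(\<integral>\<^sup>+ (\<omega>, x). ennreal ((cmod (truncated L \<omega> x))\<^sup>2) \<partial>(M \<Otimes>\<^sub>M S2)) \<le> (\<integral>\<^sup>+ (\<omega>, x). ennreal (h \<omega>) \<partial>(M \<Otimes>\<^sub>M S2))"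
    by (intro nn_integral_mono) (auto intro!: ennreal_leI bound)
  also have "\<dots> = (\<integral>\<^sup>+ \<omega>. \<integral>\<^sup>+ x. ennreal (h \<omega>) \<partial>S2 \<partial>M)"
    by (subst S2.nn_integral_fst[symmetric]) auto
  also have "\<dots> = (\<integral>\<^sup>+ \<omega>. ennreal (h \<omega>) \<partial>M) * emeasure S2 (space S2)"
    by (simp add: nn_integral_multc)
  also have "(\<integral>\<^sup>+ \<omega>. ennreal (h \<omega>) \<partial>M) = ennreal (expectation h)"
    by (rule nn_integral_eq_integral[OF ih]) (simp add: h0)
  also have "ennreal (expectation h) * emeasure S2 (space S2) < \<infinity>"
    using S2.emeasure_finite[of "space S2"] by (simp add: ennreal_mult_eq_top_iff less_top[symmetric])
  finally show ?thesis .
qed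

text \<open>Some truncation lies within mean-square distance 1 of the field, and truncations have
  finite second moment. Integrability of almost every path follows from this.\<close>

lemma field_second_moment: "(\<integral>\<^sup>+ (\<omega>, x). ennreal ((cmod (T \<omega> x))\<^sup>2) \<partial>(M \<Otimes>\<^sub>M S2)) < \<infinity>"
proof -
  have "eventually (\<lambda>L. (\<integral>\<^sup>+ (\<omega>, x). ennreal ((cmod (T \<omega> x - truncated L \<omega> x))\<^sup>2) \<partial>(M \<Otimes>\<^sub>M S2)) < 1) sequentially"
    by (rule order_tendstoD(2)[OF error_limit]) simp
  then obtain L where L: "(\<integral>\<^sup>+ (\<omega>, x). ennreal ((cmod (T \<omega> x - truncated L \<omega> x))\<^sup>2) \<partial>(M \<Otimes>\<^sub>M S2)) < 1"
    by (auto dest: eventually_happens)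
  have bound: "(cmod u)\<^sup>2 \<le> 2 * (cmod (u - z))\<^sup>2 + 2 * (cmod z)\<^sup>2" for u z :: complex
  proof -
    have "cmod u \<le> cmod (u - z) + cmod z" by (metis diff_add_cancel norm_triangle_ineq)
    then have "(cmod u)\<^sup>2 \<le> (cmod (u - z) + cmod z)\<^sup>2" by (intro power_mono) auto
    also have "\<dots> \<le> 2 * (cmod (u - z))\<^sup>2 + 2 * (cmod z)\<^sup>2"
      using sum_squares_bound[of "cmod (u - z)" "cmod z"] by (simp add: power2_sum)
    finally show ?thesis .
  qed
  have "(\<integral>\<^sup>+ (\<omega>, x). ennreal ((cmod (T \<omega> x))\<^sup>2) \<partial>(M \<Otimes>\<^sub>M S2))
      \<le> (\<integral>\<^sup>+ (\<omega>, x). 2 * ennreal ((cmod (T \<omega> x - truncated L \<omega> x))\<^sup>2) + 2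
          * ennreal ((cmod (truncated L \<omega> x))\<^sup>2) \<partial>(M \<Otimes>\<^sub>M S2))"
    using bound by (intro nn_integral_mono)
      (auto intro!: ennreal_leI simp flip: ennreal_plus ennreal_mult' ennreal_numeral)
  also have "\<dots> = 2 * (\<integral>\<^sup>+ (\<omega>, x). ennreal ((cmod (T \<omega> x - truncated L \<omega> x))\<^sup>2) \<partial>(M \<Otimes>\<^sub>M S2))
      + 2 * (\<integral>\<^sup>+ (\<omega>, x). ennreal ((cmod (truncated L \<omega> x))\<^sup>2) \<partial>(M \<Otimes>\<^sub>M S2))"
    unfolding case_prod_unfold by (subst nn_integral_add) (auto simp: nn_integral_cmult)
  also have "\<dots> < \<infinity>"
    using order.strict_trans[OF L ennreal_one_less_top] truncated_second_moment[of L]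
    by (simp add: less_top[symmetric] ennreal_add_eq_top ennreal_mult_eq_top_iff)
  finally show ?thesis .
qed

lemma field_integrable: "integrable (M \<Otimes>\<^sub>M S2) (\<lambda>(\<omega>, x). T \<omega> x)"
proof (rule integrableI_bounded)
  interpret P: finite_measure "M \<Otimes>\<^sub>M S2" by (rule pair_S2)
  have bound: "cmod u \<le> 1 + (cmod u)\<^sup>2" for u :: complex
  proof -
    have "2 * cmod u \<le> (cmod u)\<^sup>2 + 1" using sum_squares_bound[of "cmod u" 1] by simp
    then show ?thesis using norm_ge_zero[of u] by linarith
  qed
  have "(\<integral>\<^sup>+ p. ennreal (cmod (case p of (\<omega>, x) \<Rightarrow> T \<omega> x)) \<partial>(M \<Otimes>\<^sub>M S2))
     \<le> (\<integral>\<^sup>+ p. 1 + (case p of (\<omega>, x) \<Rightarrow> ennreal ((cmod (T \<omega> x))\<^sup>2)) \<partial>(M \<Otimes>\<^sub>M S2))"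
    using bound by (intro nn_integral_mono) (auto intro!: ennreal_leI simp flip: ennreal_plus ennreal_1)
  also have "\<dots> = emeasure (M \<Otimes>\<^sub>M S2) (space (M \<Otimes>\<^sub>M S2)) + (\<integral>\<^sup>+ (\<omega>, x). ennreal ((cmod (T \<omega> x))\<^sup>2) \<partial>(M \<Otimes>\<^sub>M S2))"
    by (subst nn_integral_add) auto
  also have "\<dots> < \<infinity>"
    using field_second_moment P.emeasure_finite[of "space (M \<Otimes>\<^sub>M S2)"] by (simp add: less_top[symmetric])
  finally show "(\<integral>\<^sup>+ p. ennreal (cmod (case p of (\<omega>, x) \<Rightarrow> T \<omega> x)) \<partial>(M \<Otimes>\<^sub>M S2)) < \<infinity>" .
qed simp

lemma field_AE_integrable: "AE \<omega> in M. integrable S2 (T \<omega>)"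
proof -
  interpret pair_sigma_finite M S2 by (rule pair_S2)
  show ?thesis using AE_integrable_fst'[OF field_integrable] by simp
qed

lemma harmonic_coefficient_measurable [measurable]: "harmonic_coefficient s T i \<in> borel_measurable M"
  unfolding harmonic_coefficient_def[abs_def] by measurable

text \<open>Once \<open>L\<close> reaches the degree of \<open>i\<close>, orthonormality makes the
  \<open>i\<close>-th coefficient of the truncation equal to \<open>a i\<close>. The discrepancy is
  then the coefficient of the remainder, and by Cauchy-Schwarz its second moment is at most a
  constant times the mean-square error, which tends to 0.\<close>

lemma harmonic_coefficient_AE:
  assumes "1 < B" "cubature_system s B K \<xi> w" and i: "i \<in> multipole_indices s"
  shows "AE \<omega> in M. harmonic_coefficient s T i \<omega> = a i \<omega>"
proof -
  let ?Y = "\<lambda>i. spin_harmonic s (fst i) (snd i)"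
  let ?n = "harmonic_coefficient s T i"
  have [measurable]: "a i \<in> borel_measurable M" by (rule spin_coefficient_measurable[OF a i])
  have Yb: "\<exists>c. \<forall>x. cmod (?Y i x) \<le> c" for i :: "nat \<times> int"
    using spin_harmonic_bounded[of s "fst i" "snd i"] by metis
  then obtain c where c: "\<And>i x. cmod (?Y i x) \<le> c i" by metis
  have ip: "integrable S2 (\<lambda>x. ?Y j x * cnj (?Y i x))" for j
  proof (rule integrable_S2_bounded)
    show "integrable S2 (?Y j)" by (rule S2.integrable_const_bound[of _ "c j"]) (use c in auto)
  qed (use c in auto)
  \<comment> \<open>The squared norm of the harmonic; a finite bound on it suffices for the
    limit.\<close>
  define \<kappa> where "\<kappa> = (\<integral>\<^sup>+ x. (ennreal (cmod (?Y i x)))\<^sup>2 \<partial>S2)"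
  have "\<kappa> \<le> (\<integral>\<^sup>+ x. (ennreal (c i))\<^sup>2 \<partial>S2)"
    unfolding \<kappa>_def using c by (intro nn_integral_mono power_mono ennreal_leI) auto
  also have "\<dots> < \<infinity>"
    using S2.emeasure_finite[of "space S2"]
        by (simp add: ennreal_mult_eq_top_iff less_top[symmetric] power_eq_top_ennreal)
  finally have \<kappa>: "\<kappa> < \<infinity>" .
  let ?err = "\<lambda>L. \<integral>\<^sup>+ (\<omega>, x). ennreal ((cmod (T \<omega> x - truncated L \<omega> x))\<^sup>2) \<partial>(M \<Otimes>\<^sub>M S2)"
  have main: "(\<integral>\<^sup>+ \<omega>. ennreal ((cmod (?n \<omega> - a i \<omega>))\<^sup>2) \<partial>M) \<le> \<kappa> * ?err L" if L: "fst i \<le> L" for L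
  proof -
    have pt: "ennreal ((cmod (?n \<omega> - a i \<omega>))\<^sup>2) \<le> \<kappa> * (\<integral>\<^sup>+ x. ennreal ((cmod (T \<omega> x - truncated L \<omega> x))\<^sup>2) \<partial>S2)"
      if \<omega>: "\<omega> \<in> space M" and iT: "integrable S2 (T \<omega>)" for \<omega>
    proof -
      have Tm [measurable]: "T \<omega> \<in> borel_measurable S2" using iT by simp
      have tm [measurable]: "truncated L \<omega> \<in> borel_measurable S2"
        unfolding truncated_def[abs_def] by measurable
      have it: "integrable S2 (\<lambda>x. truncated L \<omega> x * cnj (?Y i x))"
        unfolding truncated_def sum_distrib_right mult.assoc
        by (intro Bochner_Integration.integrable_sum integrable_mult_right ip)
      have iT': "integrable S2 (\<lambda>x. T \<omega> x * cnj (?Y i x))"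
        by (rule integrable_S2_bounded[OF iT, of _ "c i"]) (use c in auto)
      have "(LINT x|S2. truncated L \<omega> x * cnj (?Y i x)) = (\<Sum>j\<in>truncation L. a j \<omega> * (LINT x|S2. ?Y j x * cnj (?Y i x)))"
        unfolding truncated_def sum_distrib_right mult.assoc
        by (subst Bochner_Integration.integral_sum) (auto intro!: integrable_mult_right ip)
      also have "\<dots> = (\<Sum>j\<in>truncation L. if j = i then a i \<omega> else 0)"
      proof (intro sum.cong refl)
        fix j assume "j \<in> truncation L"
        then have "j \<in> multipole_indices s" using truncation_simps(2) by auto
        then show "a j \<omega> * (LINT x|S2. ?Y j x * cnj (?Y i x)) = (if j = i then a i \<omega> else 0)"
          using i by (subst spin_harmonic_orthonormal[OF assms(1,2)])
            (auto simp: multipole_indices_def multipoles_def prod_eq_iff)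
      qed
      also have "\<dots> = a i \<omega>" using truncation_simps(1) truncation_simps(3)[OF i L] by simp
      finally have "?n \<omega> - a i \<omega> = (LINT x|S2. (T \<omega> x - truncated L \<omega> x) * cnj (?Y i x))"
        unfolding harmonic_coefficient_def left_diff_distrib using iT' it by simp
      then have "ennreal (cmod (?n \<omega> - a i \<omega>)) \<le> (\<integral>\<^sup>+ x. ennreal (cmod ((T \<omega> x - truncated L \<omega> x) * cnj (?Y i x))) \<partial>S2)"
        using iT' it by (simp only:) (rule integral_norm_bound_ennreal, simp add: left_diff_distrib)
      also have "\<dots> = (\<integral>\<^sup>+ x. ennreal (cmod (T \<omega> x - truncated L \<omega> x)) * ennreal (cmod (?Y i x)) \<partial>S2)"
        by (simp add: norm_mult ennreal_mult)
      finally have "(ennreal (cmod (?n \<omega> - a i \<omega>)))\<^sup>2 \<le> (\<integral>\<^sup>+ x. ennreal (cmod (T \<omega> x - truncated L \<omega> x))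
          * ennreal (cmod (?Y i x)) \<partial>S2)\<^sup>2"
        by (rule power_mono) simp
      also have "\<dots> \<le> (\<integral>\<^sup>+ x. (ennreal (cmod (T \<omega> x - truncated L \<omega> x)))\<^sup>2 \<partial>S2) * \<kappa>"
        unfolding \<kappa>_def by (rule Cauchy_Schwarz_nn_integral) measurable
      finally show ?thesis by (simp add: ennreal_power mult.commute)
    qed
    have "(\<integral>\<^sup>+ \<omega>. ennreal ((cmod (?n \<omega> - a i \<omega>))\<^sup>2) \<partial>M) \<le> (\<integral>\<^sup>+ \<omega>. \<kappa> * (\<integral>\<^sup>+ x. ennreal ((cmod (T \<omega> x
        - truncated L \<omega> x))\<^sup>2) \<partial>S2) \<partial>M)"
    proof (rule nn_integral_mono_AE)
      show "AE \<omega> in M. ennreal ((cmod (?n \<omega> - a i \<omega>))\<^sup>2) \<le> \<kappa> * (\<integral>\<^sup>+ x. ennreal ((cmod (T \<omega> x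
          - truncated L \<omega> x))\<^sup>2) \<partial>S2)"
        using AE_space field_AE_integrable by eventually_elim (rule pt)
    qed
    also have "\<dots> = \<kappa> * (\<integral>\<^sup>+ \<omega>. \<integral>\<^sup>+ x. ennreal ((cmod (T \<omega> x - truncated L \<omega> x))\<^sup>2) \<partial>S2 \<partial>M)"
      by (rule nn_integral_cmult) measurable
    also have "(\<integral>\<^sup>+ \<omega>. \<integral>\<^sup>+ x. ennreal ((cmod (T \<omega> x - truncated L \<omega> x))\<^sup>2) \<partial>S2 \<partial>M) = ?err L"
      by (subst S2.nn_integral_fst[symmetric]) auto
    finally show ?thesis .
  qed
  have "(\<lambda>L. \<kappa> * ?err L) \<longlonglongrightarrow> \<kappa> * 0"
    using \<kappa>[unfolded infinity_ennreal_def] by (intro ennreal_tendsto_cmult error_limit)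
  then have "(\<integral>\<^sup>+ \<omega>. ennreal ((cmod (?n \<omega> - a i \<omega>))\<^sup>2) \<partial>M) \<le> \<kappa> * 0"
    by (rule LIMSEQ_le_const) (use main in blast)
  then have "(\<integral>\<^sup>+ \<omega>. ennreal ((cmod (?n \<omega> - a i \<omega>))\<^sup>2) \<partial>M) = 0" by simp
  then have "AE \<omega> in M. ennreal ((cmod (?n \<omega> - a i \<omega>))\<^sup>2) = 0"
    by (subst (asm) nn_integral_0_iff_AE) auto
  then show ?thesis by eventually_elim simp
qed

end

declare coefficient_measurable [measurable del] and truncated_measurable [measurable del]
    and harmonic_coefficient_measurable [measurable del]

end

section \<open>Independence over channels, multipoles and real components\<close>

definition re_im :: "bool \<Rightarrow> complex \<Rightarrow> real" where
  "re_im b z = (if b then Re z else Im z)"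

lemma (in prob_space) expectation_iexp_sum_indep:
  assumes "finite I" "indep_vars (\<lambda>_. borel) R I"
  shows "expectation (\<lambda>\<omega>. iexp (\<Sum>r\<in>I. R r \<omega>)) = (\<Prod>r\<in>I. expectation (\<lambda>\<omega>. iexp (R r \<omega>)))"
proof -
  have m: "R r \<in> borel_measurable M" if "r \<in> I" for r using assms(2) that by (simp add: indep_vars_def2)
  have ind: "indep_vars (\<lambda>_. borel) (\<lambda>r \<omega>. iexp (R r \<omega>)) I"
    by (rule indep_vars_compose2[OF assms(2)]) auto
  have "expectation (\<lambda>\<omega>. \<Prod>r\<in>I. iexp (R r \<omega>)) = (\<Prod>r\<in>I. expectation (\<lambda>\<omega>. iexp (R r \<omega>)))"
  proof (rule indep_vars_lebesgue_integral[OF assms(1) ind])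
    fix r assume "r \<in> I"
    then have [measurable]: "R r \<in> borel_measurable M" by (rule m)
    show "integrable M (\<lambda>\<omega>. iexp (R r \<omega>))" by (rule integrable_iexp) auto
  qed
  then show ?thesis
    by (simp add: exp_sum[OF assms(1)] sum_distrib_left)
qed

context prob_space begin

lemma isotropic_field_facts:
  fixes T :: "'a \<Rightarrow> real ^ 3 \<Rightarrow> complex"
  assumes "gaussian_isotropic_spin_field M s C' T"
  shows "(\<lambda>(\<omega>, x). T \<omega> x) \<in> borel_measurable (M \<Otimes>\<^sub>M S2)"
    "integrable (M \<Otimes>\<^sub>M S2) (\<lambda>(\<omega>, x). T \<omega> x)" "AE \<omega> in M. integrable S2 (T \<omega>)"
    "harmonic_coefficient s T i \<in> borel_measurable M"
proof -
  from assms obtain a where T: "(\<lambda>(\<omega>, x). T \<omega> x) \<in> borel_measurable (M \<Otimes>\<^sub>M S2)"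
    and a: "gaussian_spin_coefficients M s C' a"
    and l: "(\<lambda>L. \<integral>\<^sup>+ (\<omega>, x). ennreal ((cmod (T \<omega> x -
                (\<Sum>l\<in>{l \<in> multipoles s. l \<le> L}. \<Sum>m\<in>{- int l..int l}.
                   a (l, m) \<omega> * spin_harmonic s l m x)))\<^sup>2) \<partial>(M \<Otimes>\<^sub>M S2)) \<longlonglongrightarrow> 0"
    unfolding gaussian_isotropic_spin_field_def by blast
  show "(\<lambda>(\<omega>, x). T \<omega> x) \<in> borel_measurable (M \<Otimes>\<^sub>M S2)" by fact
  show "integrable (M \<Otimes>\<^sub>M S2) (\<lambda>(\<omega>, x). T \<omega> x)" by (rule field_integrable[OF T a l])
  show "AE \<omega> in M. integrable S2 (T \<omega>)" by (rule field_AE_integrable[OF T a l])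
  show "harmonic_coefficient s T i \<in> borel_measurable M" by (rule harmonic_coefficient_measurable[OF T a l])
qed

context
  fixes s :: int and B :: real and K \<xi> w and D :: nat
    and C :: "nat \<Rightarrow> nat \<Rightarrow> real" and P :: "'a \<Rightarrow> real ^ 3 \<Rightarrow> complex" and N :: "nat \<Rightarrow> 'a \<Rightarrow> real ^ 3 \<Rightarrow> complex"
  assumes B: "1 < B" and cub: "cubature_system s B K \<xi> w"
    and fields: "\<And>r. r \<in> {1..D} \<Longrightarrow> gaussian_isotropic_spin_field M s (C r) (N r)"
    and indep: "independent_signal_noise M D P N"
begin

lemma channel_coefficients:
  assumes "r \<in> {1..D}"
  obtains a where "gaussian_spin_coefficients M s (C r) a"
    "\<And>i. i \<in> multipole_indices s \<Longrightarrow> AE \<omega> in M. harmonic_coefficient s (N r) i \<omega> = a i \<omega>"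
proof -
  from fields[OF assms] obtain a where N: "(\<lambda>(\<omega>, x). N r \<omega> x) \<in> borel_measurable (M \<Otimes>\<^sub>M S2)"
    and a: "gaussian_spin_coefficients M s (C r) a"
    and l: "(\<lambda>L. \<integral>\<^sup>+ (\<omega>, x). ennreal ((cmod (N r \<omega> x -
                (\<Sum>l\<in>{l \<in> multipoles s. l \<le> L}. \<Sum>m\<in>{- int l..int l}.
                   a (l, m) \<omega> * spin_harmonic s l m x)))\<^sup>2) \<partial>(M \<Otimes>\<^sub>M S2)) \<longlonglongrightarrow> 0"
    unfolding gaussian_isotropic_spin_field_def by blast
  show thesis
    by (rule that[OF a harmonic_coefficient_AE[OF N a l B cub]])
qed

text \<open>The independence hypothesis is about point values.
  \<open>integral_of_adapted_process\<close> replaces each integral by an almost surely equal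
  \<open>R r\<close> that is measurable for the sigma-algebra \<open>F r\<close> of the point values
  of \<open>N r\<close>. These \<open>R r\<close> are independent, and expectations do not see null
  sets.\<close>

lemma channel_functionals_char:
  assumes h: "\<And>r. r \<in> {1..D} \<Longrightarrow> h r \<in> borel_measurable S2" and bound: "\<And>r x. r \<in> {1..D} \<Longrightarrow> cmod (h r x) \<le> c r"
  shows "expectation (\<lambda>\<omega>. iexp (\<Sum>r\<in>{1..D}. Re (LINT x|S2. N r \<omega> x * h r x)))
    = (\<Prod>r\<in>{1..D}. expectation (\<lambda>\<omega>. iexp (Re (LINT x|S2. N r \<omega> x * h r x))))"
proof -
  define F where "F r = vimage_algebra (space M) (\<lambda>\<omega>. restrict (N r \<omega>) (sphere 0 1)) (\<Pi>\<^sub>M x\<in>sphere 0 1. (borel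
      :: complex measure))" for r
  let ?X = "\<lambda>r \<omega>. restrict (if r = 0 then P \<omega> else N r \<omega>) (sphere 0 1)"
  let ?\<Pi> = "\<Pi>\<^sub>M x\<in>(sphere 0 1 :: (real ^ 3) set). (borel :: complex measure)"
  have ind: "indep_vars (\<lambda>_. ?\<Pi>) (\<lambda>r \<omega>. restrict (N r \<omega>) (sphere 0 1)) {1..D}"
  proof -
    have "indep_vars (\<lambda>_. ?\<Pi>) ?X {1..D}"
      by (rule indep_vars_subset[OF indep[unfolded independent_signal_noise_def]]) auto
    then show ?thesis by (rule indep_vars_cong[THEN iffD1, rotated -1]) auto
  qed
  have ex: "\<exists>R. R \<in> borel_measurable (F r) \<and> (AE \<omega> in M. Re (LINT x|S2. N r \<omega> x * h r x) = R \<omega>)"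
      if r: "r \<in> {1..D}" for r
  proof -
    note facts = isotropic_field_facts[OF fields[OF r]]
    note [measurable] = facts(1) h[OF r]
    have Xm: "(\<lambda>\<omega>. restrict (N r \<omega>) (sphere 0 1)) \<in> M \<rightarrow>\<^sub>M ?\<Pi>" using ind r unfolding indep_vars_def2 by blast
    have sub: "subalgebra M (F r)"
    proof -
      have "sets (F r) = {(\<lambda>\<omega>. restrict (N r \<omega>) (sphere 0 1)) -` A \<inter> space M |A. A \<in> sets ?\<Pi>}"
        unfolding F_def by (rule sets_vimage_algebra2) (rule funcsetI, rule measurable_space[OF Xm])
      also have "\<dots> \<subseteq> sets M"
      proof clarify
        fix A assume "A \<in> sets ?\<Pi>"
        with Xm show "(\<lambda>\<omega>. restrict (N r \<omega>) (sphere 0 1)) -` A \<inter> space M \<in> sets M"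
          by (rule measurable_sets)
      qed
      finally show ?thesis
        unfolding subalgebra_def by (intro conjI) (simp_all only: F_def space_vimage_algebra)
    qed
    have c0: "0 \<le> c r" using bound[OF r] norm_ge_zero by (rule order_trans[rotated])
    have int: "integrable (M \<Otimes>\<^sub>M S2) (\<lambda>(\<omega>, x). N r \<omega> x * h r x)"
    proof (rule Bochner_Integration.integrable_bound)
      show "integrable (M \<Otimes>\<^sub>M S2) (\<lambda>p. c r *\<^sub>R (case p of (\<omega>, x) \<Rightarrow> N r \<omega> x))"
        using facts(2) by simp
      show "AE p in M \<Otimes>\<^sub>M S2. cmod (case p of (\<omega>, x) \<Rightarrow> N r \<omega> x * h r x) \<le> cmod (c r *\<^sub>R (case p of (\<omega>, x) \<Rightarrow> N r \<omega> x))"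
        using bound[OF r] c0 by (auto simp: norm_mult mult.commute[of "c r"] intro!: AE_I2 mult_left_mono)
    qed measurable
    have intRe: "integrable (M \<Otimes>\<^sub>M S2) (\<lambda>(\<omega>, x). Re (N r \<omega> x * h r x))"
      using integrable_Re[OF int] by (simp add: case_prod_unfold)
    \<comment> \<open>The value at \<open>x\<close> is a coordinate of the restricted path, hence
      measurable for \<open>F r\<close>.\<close>
    have ad: "(\<lambda>\<omega>. Re (N r \<omega> x * h r x)) \<in> borel_measurable (F r)" if "x \<in> space S2" for x
    proof -
      have x: "x \<in> sphere 0 1" using that by (simp add: space_S2)
      have "(\<lambda>\<omega>. restrict (N r \<omega>) (sphere 0 1)) \<in> F r \<rightarrow>\<^sub>M ?\<Pi>"
        unfolding F_def using measurable_space[OF Xm] by (intro measurable_vimage_algebra1) auto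
      then have "(\<lambda>\<omega>. restrict (N r \<omega>) (sphere 0 1) x) \<in> borel_measurable (F r)"
        by (rule measurable_compose[OF _ measurable_component_singleton[OF x]])
      then have [measurable]: "(\<lambda>\<omega>. N r \<omega> x) \<in> borel_measurable (F r)" using x by simp
      show ?thesis by measurable
    qed
    obtain R where R: "R \<in> borel_measurable (F r)" "AE \<omega> in M. (LINT x|S2. Re (N r \<omega> x * h r x)) = R \<omega>"
      by (rule integral_of_adapted_process[OF finite_measure_S2 sub intRe ad])
    have "AE \<omega> in M. integrable S2 (\<lambda>x. N r \<omega> x * h r x)"
      using facts(3) by eventually_elim (rule integrable_S2_bounded[OF _ h[OF r] bound[OF r]])
    with R(2) have "AE \<omega> in M. Re (LINT x|S2. N r \<omega> x * h r x) = R \<omega>"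
      by eventually_elim (simp only: integral_Re)
    with R(1) show ?thesis by blast
  qed
  then have "\<forall>r\<in>{1..D}. \<exists>R. R \<in> borel_measurable (F r) \<and> (AE \<omega> in M. Re (LINT x|S2. N r \<omega> x * h r x) = R \<omega>)" ..
  from bchoice[OF this] obtain R where
    R': "\<forall>r\<in>{1..D}. R r \<in> borel_measurable (F r) \<and> (AE \<omega> in M. Re (LINT x|S2. N r \<omega> x * h r x) = R r \<omega>)" ..
  have R: "R r \<in> borel_measurable (F r)" and ae: "AE \<omega> in M. Re (LINT x|S2. N r \<omega> x * h r x) = R r \<omega>"
      if "r \<in> {1..D}" for r
    using R'[rule_format, OF that] by (rule conjunct1, rule conjunct2)
  have indR: "indep_vars (\<lambda>_. borel) R {1..D}"
    by (rule indep_vars_vimage_algebra[OF ind]) (use R in \<open>simp add: F_def\<close>)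
  have Rm [measurable]: "R r \<in> borel_measurable M" if "r \<in> {1..D}" for r
    using indR that by (simp add: indep_vars_def2)
  have Lm [measurable]: "(\<lambda>\<omega>. Re (LINT x|S2. N r \<omega> x * h r x)) \<in> borel_measurable M" if "r \<in> {1..D}" for r
  proof -
    note [measurable] = isotropic_field_facts(1)[OF fields[OF that]] h[OF that]
    show ?thesis by measurable
  qed
  have "AE \<omega> in M. \<forall>r\<in>{1..D}. Re (LINT x|S2. N r \<omega> x * h r x) = R r \<omega>"
    by (rule AE_finite_allI) (use ae in auto)
  then have "expectation (\<lambda>\<omega>. iexp (\<Sum>r\<in>{1..D}. Re (LINT x|S2. N r \<omega> x * h r x)))
      = expectation (\<lambda>\<omega>. iexp (\<Sum>r\<in>{1..D}. R r \<omega>))"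
    by (intro integral_cong_AE) (measurable, auto elim!: eventually_mono)
  also have "\<dots> = (\<Prod>r\<in>{1..D}. expectation (\<lambda>\<omega>. iexp (R r \<omega>)))"
    by (rule expectation_iexp_sum_indep[OF _ indR]) simp
  also have "\<dots> = (\<Prod>r\<in>{1..D}. expectation (\<lambda>\<omega>. iexp (Re (LINT x|S2. N r \<omega> x * h r x))))"
  proof (intro prod.cong refl)
    fix r assume r: "r \<in> {1..D}"
    note [measurable] = Rm[OF r] Lm[OF r]
    show "expectation (\<lambda>\<omega>. iexp (R r \<omega>)) = expectation (\<lambda>\<omega>. iexp (Re (LINT x|S2. N r \<omega> x * h r x)))"
      using ae[OF r] by (intro integral_cong_AE) (measurable, auto elim!: eventually_mono)
  qed
  finally show ?thesis .
qed

lemma channel_linear_combination: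
  fixes c :: "nat \<times> int \<Rightarrow> complex"
  assumes r: "r \<in> {1..D}" and J: "finite J" "J \<subseteq> multipole_indices s"
  defines "X \<equiv> \<lambda>\<omega>. Re (\<Sum>i\<in>J. c i * harmonic_coefficient s (N r) i \<omega>)"
  shows "gaussian_rv M X" "expectation X = 0" "expectation (\<lambda>\<omega>. (X \<omega>)\<^sup>2) = (\<Sum>i\<in>J. (cmod (c i))\<^sup>2 * C r (fst i)) / 2"
proof -
  from channel_coefficients[OF r] obtain a where a: "gaussian_spin_coefficients M s (C r) a"
    and ae: "\<And>i. i \<in> multipole_indices s \<Longrightarrow> AE \<omega> in M. harmonic_coefficient s (N r) i \<omega> = a i \<omega>" by metis
  define Y where "Y = (\<lambda>\<omega>. Re (\<Sum>i\<in>J. c i * a i \<omega>))"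
  have Y: "gaussian_rv M Y" "expectation Y = 0" "expectation (\<lambda>\<omega>. (Y \<omega>)\<^sup>2) = (\<Sum>i\<in>J. (cmod (c i))\<^sup>2 * C r (fst i)) / 2"
    unfolding Y_def by (rule spin_coefficients_linear[OF a J])+
  note [measurable] = isotropic_field_facts(4)[OF fields[OF r]] gaussian_rv_measurable[OF Y(1)]
  have [measurable]: "X \<in> borel_measurable M" unfolding X_def by measurable
  have "AE \<omega> in M. \<forall>i\<in>J. harmonic_coefficient s (N r) i \<omega> = a i \<omega>"
    by (rule AE_finite_allI) (use ae J in auto)
  then have eq: "AE \<omega> in M. Y \<omega> = X \<omega>"
    unfolding X_def Y_def by eventually_elim (intro arg_cong[where f=Re] sum.cong refl, simp)
  show "gaussian_rv M X" by (rule gaussian_rv_cong_AE[OF Y(1) _ eq]) measurable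
  have "expectation Y = expectation X" using eq by (intro integral_cong_AE) auto
  then show "expectation X = 0" using Y(2) by simp
  have "expectation (\<lambda>\<omega>. (Y \<omega>)\<^sup>2) = expectation (\<lambda>\<omega>. (X \<omega>)\<^sup>2)" using eq by (intro integral_cong_AE) auto
  then show "expectation (\<lambda>\<omega>. (X \<omega>)\<^sup>2) = (\<Sum>i\<in>J. (cmod (c i))\<^sup>2 * C r (fst i)) / 2" unfolding Y(3) by (rule sym)
qed

text \<open>The multipliers 1 and \<open>- \<i>\<close> select the real and the imaginary part; both
  have modulus 1, so each part has variance half the power.\<close>

lemma noise_component:
  fixes b :: bool
  assumes r: "r \<in> {1..D}" and i: "i \<in> multipole_indices s"
  defines "X \<equiv> \<lambda>\<omega>. re_im b (harmonic_coefficient s (N r) i \<omega>)"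
  shows "gaussian_rv M X" "expectation X = 0" "expectation (\<lambda>\<omega>. (X \<omega>)\<^sup>2) = C r (fst i) / 2"
proof -
  have "X = (\<lambda>\<omega>. Re (\<Sum>i\<in>{i}. (if b then 1 else - \<i>) * harmonic_coefficient s (N r) i \<omega>))"
    by (auto simp: X_def re_im_def)
  then show "gaussian_rv M X" "expectation X = 0" "expectation (\<lambda>\<omega>. (X \<omega>)\<^sup>2) = C r (fst i) / 2"
    using channel_linear_combination[OF r, of "{i}" "\<lambda>_. if b then 1 else - \<i>"] i by (auto simp: norm_power)
qed

text \<open>Across channels the joint characteristic function factorises by independence of the
  fields. Within a channel every real combination of components is a centred Gaussian whose variance
  is the sum of the contributions \<open>t^2 * C / 2\<close> of the single components, so the
  factorisation goes down to these.\<close>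

theorem noise_components_indep:
  assumes J: "finite J" "J \<subseteq> multipole_indices s"
  shows "indep_vars (\<lambda>_. borel) (\<lambda>(i, r, b) \<omega>. re_im b (harmonic_coefficient s (N r) i \<omega>)) (J \<times> {1..D} \<times> UNIV)"
proof (rule indep_vars_of_char_prod)
  let ?X = "\<lambda>(i, r, b) \<omega>. re_im b (harmonic_coefficient s (N r) i \<omega>)"
  show "finite (J \<times> {1..D} \<times> (UNIV :: bool set))" using J by simp
  show "?X k \<in> borel_measurable M" if "k \<in> J \<times> {1..D} \<times> UNIV" for k
    using that J noise_component(1) gaussian_rv_measurable by fastforce
  fix t :: "(nat \<times> int) \<times> nat \<times> bool \<Rightarrow> real"
  \<comment> \<open>The minus sign makes \<open>Re (c r i * z)\<close> the combination of
    \<open>Re z\<close> and \<open>Im z\<close> with the two entries of \<open>t\<close>; the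
    squared modulus is the sum of their squares.\<close>
  define c where "c r i = Complex (t (i, r, True)) (- t (i, r, False))" for r i
  define h where "h r x = (\<Sum>i\<in>J. c r i * cnj (spin_harmonic s (fst i) (snd i) x))" for r x
  have hm [measurable]: "h r \<in> borel_measurable S2" for r unfolding h_def by measurable
  have "\<exists>d. \<forall>x. cmod (spin_harmonic s (fst i) (snd i) x) \<le> d" for i :: "nat \<times> int"
    using spin_harmonic_bounded[of s "fst i" "snd i"] by metis
  then obtain d where d: "\<And>i x. cmod (spin_harmonic s (fst i) (snd i) x) \<le> d i" by metis
  have hb: "cmod (h r x) \<le> (\<Sum>i\<in>J. cmod (c r i) * d i)" for r x
    unfolding h_def using d by (intro order_trans[OF norm_sum] sum_mono) (simp add: norm_mult mult_left_mono)
  let ?Z = "\<lambda>r \<omega>. Re (\<Sum>i\<in>J. c r i * harmonic_coefficient s (N r) i \<omega>)"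
  have hZ: "AE \<omega> in M. Re (LINT x|S2. N r \<omega> x * h r x) = ?Z r \<omega>" if r: "r \<in> {1..D}" for r
    using isotropic_field_facts(3)[OF fields[OF r]]
  proof eventually_elim
    case (elim \<omega>)
    have i: "integrable S2 (\<lambda>x. N r \<omega> x * cnj (spin_harmonic s (fst i) (snd i) x))" for i
      by (rule integrable_S2_bounded[OF elim, of _ "d i"]) (use d in auto)
    have "(LINT x|S2. N r \<omega> x * h r x) = (LINT x|S2. (\<Sum>i\<in>J. c r i * (N r \<omega> x
        * cnj (spin_harmonic s (fst i) (snd i) x))))"
      by (intro Bochner_Integration.integral_cong refl) (simp add: h_def sum_distrib_left mult_ac)
    also have "\<dots> = (\<Sum>i\<in>J. c r i * harmonic_coefficient s (N r) i \<omega>)"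
      unfolding harmonic_coefficient_def by (subst Bochner_Integration.integral_sum) (auto intro: i)
    finally show ?case by simp
  qed
  have Zm [measurable]: "?Z r \<in> borel_measurable M" if "r \<in> {1..D}" for r
    by (rule gaussian_rv_measurable[OF channel_linear_combination(1)[OF that J]])
  have Lm [measurable]: "(\<lambda>\<omega>. Re (LINT x|S2. N r \<omega> x * h r x)) \<in> borel_measurable M" if "r \<in> {1..D}" for r
  proof -
    note [measurable] = isotropic_field_facts(1)[OF fields[OF that]]
    show ?thesis by measurable
  qed
  have split: "(\<Sum>k\<in>J \<times> {1..D} \<times> UNIV. t k * ?X k \<omega>) = (\<Sum>r\<in>{1..D}. ?Z r \<omega>)" for \<omega>
  proof -
    have "(\<Sum>k\<in>J \<times> {1..D} \<times> UNIV. t k * ?X k \<omega>) = (\<Sum>i\<in>J. \<Sum>r\<in>{1..D}. \<Sum>b\<in>UNIV. t (i, r, b) * ?X (i, r, b) \<omega>)"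
      by (simp add: sum.cartesian_product case_prod_unfold)
    also have "\<dots> = (\<Sum>r\<in>{1..D}. \<Sum>i\<in>J. \<Sum>b\<in>UNIV. t (i, r, b) * ?X (i, r, b) \<omega>)"
      by (rule sum.swap)
    also have "\<dots> = (\<Sum>r\<in>{1..D}. ?Z r \<omega>)"
      by (intro sum.cong refl) (auto simp: UNIV_bool c_def re_im_def intro!: sum.cong)
    finally show ?thesis .
  qed
  have "AE \<omega> in M. \<forall>r\<in>{1..D}. Re (LINT x|S2. N r \<omega> x * h r x) = ?Z r \<omega>"
    by (rule AE_finite_allI) (use hZ in auto)
  then have "expectation (\<lambda>\<omega>. iexp (\<Sum>k\<in>J \<times> {1..D} \<times> UNIV. t k * ?X k \<omega>))
     = expectation (\<lambda>\<omega>. iexp (\<Sum>r\<in>{1..D}. Re (LINT x|S2. N r \<omega> x * h r x)))"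
    unfolding split by (intro integral_cong_AE) (measurable, auto elim!: eventually_mono)
  also have "\<dots> = (\<Prod>r\<in>{1..D}. expectation (\<lambda>\<omega>. iexp (Re (LINT x|S2. N r \<omega> x * h r x))))"
    by (rule channel_functionals_char[OF hm hb])
  also have "\<dots> = (\<Prod>r\<in>{1..D}. expectation (\<lambda>\<omega>. iexp (?Z r \<omega>)))"
  proof (intro prod.cong refl)
    fix r assume r: "r \<in> {1..D}"
    note [measurable] = Zm[OF r] Lm[OF r]
    show "expectation (\<lambda>\<omega>. iexp (Re (LINT x|S2. N r \<omega> x * h r x))) = expectation (\<lambda>\<omega>. iexp (?Z r \<omega>))"
      using hZ[OF r] by (intro integral_cong_AE) (measurable, auto elim!: eventually_mono)
  qed
  \<comment> \<open>The 4 combines the 1/2 of the Gaussian exponent with the 1/2 in the variance of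
    a real part.\<close>
  also have "\<dots> = (\<Prod>r\<in>{1..D}. of_real (exp (- (\<Sum>i\<in>J. (cmod (c r i))\<^sup>2 * C r (fst i)) / 4)))"
  proof (intro prod.cong refl)
    fix r assume r: "r \<in> {1..D}"
    note Z = channel_linear_combination[OF r J, of "c r"]
    show "expectation (\<lambda>\<omega>. iexp (?Z r \<omega>)) = of_real (exp (- (\<Sum>i\<in>J. (cmod (c r i))\<^sup>2 * C r (fst i)) / 4))"
      unfolding gaussian_rv_char[OF Z(1,2)] Z(3) by simp
  qed
  also have "\<dots> = (\<Prod>r\<in>{1..D}. \<Prod>i\<in>J. \<Prod>b\<in>UNIV. of_real (exp (- (t (i, r, b))\<^sup>2 * C r (fst i) / 4)))"
  proof (intro prod.cong refl)
    fix r
    have "- (\<Sum>i\<in>J. (cmod (c r i))\<^sup>2 * C r (fst i)) / 4 = (\<Sum>i\<in>J. \<Sum>b\<in>UNIV. - (t (i, r, b))\<^sup>2 * C r (fst i) / 4)"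
      unfolding sum_negf[symmetric] sum_divide_distrib
      by (intro sum.cong refl) (simp add: UNIV_bool c_def cmod_power2 field_simps)
    then show "complex_of_real (exp (- (\<Sum>i\<in>J. (cmod (c r i))\<^sup>2 * C r (fst i)) / 4))
        = (\<Prod>i\<in>J. \<Prod>b\<in>UNIV. of_real (exp (- (t (i, r, b))\<^sup>2 * C r (fst i) / 4)))"
      using J by (simp only: exp_sum finite of_real_prod)
  qed
  also have "\<dots> = (\<Prod>i\<in>J. \<Prod>r\<in>{1..D}. \<Prod>b\<in>UNIV. of_real (exp (- (t (i, r, b))\<^sup>2 * C r (fst i) / 4)))"
    by (rule prod.swap)
  also have "\<dots> = (\<Prod>k\<in>J \<times> {1..D} \<times> UNIV. case k of (i, r, b) \<Rightarrow> of_real (exp (- (t (i, r, b))\<^sup>2 * C r (fst i) / 4)))"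
    by (simp add: prod.cartesian_product case_prod_unfold)
  also have "\<dots> = (\<Prod>k\<in>J \<times> {1..D} \<times> UNIV. expectation (\<lambda>\<omega>. iexp (t k * ?X k \<omega>)))"
  proof (intro prod.cong refl)
    fix k assume "k \<in> J \<times> {1..D} \<times> (UNIV :: bool set)"
    then obtain i r b where k: "k = (i, r, b)" and i: "i \<in> J" and r: "r \<in> {1..D}" by auto
    define u where "u = of_real (t k) * (if b then 1 else - \<i>)"
    have "t k * ?X k \<omega> = Re (\<Sum>i\<in>{i}. u * harmonic_coefficient s (N r) i \<omega>)" for \<omega>
      by (simp add: k u_def re_im_def)
    moreover have "(cmod u)\<^sup>2 = (t k)\<^sup>2" by (simp add: u_def norm_mult)
    ultimately show "(case k of (i, r, b) \<Rightarrow> of_real (exp (- (t (i, r, b))\<^sup>2 * C r (fst i) / 4)))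
        = expectation (\<lambda>\<omega>. iexp (t k * ?X k \<omega>))"
      using channel_linear_combination[OF r, of "{i}" "\<lambda>_. u"] gaussian_rv_char[OF
          channel_linear_combination(1,2)[OF r, of "{i}" "\<lambda>_. u"]] i J
      by (auto simp: k)
  qed
  finally show "expectation (\<lambda>\<omega>. iexp (\<Sum>k\<in>J \<times> {1..D} \<times> UNIV. t k * ?X k \<omega>))
      = (\<Prod>k\<in>J \<times> {1..D} \<times> UNIV. expectation (\<lambda>\<omega>. iexp (t k * ?X k \<omega>)))" .
qed

end
end

section \<open>Needlet coefficients\<close>

definition window_weight :: "int \<Rightarrow> real \<Rightarrow> (real \<Rightarrow> real) \<Rightarrow> nat \<Rightarrow> nat \<Rightarrow> real" where
  "window_weight s B b j l = b (sqrt (spin_eigenvalue s l) / B ^ j)"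

definition window_multipoles :: "int \<Rightarrow> real \<Rightarrow> (real \<Rightarrow> real) \<Rightarrow> nat \<Rightarrow> nat set" where
  "window_multipoles s B b j = {l \<in> multipoles s. window_weight s B b j l \<noteq> 0}"

definition window_indices :: "int \<Rightarrow> real \<Rightarrow> (real \<Rightarrow> real) \<Rightarrow> nat \<Rightarrow> (nat \<times> int) set" where
  "window_indices s B b j = (SIGMA l : window_multipoles s B b j. {- int l..int l})"

lemma spin_eigenvalue_nonneg: "l \<in> multipoles s \<Longrightarrow> 0 \<le> spin_eigenvalue s l"
  unfolding spin_eigenvalue_def multipoles_def by (simp only: of_int_0_le_iff, intro mult_nonneg_nonneg) auto

text \<open>The difference of squares \<open>e - l^2 = l - s^2 - s\<close> is of order
  \<open>l\<close>, and dividing by \<open>sqrt e + l >= l\<close> leaves a bounded error. The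
  window can thus be read as a condition on \<open>l / B^j\<close>, up to a bounded shift of
  \<open>l\<close>.\<close>

lemma sqrt_spin_eigenvalue_approx:
  assumes l: "l \<in> multipoles s"
  shows "\<bar>sqrt (spin_eigenvalue s l) - real l\<bar> \<le> 1 + (real_of_int s)\<^sup>2 + \<bar>real_of_int s\<bar>"
proof -
  let ?e = "spin_eigenvalue s l" and ?s = "real_of_int s"
  have l1: "1 \<le> real l" using l by (simp add: multipoles_def)
  have e0: "0 \<le> ?e" by (rule spin_eigenvalue_nonneg[OF l])
  have e: "?e - (real l)\<^sup>2 = real l - ?s\<^sup>2 - ?s"
    by (simp add: spin_eigenvalue_def power2_eq_square algebra_simps)
  have "(sqrt ?e - real l) * (sqrt ?e + real l) = ?e - (real l)\<^sup>2"
    using e0 by (simp add: algebra_simps power2_eq_square)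
  then have "\<bar>sqrt ?e - real l\<bar> * (sqrt ?e + real l) = \<bar>real l - ?s\<^sup>2 - ?s\<bar>"
    unfolding e using e0 by (metis abs_mult abs_of_nonneg add_nonneg_nonneg of_nat_0_le_iff real_sqrt_ge_zero)
  moreover have "\<bar>sqrt ?e - real l\<bar> * real l \<le> \<bar>sqrt ?e - real l\<bar> * (sqrt ?e + real l)"
    using e0 by (intro mult_left_mono) auto
  moreover have "\<bar>real l - ?s\<^sup>2 - ?s\<bar> \<le> real l * (1 + ?s\<^sup>2 + \<bar>?s\<bar>)"
  proof -
    have "?s\<^sup>2 + \<bar>?s\<bar> \<le> real l * (?s\<^sup>2 + \<bar>?s\<bar>)" using mult_right_mono[OF l1, of "?s\<^sup>2 + \<bar>?s\<bar>"] by simp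
    moreover have "\<bar>real l - ?s\<^sup>2 - ?s\<bar> \<le> real l + (?s\<^sup>2 + \<bar>?s\<bar>)"
      using l1 zero_le_power2[of ?s] by linarith
    moreover have "real l * (1 + ?s\<^sup>2 + \<bar>?s\<bar>) = real l + real l * (?s\<^sup>2 + \<bar>?s\<bar>)"
      by (simp add: algebra_simps)
    ultimately show ?thesis by linarith
  qed
  ultimately have "\<bar>sqrt ?e - real l\<bar> * real l \<le> (1 + ?s\<^sup>2 + \<bar>?s\<bar>) * real l"
    by (simp add: mult.commute)
  then show ?thesis using l1 by simp
qed

section \<open>Size and number of the multipoles seen by the window\<close>

context
  fixes s :: int and B :: real and b :: "real \<Rightarrow> real"
  assumes B: "1 < B" and window: "needlet_window B b"
begin

lemma window_nonneg: "0 \<le> b u"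
  using window by (simp add: needlet_window_def)

lemma window_support: "b u \<noteq> 0 \<Longrightarrow> 1 / B \<le> u \<and> u \<le> B"
  using window unfolding needlet_window_def by (metis atLeastAtMost_iff)

lemma window_partition: "0 < u \<Longrightarrow> ((\<lambda>j::int. (b (u / B powi j))\<^sup>2) has_sum 1) UNIV"
  using window by (simp add: needlet_window_def)

text \<open>For \<open>u > 0\<close> the square is one term of a series of nonnegative terms with
  sum 1; all other \<open>u\<close> lie outside the support.\<close>

lemma window_le_1: "b u \<le> 1"
proof (cases "0 < u")
  case True
  have "sum (\<lambda>j::int. (b (u / B powi j))\<^sup>2) {0} \<le> 1"
    by (rule finite_sum_le_has_sum[OF window_partition[OF True]]) auto
  then have "(b u)\<^sup>2 \<le> 1\<^sup>2" by simp
  then show ?thesis by (rule power2_le_imp_le) simp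
next
  case False
  have "0 < 1 / B" using B by simp
  then have "\<not> 1 / B \<le> u" using False by linarith
  then have "b u = 0" using window_support by blast
  then show ?thesis by simp
qed

lemma continuous_window: "isCont b u"
proof -
  have "(deriv ^^ 0) b field_differentiable (at u)"
    using window unfolding needlet_window_def smooth_on_def by blast
  then show ?thesis by (simp add: field_differentiable_imp_continuous_at)
qed

text \<open>The partition of unity prevents the window from vanishing identically, and continuity
  spreads a positive value over an interval. The multipoles falling into it carry the lower bound on
  the variance; \<open>\<delta> < u\<close> keeps them of order \<open>B^j\<close>.\<close>

lemma window_lower_bound:
  obtains u \<delta> \<epsilon> where "0 < \<delta>" "\<delta> < u" "0 < \<epsilon>" "\<And>x. \<bar>x - u\<bar> \<le> \<delta> \<Longrightarrow> \<epsilon> \<le> b x"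
proof -
  obtain u where u: "b u \<noteq> 0"
  proof (rule ccontr)
    assume "\<not> thesis"
    then have "b u = 0" for u using that by blast
    then have "((\<lambda>j::int. 0 :: real) has_sum 1) UNIV" using window_partition[of 1] by simp
    moreover have "((\<lambda>j::int. 0 :: real) has_sum 0) UNIV" by (rule has_sum_0) simp
    ultimately show False using has_sum_unique by fastforce
  qed
  have u0: "0 < u"
  proof -
    have "0 < 1 / B" using B by simp
    then show ?thesis using window_support[OF u] by linarith
  qed
  have bu: "0 < b u" using u window_nonneg[of u] by simp
  have "eventually (\<lambda>x. b u / 2 < b x) (nhds u)"
  proof (rule order_tendstoD(1))
    show "(b \<longlongrightarrow> b u) (nhds u)"
      using continuous_window[of u] by (simp add: isCont_def tendsto_at_iff_tendsto_nhds)
  qed (use bu in simp)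
  then obtain d where d: "0 < d" "\<And>x. dist x u < d \<Longrightarrow> b u / 2 < b x"
    unfolding eventually_nhds_metric by blast
  show thesis
  proof (rule that[of "min (d / 2) (u / 2)" u "b u / 2"])
    fix x assume "\<bar>x - u\<bar> \<le> min (d / 2) (u / 2)"
    then have "dist x u < d" using d(1) by (simp add: dist_real_def)
    then show "b u / 2 \<le> b x" using d(2) by (simp add: less_imp_le)
  qed (use d u0 bu in auto)
qed

lemma window_multipole_bounds:
  assumes "l \<in> window_multipoles s B b j"
  shows "B ^ j / B \<le> sqrt (spin_eigenvalue s l)" "sqrt (spin_eigenvalue s l) \<le> B ^ (j + 1)"
proof -
  have "0 < B ^ j" using B by simp
  then show "B ^ j / B \<le> sqrt (spin_eigenvalue s l)" "sqrt (spin_eigenvalue s l) \<le> B ^ (j + 1)"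
    using window_support[of "sqrt (spin_eigenvalue s l) / B ^ j"] assms B
    by (auto simp: window_multipoles_def window_weight_def field_simps)
qed

lemma window_multipoles_le:
  assumes "l \<in> window_multipoles s B b j"
  shows "real l \<le> B ^ (j + 1) + (1 + (real_of_int s)\<^sup>2 + \<bar>real_of_int s\<bar>)"
  using window_multipole_bounds[OF assms] sqrt_spin_eigenvalue_approx[of l s] assms
  by (auto simp: window_multipoles_def)

lemma finite_window_multipoles: "finite (window_multipoles s B b j)"
proof (rule finite_subset)
  show "window_multipoles s B b j \<subseteq> {..nat \<lceil>B ^ (j + 1) + (1 + (real_of_int s)\<^sup>2 + \<bar>real_of_int s\<bar>)\<rceil>}"
  proof
    fix l assume "l \<in> window_multipoles s B b j"
    from window_multipoles_le[OF this] show "l \<in> {..nat \<lceil>B ^ (j + 1) + (1 + (real_of_int s)\<^sup>2 + \<bar>real_of_int s\<bar>)\<rceil>}"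
      by (simp add: le_nat_iff le_ceiling_iff)
  qed
qed simp

lemma finite_window_indices: "finite (window_indices s B b j)"
  unfolding window_indices_def by (intro finite_SigmaI finite_window_multipoles) simp

lemma window_indices_subset: "window_indices s B b j \<subseteq> multipole_indices s"
  by (auto simp: window_indices_def window_multipoles_def multipole_indices_def)

lemma power_dominates: "eventually (\<lambda>j. c \<le> \<delta> * B ^ j) sequentially" if "0 < \<delta>" for c \<delta> :: real
proof -
  obtain n where n: "c / \<delta> < B ^ n" using real_arch_pow[OF B] by blast
  show ?thesis
  proof (rule eventually_sequentiallyI[of n])
    fix j assume "n \<le> j"
    then have "B ^ n \<le> B ^ j" using B by (intro power_increasing) auto
    then have "c / \<delta> \<le> B ^ j" using n by linarith
    then show "c \<le> \<delta> * B ^ j" using that by (simp add: field_simps)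
  qed
qed

text \<open>The support puts the root of the eigenvalue between \<open>B^j / B\<close> and
  \<open>B * B^j\<close>; halving and doubling absorb its bounded distance \<open>H\<close> from
  \<open>l\<close>.\<close>

lemma window_multipole_range:
  "eventually (\<lambda>j. \<forall>l\<in>window_multipoles s B b j. 1 / (2 * B) * B ^ j \<le> real l \<and> real l \<le> 2 * B * B ^ j) sequentially"
proof -
  define H where "H = 1 + (real_of_int s)\<^sup>2 + \<bar>real_of_int s\<bar>"
  have 1: "eventually (\<lambda>j. H \<le> 1 / (2 * B) * B ^ j) sequentially" and 2: "eventually (\<lambda>j. H \<le> B * B ^ j) sequentially"
    by (rule power_dominates, use B in simp)+
  show ?thesis using 1 2
  proof eventually_elim
    case (elim j)
    show ?case
    proof
      fix l assume l: "l \<in> window_multipoles s B b j"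
      have "\<bar>sqrt (spin_eigenvalue s l) - real l\<bar> \<le> H"
        using sqrt_spin_eigenvalue_approx[of l s] l by (auto simp: window_multipoles_def H_def)
      moreover have "B ^ j / B = 1 / (2 * B) * B ^ j + 1 / (2 * B) * B ^ j" using B by (simp add: field_simps)
      moreover have "B ^ (j + 1) = B * B ^ j" by simp
      ultimately show "1 / (2 * B) * B ^ j \<le> real l \<and> real l \<le> 2 * B * B ^ j"
        using window_multipole_bounds[OF l] elim by (auto simp: abs_le_iff)
    qed
  qed
qed

text \<open>There are at most \<open>(2 * B + 1) * B^j\<close> degrees, each with at most
  \<open>(4 * B + 1) * B^j\<close> orders. The summands 1 absorb additive constants, since
  \<open>B^j >= 1\<close>.\<close>

lemma card_window_indices:
  "eventually (\<lambda>j. real (card (window_indices s B b j)) \<le> (2 * B + 1) * (4 * B + 1) * B ^ (2 * j)) sequentially"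
  using window_multipole_range
proof eventually_elim
  case (elim j)
  let ?L = "window_multipoles s B b j"
  have Bj: "1 \<le> B ^ j" using B by (simp add: one_le_power)
  have "real (card (window_indices s B b j)) = (\<Sum>l\<in>?L. 2 * real l + 1)"
    unfolding window_indices_def
        by (subst card_SigmaI) (auto simp: finite_window_multipoles nat_add_distrib add.commute)
  also have "\<dots> \<le> (\<Sum>l\<in>?L. (4 * B + 1) * B ^ j)"
  proof (rule sum_mono)
    fix l assume "l \<in> ?L"
    then have "2 * real l + 1 \<le> 2 * (2 * B * B ^ j) + B ^ j" using elim Bj by auto
    then show "2 * real l + 1 \<le> (4 * B + 1) * B ^ j" by (simp add: algebra_simps)
  qed
  also have "\<dots> = real (card ?L) * ((4 * B + 1) * B ^ j)" by simp
  also have "\<dots> \<le> ((2 * B + 1) * B ^ j) * ((4 * B + 1) * B ^ j)"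
  proof (rule mult_right_mono)
    have "?L \<subseteq> {..nat \<lfloor>2 * B * B ^ j\<rfloor>}"
      using elim by (auto simp: le_nat_floor)
    then have "card ?L \<le> nat \<lfloor>2 * B * B ^ j\<rfloor> + 1" using card_mono[of "{..nat \<lfloor>2 * B * B ^ j\<rfloor>}" ?L] by simp
    then have "real (card ?L) \<le> real (nat \<lfloor>2 * B * B ^ j\<rfloor>) + 1" by linarith
    also have "\<dots> \<le> 2 * B * B ^ j + B ^ j" using B Bj by (intro add_mono) (simp_all add: of_nat_floor)
    finally show "real (card ?L) \<le> (2 * B + 1) * B ^ j" by (simp add: algebra_simps)
  qed (use B in auto)
  also have "\<dots> = (2 * B + 1) * (4 * B + 1) * B ^ (2 * j)" by (simp add: power_even_eq power2_eq_square)
  finally show ?case .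
qed

text \<open>Take the degrees with \<open>l / B^j\<close> within \<open>\<delta> / 2\<close> of
  \<open>u\<close>; the other half of \<open>\<delta>\<close> absorbs the distance between
  \<open>l\<close> and the root of its eigenvalue. At least \<open>\<delta> / 2 * B^j\<close> of
  them survive rounding, each with at least \<open>(u - \<delta> / 2) * B^j\<close> orders, and the
  product of the two factors is \<open>c\<close>.\<close>

lemma many_window_indices:
  obtains \<epsilon> c where "0 < \<epsilon>" "0 < c"
    "eventually (\<lambda>j. c * B ^ (2 * j) \<le> real (card {i \<in> window_indices s B b j. \<epsilon>
        \<le> window_weight s B b j (fst i)})) sequentially"
proof -
  obtain u \<delta> \<epsilon> where \<delta>: "0 < \<delta>" "\<delta> < u" and \<epsilon>: "0 < \<epsilon>" and low: "\<And>x. \<bar>x - u\<bar> \<le> \<delta> \<Longrightarrow> \<epsilon> \<le> b x"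
    using window_lower_bound by metis
  define H where "H = 1 + (real_of_int s)\<^sup>2 + \<bar>real_of_int s\<bar>"
  have "eventually (\<lambda>j. H \<le> \<delta> / 2 * B ^ j) sequentially" by (rule power_dominates) (use \<delta> in simp)
  \<comment> \<open>Pays for rounding both ends of the interval of degrees.\<close>
  moreover have "eventually (\<lambda>j. 2 \<le> \<delta> / 2 * B ^ j) sequentially" by (rule power_dominates) (use \<delta> in simp)
  \<comment> \<open>Makes all these degrees exceed \<open>|s|\<close>, so that they are
    multipoles.\<close>
  moreover have "eventually (\<lambda>j. \<bar>real_of_int s\<bar> + 1 \<le> (u - \<delta> / 2) * B ^ j) sequentially"
      by (rule power_dominates) (use \<delta> in simp)
  ultimately have ev: "eventually (\<lambda>j. (\<delta> / 2) * (u - \<delta> / 2) * B ^ (2 * j)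
      \<le> real (card {i \<in> window_indices s B b j. \<epsilon> \<le> window_weight s B b j (fst i)})) sequentially"
  proof eventually_elim
    case (elim j)
    let ?G = "{i \<in> window_indices s B b j. \<epsilon> \<le> window_weight s B b j (fst i)}"
    have Bj: "0 < B ^ j" using B by simp
    define p q where "p = nat \<lceil>(u - \<delta> / 2) * B ^ j\<rceil>" and "q = nat \<lfloor>(u + \<delta> / 2) * B ^ j\<rfloor>"
    have p0: "0 \<le> (u - \<delta> / 2) * B ^ j" using \<delta> Bj by simp
    have p: "(u - \<delta> / 2) * B ^ j \<le> real p" "real p \<le> (u - \<delta> / 2) * B ^ j + 1"
      unfolding p_def using p0 by linarith+
    have q: "real q \<le> (u + \<delta> / 2) * B ^ j" "(u + \<delta> / 2) * B ^ j - 1 \<le> real q"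
    proof -
      have "0 \<le> (u + \<delta> / 2) * B ^ j" using \<delta> Bj by simp
      then show "real q \<le> (u + \<delta> / 2) * B ^ j" "(u + \<delta> / 2) * B ^ j - 1 \<le> real q"
        unfolding q_def by linarith+
    qed
    have len: "\<delta> / 2 * B ^ j \<le> real (card {p..q})"
    proof -
      have "(u + \<delta> / 2) * B ^ j - (u - \<delta> / 2) * B ^ j = \<delta> / 2 * B ^ j + \<delta> / 2 * B ^ j" by (simp add: algebra_simps)
      then have "real p + \<delta> / 2 * B ^ j \<le> real q + 1" using p q elim by linarith
      moreover have "0 \<le> \<delta> / 2 * B ^ j" using \<delta> Bj by simp
      ultimately have "p \<le> Suc q" "\<delta> / 2 * B ^ j \<le> real q + 1 - real p" by linarith+
      then show ?thesis by (simp add: of_nat_diff)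
    qed
    have sub: "(SIGMA l : {p..q}. {- int l..int l}) \<subseteq> ?G"
    proof safe
      fix l m assume l: "l \<in> {p..q}" and m: "m \<in> {- int l..int l}"
      have lr: "(u - \<delta> / 2) * B ^ j \<le> real l" "real l \<le> (u + \<delta> / 2) * B ^ j" using l p q by auto
      then have "\<bar>real_of_int s\<bar> + 1 \<le> real l" using elim by linarith
      then have lm: "l \<in> multipoles s" unfolding multipoles_def by (simp add: le_nat_iff) linarith
      let ?x = "sqrt (spin_eigenvalue s l)"
      have near: "\<bar>?x - real l\<bar> \<le> \<delta> / 2 * B ^ j"
        using sqrt_spin_eigenvalue_approx[OF lm] elim by (simp add: H_def)
      have "(u - \<delta>) * B ^ j = (u - \<delta> / 2) * B ^ j - \<delta> / 2 * B ^ j"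
        by (simp add: algebra_simps)
      then have "(u - \<delta>) * B ^ j \<le> ?x" using lr(1) abs_le_D2[OF near] by linarith
      moreover have "(u + \<delta>) * B ^ j = (u + \<delta> / 2) * B ^ j + \<delta> / 2 * B ^ j"
        by (simp add: algebra_simps)
      then have "?x \<le> (u + \<delta>) * B ^ j" using lr(2) abs_le_D1[OF near] by linarith
      ultimately have "(u - \<delta>) * B ^ j \<le> ?x" "?x \<le> (u + \<delta>) * B ^ j" .
      then have "u - \<delta> \<le> ?x / B ^ j" "?x / B ^ j \<le> u + \<delta>"
        by (simp_all only: pos_le_divide_eq[OF Bj] pos_divide_le_eq[OF Bj])
      then have "\<epsilon> \<le> window_weight s B b j l" unfolding window_weight_def by (intro low) (simp add: abs_le_iff)
      then show "(l, m) \<in> window_indices s B b j" "\<epsilon> \<le> window_weight s B b j (fst (l, m))"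
        using lm m \<epsilon> by (auto simp: window_indices_def window_multipoles_def)
    qed
    have "(\<delta> / 2) * (u - \<delta> / 2) * B ^ (2 * j) = (\<delta> / 2 * B ^ j) * ((u - \<delta> / 2) * B ^ j)"
      by (simp add: power_even_eq power2_eq_square)
    also have "\<dots> \<le> real (card {p..q}) * ((u - \<delta> / 2) * B ^ j)"
      by (rule mult_right_mono[OF len p0])
    also have "\<dots> = (\<Sum>l\<in>{p..q}. (u - \<delta> / 2) * B ^ j)" by simp
    also have "\<dots> \<le> (\<Sum>l\<in>{p..q}. 2 * real l + 1)"
    proof (rule sum_mono)
      fix l assume "l \<in> {p..q}"
      then have "real p \<le> real l" by simp
      then show "(u - \<delta> / 2) * B ^ j \<le> 2 * real l + 1" using p by linarith
    qed
    also have "\<dots> = real (card (SIGMA l : {p..q}. {- int l..int l}))"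
      by (subst card_SigmaI) (auto simp: nat_add_distrib add.commute)
    also have "\<dots> \<le> real (card ?G)"
      using sub finite_window_indices by (intro of_nat_mono card_mono) auto
    finally show ?case .
  qed
  show thesis by (rule that[OF \<epsilon> _ ev]) (use \<delta> in auto)
qed

end

section \<open>Deviation over channels for complex vectors\<close>

lemma cnj_sum_square:
  fixes z :: "'i \<Rightarrow> complex"
  shows "of_real ((cmod (sum z A))\<^sup>2) = (\<Sum>p\<in>A. \<Sum>q\<in>A. z p * cnj (z q))"
  by (simp only: complex_norm_square cnj_sum sum_product)

lemma squared_deviation_shift:
  fixes x :: "nat \<Rightarrow> real"
  assumes "1 \<le> D"
  shows "squared_deviation D (\<lambda>r. c + x r) = squared_deviation D x"
proof -
  define S where "S = (\<Sum>r\<in>{1..D}. x r)"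
  have "(\<Sum>r\<in>{1..D}. (c + x r)\<^sup>2) = D * c\<^sup>2 + 2 * c * S + (\<Sum>r\<in>{1..D}. (x r)\<^sup>2)"
    by (simp add: power2_sum sum.distrib S_def sum_distrib_left)
  moreover have "(\<Sum>r\<in>{1..D}. c + x r) = D * c + S" by (simp add: sum.distrib S_def)
  ultimately show ?thesis
    using assms unfolding squared_deviation_def S_def[symmetric]
    by (simp add: field_simps power2_eq_square)
qed

definition complex_deviation :: "nat \<Rightarrow> (nat \<Rightarrow> complex) \<Rightarrow> real" where
  "complex_deviation D z = (\<Sum>r\<in>{1..D}. (cmod (z r))\<^sup>2) - (cmod (\<Sum>r\<in>{1..D}. z r))\<^sup>2 / real D"

lemma complex_deviation_re_im:
  "complex_deviation D z = (\<Sum>b\<in>UNIV. squared_deviation D (\<lambda>r. re_im b (z r)))"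
  by (simp add: UNIV_bool complex_deviation_def squared_deviation_def re_im_def cmod_power2 sum.distrib
      add_divide_distrib)

lemma complex_deviation_shift:
  assumes "1 \<le> D"
  shows "complex_deviation D (\<lambda>r. p + z r) = complex_deviation D z"
proof -
  have "re_im b (p + z r) = re_im b p + re_im b (z r)" for b r by (simp add: re_im_def)
  then show ?thesis
    unfolding complex_deviation_re_im by (simp only: squared_deviation_shift[OF assms])
qed

text \<open>The off-diagonal sum is the squared modulus of the total minus the diagonal. It is
  therefore real, and both estimators are combinations of the same two energies.\<close>

lemma cross_minus_auto:
  fixes z :: "nat \<Rightarrow> complex"
  assumes D: "2 \<le> D"
  shows "Re (\<Sum>r\<in>{1..D}. \<Sum>q\<in>{1..D} - {r}. z r * cnj (z q)) / (real D * (real D - 1))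
      - (\<Sum>r\<in>{1..D}. (cmod (z r))\<^sup>2) / real D
    = - complex_deviation D z / (real D - 1)"
proof -
  define A where "A = (\<Sum>r\<in>{1..D}. (cmod (z r))\<^sup>2)"
  define S where "S = (cmod (\<Sum>r\<in>{1..D}. z r))\<^sup>2"
  have "(\<Sum>r\<in>{1..D}. \<Sum>q\<in>{1..D} - {r}. z r * cnj (z q)) = (\<Sum>r\<in>{1..D}. (\<Sum>q\<in>{1..D}. z r * cnj (z q)) - z r * cnj (z r))"
    by (intro sum.cong refl) (simp add: sum_diff1)
  also have "\<dots> = of_real S - of_real A"
  proof -
    have "of_real S = (\<Sum>r\<in>{1..D}. \<Sum>q\<in>{1..D}. z r * cnj (z q))"
      unfolding S_def by (rule cnj_sum_square)
    moreover have "of_real A = (\<Sum>r\<in>{1..D}. z r * cnj (z r))"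
      unfolding A_def of_real_sum complex_norm_square ..
    ultimately show ?thesis by (simp only: sum_subtractf)
  qed
  finally have "Re (\<Sum>r\<in>{1..D}. \<Sum>q\<in>{1..D} - {r}. z r * cnj (z q)) = S - A" by simp
  moreover have "(S - A) / (real D * (real D - 1)) - A / real D = - (A - S / real D) / (real D - 1)"
    using D by (simp add: field_simps)
  ultimately show ?thesis by (simp add: complex_deviation_def A_def S_def)
qed

section \<open>Needlet coefficients and Parseval's identity\<close>

context
  fixes s :: int and B :: real and b :: "real \<Rightarrow> real" and K :: "nat \<Rightarrow> nat" and \<xi> :: "nat \<Rightarrow> nat \<Rightarrow> real ^ 3"
      and w :: "nat \<Rightarrow> nat \<Rightarrow> real"
  assumes B: "1 < B" and window: "needlet_window B b" and cub: "cubature_system s B K \<xi> w"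
begin

text \<open>The compact support of the window leaves finitely many multipoles, which turns the
  infinite sum into a finite one.\<close>

lemma spin_needlet_finite:
  "spin_needlet s B b \<xi> w j k x = (\<Sum>i\<in>window_indices s B b j. of_real (sqrt (w j k) * window_weight s B b j (fst i)) *
     (spin_harmonic s (fst i) (snd i) x * cnj (spin_harmonic s (fst i) (snd i) (\<xi> j k))))"
proof -
  let ?Y = "\<lambda>l m x. spin_harmonic s l m x"
  have "(\<Sum>\<^sub>\<infinity>l\<in>multipoles s. of_real (b (sqrt (spin_eigenvalue s l) / B ^ j)) * (\<Sum>m\<in>{- int l..int l}. ?Y l m x
      * cnj (?Y l m (\<xi> j k))))
     = (\<Sum>\<^sub>\<infinity>l\<in>window_multipoles s B b j. of_real (b (sqrt (spin_eigenvalue s l) / B ^ j))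
         * (\<Sum>m\<in>{- int l..int l}. ?Y l m x * cnj (?Y l m (\<xi> j k))))"
    by (rule infsum_cong_neutral) (auto simp: window_multipoles_def window_weight_def)
  also have "\<dots> = (\<Sum>l\<in>window_multipoles s B b j. of_real (b (sqrt (spin_eigenvalue s l) / B ^ j))
      * (\<Sum>m\<in>{- int l..int l}. ?Y l m x * cnj (?Y l m (\<xi> j k))))"
    by (rule infsum_finite[OF finite_window_multipoles[OF B window]])
  also have "\<dots> = (\<Sum>l\<in>window_multipoles s B b j. \<Sum>m\<in>{- int l..int l}. of_real (window_weight s B b j l)
      * (?Y l m x * cnj (?Y l m (\<xi> j k))))"
    by (simp add: sum_distrib_left window_weight_def)
  also have "\<dots> = (\<Sum>i\<in>window_indices s B b j. of_real (window_weight s B b j (fst i)) * (?Y (fst i) (snd i) x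
      * cnj (?Y (fst i) (snd i) (\<xi> j k))))"
    unfolding window_indices_def
    by (subst sum.Sigma) (auto simp: finite_window_multipoles[OF B window] case_prod_unfold)
  finally show ?thesis
    unfolding spin_needlet_def by (simp add: sum_distrib_left mult.assoc)
qed

lemma spin_needlet_measurable: "spin_needlet s B b \<xi> w j k \<in> borel_measurable S2"
  unfolding spin_needlet_finite[abs_def] by measurable

lemma field_coefficient_expand:
  assumes T: "integrable S2 (T \<omega>)"
  shows "field_coefficient T (spin_needlet s B b \<xi> w) j k \<omega>
    = (\<Sum>i\<in>window_indices s B b j. of_real (sqrt (w j k)) * spin_harmonic s (fst i) (snd i) (\<xi> j k)
        * (of_real (window_weight s B b j (fst i)) * harmonic_coefficient s T i \<omega>))"
proof -
  have int: "integrable S2 (\<lambda>x. T \<omega> x * cnj (spin_harmonic s (fst i) (snd i) x))" for i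
  proof -
    obtain c where "\<And>x. cmod (spin_harmonic s (fst i) (snd i) x) \<le> c" using spin_harmonic_bounded by blast
    then show ?thesis by (intro integrable_S2_bounded[OF T, of _ c]) auto
  qed
  have "T \<omega> x * cnj (spin_needlet s B b \<xi> w j k x) = (\<Sum>i\<in>window_indices s B b j. of_real (sqrt (w j k))
      * spin_harmonic s (fst i) (snd i) (\<xi> j k)
        * of_real (window_weight s B b j (fst i)) * (T \<omega> x * cnj (spin_harmonic s (fst i) (snd i) x)))" for x
    unfolding spin_needlet_finite cnj_sum sum_distrib_left by (intro sum.cong refl) (simp add: mult_ac)
  then show ?thesis
    unfolding field_coefficient_def harmonic_coefficient_def
    by (simp only:) (subst Bochner_Integration.integral_sum, auto intro!: integrable_mult_right int simp: mult.assoc)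
qed

text \<open>The window confines \<open>\<surd>e\<^sub>l\<^sub>s\<close> to the range where the cubature rule is exact.\<close>

lemma needlet_parseval:
  fixes z :: "nat \<times> int \<Rightarrow> complex"
  shows "(\<Sum>k<K j. (cmod (\<Sum>i\<in>window_indices s B b j. of_real (sqrt (w j k))
      * spin_harmonic s (fst i) (snd i) (\<xi> j k) * z i))\<^sup>2)
    = (\<Sum>i\<in>window_indices s B b j. (cmod (z i))\<^sup>2)"
proof -
  let ?I = "window_indices s B b j" and ?Y = "\<lambda>k i. spin_harmonic s (fst i) (snd i) (\<xi> j k)"
  have w: "0 \<le> w j k" if "k < K j" for k
    using cub that unfolding cubature_system_def by (meson less_imp_le)
  have "complex_of_real (\<Sum>k<K j. (cmod (\<Sum>i\<in>?I. of_real (sqrt (w j k)) * ?Y k i * z i))\<^sup>2)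
     = (\<Sum>k<K j. \<Sum>p\<in>?I. \<Sum>q\<in>?I. (of_real (sqrt (w j k)) * ?Y k p * z p) * cnj (of_real (sqrt (w j k)) * ?Y k q * z q))"
    unfolding of_real_sum cnj_sum_square ..
  also have "\<dots> = (\<Sum>k<K j. \<Sum>p\<in>?I. \<Sum>q\<in>?I. (z p * cnj (z q)) * (of_real (w j k) * ?Y k p * cnj (?Y k q)))"
  proof (intro sum.cong refl)
    fix k p q assume "k \<in> {..<K j}"
    then have "of_real (sqrt (w j k)) * of_real (sqrt (w j k)) = complex_of_real (w j k)"
      using w[of k] by (simp flip: of_real_mult)
    then show "(of_real (sqrt (w j k)) * ?Y k p * z p) * cnj (of_real (sqrt (w j k)) * ?Y k q * z q)
       = (z p * cnj (z q)) * (of_real (w j k) * ?Y k p * cnj (?Y k q))"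
      by (simp add: mult_ac)
  qed
  also have "\<dots> = (\<Sum>p\<in>?I. \<Sum>q\<in>?I. (z p * cnj (z q)) * (\<Sum>k<K j. of_real (w j k) * ?Y k p * cnj (?Y k q)))"
    unfolding sum_distrib_left by (subst sum.swap, intro sum.cong refl, rule sum.swap)
  also have "\<dots> = (\<Sum>p\<in>?I. \<Sum>q\<in>?I. if p = q then of_real ((cmod (z p))\<^sup>2) else 0)"
  proof (intro sum.cong refl)
    fix p q assume p: "p \<in> ?I" and q: "q \<in> ?I"
    have orth: "(\<Sum>k<K j. of_real (w j k) * ?Y k p * cnj (?Y k q)) = (if fst p = fst q \<and> snd p = snd q then 1 else 0)"
      using p q window_multipole_bounds(2)[OF B window]
      by (intro cubature_exact[OF cub]) (auto simp: window_indices_def window_multipoles_def multipoles_def)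
    show "(z p * cnj (z q)) * (\<Sum>k<K j. of_real (w j k) * ?Y k p * cnj (?Y k q)) = (if p
        = q then of_real ((cmod (z p))\<^sup>2) else 0)"
    proof (cases "p = q")
      case True
      then show ?thesis unfolding orth complex_norm_square by simp
    next
      case False
      then have "\<not> (fst p = fst q \<and> snd p = snd q)" by (simp add: prod_eq_iff)
      then show ?thesis unfolding orth if_not_P[OF False] by (simp only: if_False mult_zero_right)
    qed
  qed
  also have "\<dots> = of_real (\<Sum>i\<in>?I. (cmod (z i))\<^sup>2)"
    using finite_window_indices[OF B window] by (simp add: sum.delta)
  finally show ?thesis by (simp only: of_real_eq_iff)
qed

lemma needlet_product_integrable:
  assumes f: "integrable S2 f"
  shows "integrable S2 (\<lambda>x. f x * cnj (spin_needlet s B b \<xi> w j k x))"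
proof -
  have int: "integrable S2 (\<lambda>x. f x * cnj (spin_harmonic s l m x))" for l m
  proof -
    obtain c where "\<And>x. cmod (spin_harmonic s l m x) \<le> c" using spin_harmonic_bounded by blast
    then show ?thesis by (intro integrable_S2_bounded[OF f, of _ c]) auto
  qed
  have "f x * cnj (spin_needlet s B b \<xi> w j k x) = (\<Sum>i\<in>window_indices s B b j. (of_real (sqrt (w j k))
      * spin_harmonic s (fst i) (snd i) (\<xi> j k)
        * of_real (window_weight s B b j (fst i))) * (f x * cnj (spin_harmonic s (fst i) (snd i) x)))" for x
    unfolding spin_needlet_finite cnj_sum sum_distrib_left by (intro sum.cong refl) (simp add: mult_ac)
  then show ?thesis
    by (simp only:) (intro Bochner_Integration.integrable_sum integrable_mult_right int)
qed

lemma field_coefficient_add: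
  assumes "integrable S2 (P \<omega>)" "integrable S2 (T \<omega>)"
  shows "field_coefficient (\<lambda>\<omega> x. P \<omega> x + T \<omega> x) (spin_needlet s B b \<xi> w) j k \<omega>
    = field_coefficient P (spin_needlet s B b \<xi> w) j k \<omega> + field_coefficient T (spin_needlet s B b \<xi> w) j k \<omega>"
  unfolding field_coefficient_def distrib_right
  by (intro Bochner_Integration.integral_add needlet_product_integrable assms)

lemma needlet_energy:
  assumes "integrable S2 (T \<omega>)"
  shows "(\<Sum>k<K j. (cmod (field_coefficient T (spin_needlet s B b \<xi> w) j k \<omega>))\<^sup>2)
    = (\<Sum>i\<in>window_indices s B b j. (window_weight s B b j (fst i))\<^sup>2 * (cmod (harmonic_coefficient s T i \<omega>))\<^sup>2)"
  unfolding field_coefficient_expand[of T, OF assms] needlet_parseval by (simp add: norm_mult power_mult_distrib)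

text \<open>The deviation combines the energies of the single channels with the energy of their sum.
  Coefficients are additive over channels, so Parseval's identity applies to both.\<close>

lemma sum_complex_deviation:
  assumes T: "\<And>r. r \<in> {1..D} \<Longrightarrow> integrable S2 (N r \<omega>)"
  shows "(\<Sum>k<K j. complex_deviation D (\<lambda>r. field_coefficient (N r) (spin_needlet s B b \<xi> w) j k \<omega>))
    = (\<Sum>i\<in>window_indices s B b j. (window_weight s B b j (fst i))\<^sup>2
        * complex_deviation D (\<lambda>r. harmonic_coefficient s (N r) i \<omega>))"
proof -
  let ?I = "window_indices s B b j" and ?W = "\<lambda>i. window_weight s B b j (fst i)" and ?n
      = "\<lambda>r i. harmonic_coefficient s (N r) i \<omega>"
  let ?y = "\<lambda>k i. of_real (sqrt (w j k)) * spin_harmonic s (fst i) (snd i) (\<xi> j k)"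
  let ?\<beta> = "\<lambda>r k. field_coefficient (N r) (spin_needlet s B b \<xi> w) j k \<omega>"
  have \<beta>: "?\<beta> r k = (\<Sum>i\<in>?I. ?y k i * (of_real (?W i) * ?n r i))" if "r \<in> {1..D}" for r k
    by (rule field_coefficient_expand[of "N r" \<omega>, OF T[OF that]])
  have 1: "(\<Sum>k<K j. (cmod (?\<beta> r k))\<^sup>2) = (\<Sum>i\<in>?I. (?W i)\<^sup>2 * (cmod (?n r i))\<^sup>2)" if "r \<in> {1..D}" for r
    by (rule needlet_energy[of "N r" \<omega>, OF T[OF that]])
  have sum\<beta>: "(\<Sum>r\<in>{1..D}. ?\<beta> r k) = (\<Sum>i\<in>?I. ?y k i * (of_real (?W i) * (\<Sum>r\<in>{1..D}. ?n r i)))" for k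
  proof -
    have "(\<Sum>r\<in>{1..D}. ?\<beta> r k) = (\<Sum>r\<in>{1..D}. \<Sum>i\<in>?I. ?y k i * (of_real (?W i) * ?n r i))"
      by (intro sum.cong refl \<beta>)
    also have "\<dots> = (\<Sum>i\<in>?I. \<Sum>r\<in>{1..D}. ?y k i * (of_real (?W i) * ?n r i))" by (rule sum.swap)
    finally show ?thesis by (simp add: sum_distrib_left)
  qed
  have 2: "(\<Sum>k<K j. (cmod (\<Sum>r\<in>{1..D}. ?\<beta> r k))\<^sup>2) = (\<Sum>i\<in>?I. (?W i)\<^sup>2 * (cmod (\<Sum>r\<in>{1..D}. ?n r i))\<^sup>2)"
    unfolding sum\<beta> needlet_parseval by (simp add: norm_mult power_mult_distrib)
  have "(\<Sum>k<K j. complex_deviation D (\<lambda>r. ?\<beta> r k)) = (\<Sum>r\<in>{1..D}. \<Sum>k<K j. (cmod (?\<beta> r k))\<^sup>2)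
      - (\<Sum>k<K j. (cmod (\<Sum>r\<in>{1..D}. ?\<beta> r k))\<^sup>2) / D"
    unfolding complex_deviation_def sum_subtractf sum_divide_distrib by (subst sum.swap) simp
  also have "(\<Sum>r\<in>{1..D}. \<Sum>k<K j. (cmod (?\<beta> r k))\<^sup>2) = (\<Sum>r\<in>{1..D}. \<Sum>i\<in>?I. (?W i)\<^sup>2 * (cmod (?n r i))\<^sup>2)"
    by (intro sum.cong refl 1)
  also have "\<dots> = (\<Sum>i\<in>?I. \<Sum>r\<in>{1..D}. (?W i)\<^sup>2 * (cmod (?n r i))\<^sup>2)" by (rule sum.swap)
  finally show ?thesis
    unfolding 2 complex_deviation_def
        by (simp add: sum_subtractf sum_divide_distrib sum_distrib_left right_diff_distrib)
qed

end

section \<open>Asymptotic normality\<close>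

context prob_space begin

section \<open>The difference of the estimators as a sum of independent variables\<close>

context
  fixes s :: int and D :: nat and B :: real and b :: "real \<Rightarrow> real"
    and K :: "nat \<Rightarrow> nat" and \<xi> :: "nat \<Rightarrow> nat \<Rightarrow> real ^ 3" and w :: "nat \<Rightarrow> nat \<Rightarrow> real"
    and C :: "nat \<Rightarrow> real" and CN :: "nat \<Rightarrow> nat \<Rightarrow> real"
    and P :: "'a \<Rightarrow> real ^ 3 \<Rightarrow> complex" and N :: "nat \<Rightarrow> 'a \<Rightarrow> real ^ 3 \<Rightarrow> complex"
  assumes D: "2 \<le> D" and B: "1 < B" and window: "needlet_window B b" and cub: "cubature_system s B K \<xi> w"
    and signal: "gaussian_isotropic_spin_field M s C P"
    and noise: "\<And>r. r \<in> {1..D} \<Longrightarrow> gaussian_isotropic_spin_field M s (CN r) (N r)"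
    and indep: "independent_signal_noise M D P N"
begin

text \<open>Half the power, because it belongs to the real and to the imaginary part
  separately.\<close>

definition noise_variance :: "nat \<times> int \<Rightarrow> nat \<Rightarrow> real" where
  "noise_variance i r = CN r (fst i) / 2"

definition channel_statistic :: "(nat \<times> int) \<times> bool \<Rightarrow> 'a \<Rightarrow> real" where
  "channel_statistic = (\<lambda>(i, c). centred_sample_variance D (\<lambda>r \<omega>. re_im c (harmonic_coefficient s (N r) i \<omega>))
      (noise_variance i))"

text \<open>The squared weight comes from Parseval's identity, the sign from the deviation entering
  cross minus auto negatively.\<close>

definition summand :: "nat \<Rightarrow> (nat \<times> int) \<times> bool \<Rightarrow> 'a \<Rightarrow> real" where
  "summand j p \<omega> = - (window_weight s B b j (fst (fst p)))\<^sup>2 * channel_statistic p \<omega>"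

definition summand_indices :: "nat \<Rightarrow> ((nat \<times> int) \<times> bool) set" where
  "summand_indices j = window_indices s B b j \<times> UNIV"

lemma finite_summand_indices: "finite (summand_indices j)"
  by (simp add: summand_indices_def finite_window_indices[OF B window])

lemma channels_indep:
  assumes i: "i \<in> multipole_indices s"
  shows "indep_vars (\<lambda>_. borel) (\<lambda>r \<omega>. re_im c (harmonic_coefficient s (N r) i \<omega>)) {1..D}"
proof -
  let ?X = "\<lambda>(i, r, c) \<omega>. re_im c (harmonic_coefficient s (N r) i \<omega>)"
  have "indep_vars (\<lambda>_. borel) ?X ({i} \<times> {1..D} \<times> UNIV)"
    by (rule noise_components_indep[OF B cub noise indep]) (use i in auto)
  \<comment> \<open>Grouping into singleton blocks serves to reindex the family from triples to
    channels.\<close>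
  then have "indep_vars (\<lambda>r. \<Pi>\<^sub>M k\<in>{(i, r, c)}. borel) (\<lambda>r \<omega>. \<lambda>k\<in>{(i, r, c)}. ?X k \<omega>) {1..D}"
    by (rule indep_vars_restrict) (auto simp: disjoint_family_on_def)
  then have "indep_vars (\<lambda>_. borel) (\<lambda>r \<omega>. (\<lambda>k\<in>{(i, r, c)}. ?X k \<omega>) (i, r, c)) {1..D}"
    by (rule indep_vars_compose2) (rule measurable_component_singleton, simp)
  then show ?thesis by simp
qed

lemma channel_moments:
  fixes c :: bool
  assumes i: "i \<in> multipole_indices s" and r: "r \<in> {1..D}"
  defines "X \<equiv> \<lambda>\<omega>. re_im c (harmonic_coefficient s (N r) i \<omega>)"
  shows "integrable M (\<lambda>\<omega>. X \<omega> ^ k)" "expectation X = 0" "expectation (\<lambda>\<omega>. (X \<omega>)\<^sup>2) = noise_variance i r"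
    "expectation (\<lambda>\<omega>. X \<omega> ^ 4) = 3 * (noise_variance i r)\<^sup>2" "expectation (\<lambda>\<omega>. X \<omega> ^ 8) = 105 * noise_variance i r ^ 4"
proof -
  note X = noise_component[OF B cub noise indep r i, of c, folded X_def]
  show "expectation X = 0" by (rule X(2))
  show v: "expectation (\<lambda>\<omega>. (X \<omega>)\<^sup>2) = noise_variance i r"
    using X(3) unfolding noise_variance_def X_def by simp
  note m = gaussian_rv_moments[OF X(1,2)]
  show "integrable M (\<lambda>\<omega>. X \<omega> ^ k)" by (rule m(1))
  show "expectation (\<lambda>\<omega>. X \<omega> ^ 4) = 3 * (noise_variance i r)\<^sup>2" using m(2) unfolding v .
  show "expectation (\<lambda>\<omega>. X \<omega> ^ 8) = 105 * noise_variance i r ^ 4" using m(3) unfolding v .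
qed

lemma channel_statistic_facts:
  assumes "i \<in> multipole_indices s"
  shows "channel_statistic (i, c) \<in> borel_measurable M"
    "expectation (channel_statistic (i, c)) = 0"
    "integrable M (\<lambda>\<omega>. channel_statistic (i, c) \<omega> ^ 4)"
    "expectation (\<lambda>\<omega>. channel_statistic (i, c) \<omega> ^ 4) \<le> 848 * D ^ 3 * (\<Sum>r\<in>{1..D}. noise_variance i r ^ 4)"
    "integrable M (\<lambda>\<omega>. (channel_statistic (i, c) \<omega>)\<^sup>2)"
    "expectation (\<lambda>\<omega>. (channel_statistic (i, c) \<omega>)\<^sup>2) \<le> 6 * D * (\<Sum>r\<in>{1..D}. (noise_variance i r)\<^sup>2)"
    "2 * (noise_variance i 1)\<^sup>2 / (real D)\<^sup>2 \<le> expectation (\<lambda>\<omega>. (channel_statistic (i, c) \<omega>)\<^sup>2)"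
proof -
  note fam = D channels_indep[OF assms] channel_moments[OF assms]
  note csv = measurable_csv[OF fam] csv_mean[OF fam] csv_fourth[OF fam] csv_square[OF fam] csv_square_lower[OF fam]
  show "channel_statistic (i, c) \<in> borel_measurable M"
    "expectation (channel_statistic (i, c)) = 0"
    "integrable M (\<lambda>\<omega>. channel_statistic (i, c) \<omega> ^ 4)"
    "expectation (\<lambda>\<omega>. channel_statistic (i, c) \<omega> ^ 4) \<le> 848 * D ^ 3 * (\<Sum>r\<in>{1..D}. noise_variance i r ^ 4)"
    "integrable M (\<lambda>\<omega>. (channel_statistic (i, c) \<omega>)\<^sup>2)"
    "expectation (\<lambda>\<omega>. (channel_statistic (i, c) \<omega>)\<^sup>2) \<le> 6 * D * (\<Sum>r\<in>{1..D}. (noise_variance i r)\<^sup>2)"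
    "2 * (noise_variance i 1)\<^sup>2 / (real D)\<^sup>2 \<le> expectation (\<lambda>\<omega>. (channel_statistic (i, c) \<omega>)\<^sup>2)"
    unfolding channel_statistic_def prod.case
    subgoal by (rule csv(1))
    subgoal by (rule csv(2))
    subgoal by (rule csv(3))
    subgoal by (rule csv(4))
    subgoal by (rule csv(5))
    subgoal by (rule csv(6))
    subgoal by (rule csv(7))
    done
qed

lemma summand_indices_multipole: "p \<in> summand_indices j \<Longrightarrow> fst p \<in> multipole_indices s"
  using window_indices_subset[OF B window, of s j] by (auto simp: summand_indices_def)

lemma summand_facts:
  assumes "p \<in> summand_indices j"
  shows "summand j p \<in> borel_measurable M" "expectation (summand j p) = 0"
    "integrable M (\<lambda>\<omega>. summand j p \<omega> ^ 4)" "integrable M (\<lambda>\<omega>. (summand j p \<omega>)\<^sup>2)"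
proof -
  note cs = channel_statistic_facts[OF summand_indices_multipole[OF assms], of "snd p"]
  note [measurable] = cs(1)[simplified]
  show "summand j p \<in> borel_measurable M" unfolding summand_def by measurable
  show "expectation (summand j p) = 0" using cs(2) by (simp add: summand_def[abs_def])
  show "integrable M (\<lambda>\<omega>. summand j p \<omega> ^ 4)" "integrable M (\<lambda>\<omega>. (summand j p \<omega>)\<^sup>2)"
    using cs(3,5) by (auto simp: summand_def power_mult_distrib)
qed

text \<open>Each summand is a function of the \<open>D\<close> variables that share its multipole
  and its choice of real or imaginary part; these blocks are disjoint.\<close>

lemma summands_indep: "indep_vars (\<lambda>_. borel) (summand j) (summand_indices j)"
proof -
  let ?X = "\<lambda>(i, r, c) \<omega>. re_im c (harmonic_coefficient s (N r) i \<omega>)"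
  let ?G = "\<lambda>p :: (nat \<times> int) \<times> bool. {fst p} \<times> {1..D} \<times> {snd p}"
  let ?f = "\<lambda>p z. - (window_weight s B b j (fst (fst p)))\<^sup>2 *
     (squared_deviation D (\<lambda>r. z (fst p, r, snd p)) / (real D - 1) - (\<Sum>r\<in>{1..D}. noise_variance (fst p) r) / real D)"
  have "indep_vars (\<lambda>_. borel) ?X (window_indices s B b j \<times> {1..D} \<times> UNIV)"
    by (rule noise_components_indep[OF B cub noise indep finite_window_indices[OF B window]
        window_indices_subset[OF B window]])
  then have "indep_vars (\<lambda>p. \<Pi>\<^sub>M k\<in>?G p. borel) (\<lambda>p \<omega>. \<lambda>k\<in>?G p. ?X k \<omega>) (summand_indices j)"
    by (rule indep_vars_restrict) (auto simp: disjoint_family_on_def summand_indices_def)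
  then have "indep_vars (\<lambda>_. borel) (\<lambda>p \<omega>. ?f p (\<lambda>k\<in>?G p. ?X k \<omega>)) (summand_indices j)"
  proof (rule indep_vars_compose2)
    fix p :: "(nat \<times> int) \<times> bool"
    have [measurable]: "(\<lambda>z. z (fst p, r, snd p)) \<in> borel_measurable (\<Pi>\<^sub>M k\<in>?G p. (borel :: real measure))"
        if "r \<in> {1..D}" for r
      using that by (intro measurable_component_singleton) auto
    show "?f p \<in> borel_measurable (\<Pi>\<^sub>M k\<in>?G p. borel)"
      unfolding squared_deviation_def by measurable
  qed
  then show ?thesis
  proof (rule indep_vars_cong[THEN iffD1, rotated -1])
    fix p :: "(nat \<times> int) \<times> bool"
    show "(\<lambda>\<omega>. ?f p (\<lambda>k\<in>?G p. ?X k \<omega>)) = summand j p"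
      by (rule ext, cases p) (auto simp: summand_def channel_statistic_def centred_sample_variance_def
          squared_deviation_def)
  qed auto
qed

abbreviation "needlets \<equiv> spin_needlet s B b \<xi> w"
abbreviation "difference j \<omega> \<equiv> Gamma_CP D K needlets P N j \<omega> - Gamma_AP M D K needlets P N j \<omega>"

lemma field_coefficient_measurable:
  assumes "(\<lambda>(\<omega>, x). T \<omega> x) \<in> borel_measurable (M \<Otimes>\<^sub>M S2)"
  shows "field_coefficient T needlets j k \<in> borel_measurable M"
proof -
  note [measurable] = assms spin_needlet_measurable[OF B window cub, of j k]
  show ?thesis unfolding field_coefficient_def[abs_def] by measurable
qed

text \<open>Summed over the nodes, the bias correction of the auto estimator is the mean noise
  energy, which Parseval's identity expresses through the spectrum.\<close>

lemma noise_energy: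
  assumes r: "r \<in> {1..D}"
  shows "(\<Sum>k<K j. expectation (\<lambda>\<omega>. (cmod (field_coefficient (N r) needlets j k \<omega>))\<^sup>2))
    = (\<Sum>i\<in>window_indices s B b j. (window_weight s B b j (fst i))\<^sup>2 * (2 * noise_variance i r))"
proof -
  note facts = isotropic_field_facts[OF noise[OF r]]
  note [measurable] = field_coefficient_measurable[OF facts(1)] facts(4)
  let ?W = "\<lambda>i. window_weight s B b j (fst i)"
  define E where "E \<omega> = (\<Sum>i\<in>window_indices s B b j. (?W i)\<^sup>2 * (cmod (harmonic_coefficient s (N r) i \<omega>))\<^sup>2)" for \<omega>
  have [measurable]: "E \<in> borel_measurable M" unfolding E_def by measurable
  have n: "integrable M (\<lambda>\<omega>. (cmod (harmonic_coefficient s (N r) i \<omega>))\<^sup>2)"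
    "expectation (\<lambda>\<omega>. (cmod (harmonic_coefficient s (N r) i \<omega>))\<^sup>2) = 2 * noise_variance i r"
        if "i \<in> window_indices s B b j" for i
  proof -
    have i: "i \<in> multipole_indices s" using that window_indices_subset[OF B window] by blast
    note m = channel_moments[OF i r]
    have "(cmod z)\<^sup>2 = (re_im True z)\<^sup>2 + (re_im False z)\<^sup>2" for z by (simp add: re_im_def cmod_power2)
    then show "integrable M (\<lambda>\<omega>. (cmod (harmonic_coefficient s (N r) i \<omega>))\<^sup>2)"
      "expectation (\<lambda>\<omega>. (cmod (harmonic_coefficient s (N r) i \<omega>))\<^sup>2) = 2 * noise_variance i r"
      using m(1)[of True 2] m(1)[of False 2] m(3)[of True] m(3)[of False] by simp_all
  qed
  have iE: "integrable M E" unfolding E_def by (intro Bochner_Integration.integrable_sum integrable_mult_right n)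
  have ae: "AE \<omega> in M. (\<Sum>k<K j. (cmod (field_coefficient (N r) needlets j k \<omega>))\<^sup>2) = E \<omega>"
    using facts(3) unfolding E_def by eventually_elim (rule needlet_energy[OF B window cub])
  \<comment> \<open>Each term is dominated by the total energy; integrability is what allows sum and
    expectation to be exchanged.\<close>
  have "integrable M (\<lambda>\<omega>. (cmod (field_coefficient (N r) needlets j k \<omega>))\<^sup>2)" if "k < K j" for k
  proof (rule Bochner_Integration.integrable_bound[OF iE])
    show "AE \<omega> in M. norm ((cmod (field_coefficient (N r) needlets j k \<omega>))\<^sup>2) \<le> norm (E \<omega>)"
      using ae
    proof eventually_elim
      case (elim \<omega>)
      have "(cmod (field_coefficient (N r) needlets j k \<omega>))\<^sup>2
          \<le> (\<Sum>k<K j. (cmod (field_coefficient (N r) needlets j k \<omega>))\<^sup>2)"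
        using that by (intro member_le_sum) auto
      then show ?case using elim by simp
    qed
  qed measurable
  then have "(\<Sum>k<K j. expectation (\<lambda>\<omega>. (cmod (field_coefficient (N r) needlets j k \<omega>))\<^sup>2))
     = expectation (\<lambda>\<omega>. \<Sum>k<K j. (cmod (field_coefficient (N r) needlets j k \<omega>))\<^sup>2)"
    by (intro Bochner_Integration.integral_sum[symmetric]) simp
  also have "\<dots> = expectation E" using ae by (intro integral_cong_AE) auto
  also have "\<dots> = (\<Sum>i\<in>window_indices s B b j. (?W i)\<^sup>2 * (2 * noise_variance i r))"
    unfolding E_def using n by (subst Bochner_Integration.integral_sum) (auto intro!: integrable_mult_right)
  finally show ?thesis .
qed

text \<open>Splitting the integral of signal plus noise requires integrable paths, which are
  available almost surely.\<close>

lemma difference_eq_sum: "AE \<omega> in M. difference j \<omega> = (\<Sum>p\<in>summand_indices j. summand j p \<omega>)"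
proof -
  have "AE \<omega> in M. \<forall>r\<in>{1..D}. integrable S2 (N r \<omega>)"
    by (rule AE_finite_allI) (use isotropic_field_facts(3)[OF noise] in auto)
  with isotropic_field_facts(3)[OF signal] show ?thesis
  proof eventually_elim
    case (elim \<omega>)
    let ?I = "window_indices s B b j" and ?W = "\<lambda>i. window_weight s B b j (fst i)"
    let ?p = "\<lambda>k. field_coefficient P needlets j k \<omega>" and ?\<nu> = "\<lambda>k r. field_coefficient (N r) needlets j k \<omega>"
    let ?z = "\<lambda>k r. field_coefficient (\<lambda>\<omega> x. P \<omega> x + N r \<omega> x) needlets j k \<omega>"
    let ?e = "\<lambda>k r. expectation (\<lambda>\<omega>. (cmod (field_coefficient (N r) needlets j k \<omega>))\<^sup>2)"
    have z: "?z k r = ?p k + ?\<nu> k r" if "r \<in> {1..D}" for k r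
      using elim that by (intro field_coefficient_add[OF B window cub]) auto
    have "complex_deviation D (?z k) = complex_deviation D (?\<nu> k)" for k
    proof -
      have "complex_deviation D (?z k) = complex_deviation D (\<lambda>r. ?p k + ?\<nu> k r)"
        unfolding complex_deviation_def
        by (intro arg_cong2[where f="\<lambda>x y. x - (cmod y)\<^sup>2 / real D"] sum.cong refl) (simp_all only: z)
      also have "\<dots> = complex_deviation D (?\<nu> k)" using D by (intro complex_deviation_shift) simp
      finally show ?thesis .
    qed
    then have dev: "(\<Sum>k<K j. complex_deviation D (?z k)) = (\<Sum>i\<in>?I. (?W i)\<^sup>2
        * complex_deviation D (\<lambda>r. harmonic_coefficient s (N r) i \<omega>))"
      using sum_complex_deviation[OF B window cub, of D N \<omega> j] elim by simp
    have en: "(\<Sum>k<K j. \<Sum>r\<in>{1..D}. ?e k r) = (\<Sum>i\<in>?I. (?W i)\<^sup>2 * (2 * (\<Sum>r\<in>{1..D}. noise_variance i r)))"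
    proof -
      have "(\<Sum>k<K j. \<Sum>r\<in>{1..D}. ?e k r) = (\<Sum>r\<in>{1..D}. \<Sum>k<K j. ?e k r)" by (rule sum.swap)
      also have "\<dots> = (\<Sum>r\<in>{1..D}. \<Sum>i\<in>?I. (?W i)\<^sup>2 * (2 * noise_variance i r))"
        by (intro sum.cong refl noise_energy)
      also have "\<dots> = (\<Sum>i\<in>?I. \<Sum>r\<in>{1..D}. (?W i)\<^sup>2 * (2 * noise_variance i r))" by (rule sum.swap)
      finally show ?thesis by (simp add: sum_distrib_left)
    qed
    have "Gamma_CP D K needlets P N j \<omega> = (\<Sum>k<K j. Re (\<Sum>r\<in>{1..D}. \<Sum>q\<in>{1..D} - {r}. ?z k r
        * cnj (?z k q)) / (real D * (real D - 1)))"
    proof -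
      have c: "1 / (of_nat D * (of_nat D - 1)) = complex_of_real (1 / (real D * (real D - 1)))" by simp
      have "Re (complex_of_real (1 / v) * (\<Sum>k<n. Q k)) = (\<Sum>k<n. Re (Q k) / v)" for v n and Q :: "nat \<Rightarrow> complex"
        by (simp add: sum_divide_distrib)
      then show ?thesis unfolding Gamma_CP_def Gamma_CP_complex_def c .
    qed
    moreover have "Gamma_AP M D K needlets P N j \<omega> = (\<Sum>k<K j. (\<Sum>r\<in>{1..D}. (cmod (?z k r))\<^sup>2) / real D)
        - (\<Sum>k<K j. \<Sum>r\<in>{1..D}. ?e k r) / real D"
      unfolding Gamma_AP_def by (simp add: sum_subtractf sum_divide_distrib diff_divide_distrib)
    ultimately have "difference j \<omega> = (\<Sum>k<K j. - complex_deviation D (?z k) / (real D - 1))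
        + (\<Sum>k<K j. \<Sum>r\<in>{1..D}. ?e k r) / real D"
      unfolding cross_minus_auto[OF D, symmetric] by (simp add: sum_subtractf)
    also have "\<dots> = - (\<Sum>k<K j. complex_deviation D (?z k)) / (real D - 1) + (\<Sum>k<K j. \<Sum>r\<in>{1..D}. ?e k r) / real D"
      by (simp add: sum_negf sum_divide_distrib)
    also have "\<dots> = (\<Sum>i\<in>?I. - (?W i)\<^sup>2 * (complex_deviation D (\<lambda>r. harmonic_coefficient s (N r) i \<omega>) / (real D - 1)
          - 2 * (\<Sum>r\<in>{1..D}. noise_variance i r) / real D))"
      unfolding dev en by (simp add: right_diff_distrib sum_subtractf sum_negf sum_divide_distrib)
    \<comment> \<open>The real and the imaginary part each take one of the two copies of the summed
      noise variances.\<close>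
    also have "\<dots> = (\<Sum>i\<in>?I. \<Sum>c\<in>UNIV. summand j (i, c) \<omega>)"
      unfolding complex_deviation_re_im summand_def channel_statistic_def centred_sample_variance_def UNIV_bool
      by (intro sum.cong refl) (simp add: add_divide_distrib algebra_simps)
    also have "\<dots> = (\<Sum>p\<in>summand_indices j. summand j p \<omega>)"
      unfolding summand_indices_def by (simp add: sum.cartesian_product)
    finally show ?case .
  qed
qed

lemma estimators_measurable:
  "Gamma_CP D K needlets P N j \<in> borel_measurable M" "Gamma_AP M D K needlets P N j \<in> borel_measurable M"
proof -
  have z: "field_coefficient (\<lambda>\<omega> x. P \<omega> x + N r \<omega> x) needlets j k \<in> borel_measurable M" if "r \<in> {1..D}" for r k
  proof (rule field_coefficient_measurable)
    note [measurable] = isotropic_field_facts(1)[OF signal] isotropic_field_facts(1)[OF noise[OF that]]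
    show "(\<lambda>(\<omega>, x). P \<omega> x + N r \<omega> x) \<in> borel_measurable (M \<Otimes>\<^sub>M S2)" by measurable
  qed
  show "Gamma_CP D K needlets P N j \<in> borel_measurable M"
    unfolding Gamma_CP_def Gamma_CP_complex_def
    by (intro borel_measurable_Re[THEN measurable_compose[rotated]] borel_measurable_times
        borel_measurable_const borel_measurable_sum borel_measurable_cnj z) auto
  show "Gamma_AP M D K needlets P N j \<in> borel_measurable M"
    unfolding Gamma_AP_def
    by (intro borel_measurable_times borel_measurable_const borel_measurable_sum borel_measurable_diff
        borel_measurable_power measurable_compose[OF z borel_measurable_norm]) auto
qed

lemma difference_variance:
  "variance (\<lambda>\<omega>. difference j \<omega>) = (\<Sum>p\<in>summand_indices j. expectation (\<lambda>\<omega>. (summand j p \<omega>)\<^sup>2))"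
proof -
  note facts = summand_facts[of _ j]
  note [measurable] = estimators_measurable facts(1)
  have int: "integrable M (summand j p)" if "p \<in> summand_indices j" for p
    using square_integrable_imp_integrable[OF facts(1)[OF that] facts(4)[OF that]] .
  have "expectation (\<lambda>\<omega>. difference j \<omega>) = expectation (\<lambda>\<omega>. \<Sum>p\<in>summand_indices j. summand j p \<omega>)"
    by (rule integral_cong_AE[OF _ _ difference_eq_sum]) measurable
  also have "\<dots> = 0" using int facts(2) by (subst Bochner_Integration.integral_sum) auto
  finally have "variance (\<lambda>\<omega>. difference j \<omega>) = expectation (\<lambda>\<omega>. (difference j \<omega>)\<^sup>2)" by simp
  also have "\<dots> = expectation (\<lambda>\<omega>. (\<Sum>p\<in>summand_indices j. summand j p \<omega>)\<^sup>2)"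
  proof (rule integral_cong_AE)
    show "AE \<omega> in M. (difference j \<omega>)\<^sup>2 = (\<Sum>p\<in>summand_indices j. summand j p \<omega>)\<^sup>2"
      using difference_eq_sum[of j] by eventually_elim simp
  qed measurable
  also have "\<dots> = (\<Sum>p\<in>summand_indices j. expectation (\<lambda>\<omega>. (summand j p \<omega>)\<^sup>2))"
    by (rule indep_sum_second_moment(2)[OF finite_summand_indices summands_indep facts(4,2)])
  finally show ?thesis .
qed


section \<open>Asymptotics of the second and fourth moments\<close>

context
  fixes \<gamma> :: real
  assumes spectra: "\<And>r. r \<in> {1..D} \<Longrightarrow> regular_spectrum s \<gamma> (CN r)" and gamma: "2 < \<gamma>"
begin

lemma spectrum_bounds:
  obtains c where "0 < c" "\<And>r l. r \<in> {1..D} \<Longrightarrow> l \<in> multipoles s \<Longrightarrow> real l powr (- \<gamma>) / c \<le> CN r l \<and> CN r l \<le> c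
      * real l powr (- \<gamma>)"
proof -
  have "\<exists>c>0. \<forall>l\<in>multipoles s. real l powr (- \<gamma>) / c \<le> CN r l \<and> CN r l \<le> c * real l powr (- \<gamma>)" if "r \<in> {1..D}" for r
  proof -
    from spectra[OF that] obtain g c where C: "\<forall>l\<in>multipoles s. CN r l = real l powr (- \<gamma>) * g (real l) \<and> 0 < CN r l"
      and c: "0 < c" "\<forall>l\<in>multipoles s. 1 / c \<le> g (real l) \<and> g (real l) \<le> c"
      unfolding regular_spectrum_def by blast
    have "real l powr (- \<gamma>) / c \<le> CN r l \<and> CN r l \<le> c * real l powr (- \<gamma>)" if l: "l \<in> multipoles s" for l
    proof -
      have "real l powr (- \<gamma>) * (1 / c) \<le> real l powr (- \<gamma>) * g (real l)" "real l powr (- \<gamma>) * g (real l)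
          \<le> real l powr (- \<gamma>) * c"
      proof -
        have g: "1 / c \<le> g (real l)" "g (real l) \<le> c" using c(2) l by blast+
        show "real l powr (- \<gamma>) * (1 / c) \<le> real l powr (- \<gamma>) * g (real l)" by (rule mult_left_mono[OF g(1)]) simp
        show "real l powr (- \<gamma>) * g (real l) \<le> real l powr (- \<gamma>) * c" by (rule mult_left_mono[OF g(2)]) simp
      qed
      then show ?thesis using C l by (simp add: mult.commute)
    qed
    then show ?thesis using c(1) by blast
  qed
  then have "\<forall>r\<in>{1..D}. \<exists>c>0. \<forall>l\<in>multipoles s. real l powr (- \<gamma>) / c \<le> CN r l \<and> CN r l \<le> c * real l powr (- \<gamma>)" ..
  from bchoice[OF this] obtain c where
    c: "\<forall>r\<in>{1..D}. 0 < c r \<and> (\<forall>l\<in>multipoles s. real l powr (- \<gamma>) / c r \<le> CN r l \<and> CN r l \<le> c r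
        * real l powr (- \<gamma>))" by blast
  \<comment> \<open>The sum dominates each channel constant and so serves all channels at
    once.\<close>
  define c0 where "c0 = (\<Sum>r\<in>{1..D}. c r)"
  have le: "c r \<le> c0" if "r \<in> {1..D}" for r
    unfolding c0_def using that c by (intro member_le_sum) (auto intro: less_imp_le)
  have "0 < c 1" using c D by simp
  also have "c 1 \<le> c0" using le D by simp
  finally have c0: "0 < c0" .
  show thesis
  proof (rule that[OF c0])
    fix r l assume r: "r \<in> {1..D}" and l: "l \<in> multipoles s"
    have "real l powr (- \<gamma>) / c0 \<le> real l powr (- \<gamma>) / c r"
      using c r le[OF r] by (intro divide_left_mono) (auto intro!: mult_pos_pos c0)
    moreover have "c r * real l powr (- \<gamma>) \<le> c0 * real l powr (- \<gamma>)"
      using le[OF r] by (intro mult_right_mono) auto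
    ultimately show "real l powr (- \<gamma>) / c0 \<le> CN r l \<and> CN r l \<le> c0 * real l powr (- \<gamma>)"
      using c r l by (meson order_trans)
  qed
qed

lemma noise_variance_bounds:
  obtains lo hi where "0 < lo" "0 < hi"
    "eventually (\<lambda>j. \<forall>i\<in>window_indices s B b j. \<forall>r\<in>{1..D}. lo * (B ^ j) powr (- \<gamma>) \<le> noise_variance i r
        \<and> noise_variance i r \<le> hi * (B ^ j) powr (- \<gamma>)) sequentially"
proof -
  obtain c where c: "0 < c" and C: "\<And>r l. r \<in> {1..D} \<Longrightarrow> l \<in> multipoles s \<Longrightarrow> real l powr (- \<gamma>) / c \<le> CN r l
      \<and> CN r l \<le> c * real l powr (- \<gamma>)"
    using spectrum_bounds by blast
  \<comment> \<open>Powers with exponent \<open>- \<gamma>\<close> decrease, so the largest degree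
    gives the lower constant and the smallest the upper one; the final 1/2 is the share of one real
    component.\<close>
  define lo where "lo = (2 * B) powr (- \<gamma>) / c / 2"
  define hi where "hi = c * (1 / (2 * B)) powr (- \<gamma>) / 2"
  have "eventually (\<lambda>j. \<forall>i\<in>window_indices s B b j. \<forall>r\<in>{1..D}. lo * (B ^ j) powr (- \<gamma>) \<le> noise_variance i r
      \<and> noise_variance i r \<le> hi * (B ^ j) powr (- \<gamma>)) sequentially"
    using window_multipole_range[OF B window, of s]
  proof eventually_elim
    case (elim j)
    show ?case
    proof (intro ballI)
      fix i r assume i: "i \<in> window_indices s B b j" and r: "r \<in> {1..D}"
      let ?l = "fst i"
      have l: "?l \<in> window_multipoles s B b j" "?l \<in> multipoles s"
        using i by (auto simp: window_indices_def window_multipoles_def)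
      have Bj: "0 < B ^ j" using B by simp
      have b1: "1 / (2 * B) * B ^ j \<le> real ?l" and b2: "real ?l \<le> 2 * B * B ^ j" using elim l by auto
      have p: "0 < 1 / (2 * B) * B ^ j" using B Bj by simp
      have "real ?l powr (- \<gamma>) \<le> (1 / (2 * B) * B ^ j) powr (- \<gamma>)"
        using b1 p gamma by (intro powr_mono2') auto
      then have 1: "real ?l powr (- \<gamma>) \<le> (1 / (2 * B)) powr (- \<gamma>) * (B ^ j) powr (- \<gamma>)"
        using B Bj by (subst (asm) powr_mult) auto
      have "(2 * B * B ^ j) powr (- \<gamma>) \<le> real ?l powr (- \<gamma>)"
        using b2 b1 p gamma by (intro powr_mono2') auto
      then have 2: "(2 * B) powr (- \<gamma>) * (B ^ j) powr (- \<gamma>) \<le> real ?l powr (- \<gamma>)"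
        using B Bj by (subst (asm) powr_mult) auto
      have "(2 * B) powr (- \<gamma>) * (B ^ j) powr (- \<gamma>) / c \<le> CN r ?l"
        using C[OF r l(2)] divide_right_mono[OF 2, of c] c by linarith
      moreover have "CN r ?l \<le> c * ((1 / (2 * B)) powr (- \<gamma>) * (B ^ j) powr (- \<gamma>))"
        using C[OF r l(2)] mult_left_mono[OF 1, of c] c by linarith
      ultimately show "lo * (B ^ j) powr (- \<gamma>) \<le> noise_variance i r \<and> noise_variance i r \<le> hi * (B ^ j) powr (- \<gamma>)"
        unfolding noise_variance_def lo_def hi_def by (simp add: mult_ac)
    qed
  qed
  then show thesis by (rule that[rotated -1]) (use c B in \<open>auto simp: lo_def hi_def\<close>)
qed

abbreviation "total_variance j \<equiv> \<Sum>p\<in>summand_indices j. expectation (\<lambda>\<omega>. (summand j p \<omega>)\<^sup>2)"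
abbreviation "total_fourth j \<equiv> \<Sum>p\<in>summand_indices j. expectation (\<lambda>\<omega>. summand j p \<omega> ^ 4)"

lemma weight_bounds: "0 \<le> window_weight s B b j l" "window_weight s B b j l \<le> 1"
  using window_nonneg[OF B window] window_le_1[OF B window] by (simp_all add: window_weight_def)

text \<open>Counting times size. With \<open>R = (B ^ j) powr (- \<gamma>)\<close>, every summand
  has second moment at most of order \<open>R^2\<close> and fourth moment at most of order
  \<open>R^4\<close>, and there are at most of order \<open>B^(2j)\<close> of them. For the lower
  bound only the indices with weight at least \<open>\<epsilon>\<close> are kept; these are of the
  same order in number.\<close>

lemma moment_asymptotics:
  obtains U L F where "0 < L"
    "eventually (\<lambda>j. total_variance j \<le> U * (B ^ (2 * j) * ((B ^ j) powr (- \<gamma>))\<^sup>2)) sequentially"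
    "eventually (\<lambda>j. L * (B ^ (2 * j) * ((B ^ j) powr (- \<gamma>))\<^sup>2) \<le> total_variance j) sequentially"
    "eventually (\<lambda>j. total_fourth j \<le> F * (B ^ (2 * j) * ((B ^ j) powr (- \<gamma>)) ^ 4)) sequentially"
proof -
  obtain lo hi where lohi: "0 < lo" "0 < hi" and nv:
    "eventually (\<lambda>j. \<forall>i\<in>window_indices s B b j. \<forall>r\<in>{1..D}. lo * (B ^ j) powr (- \<gamma>) \<le> noise_variance i r
        \<and> noise_variance i r \<le> hi * (B ^ j) powr (- \<gamma>)) sequentially"
    using noise_variance_bounds by blast
  obtain \<epsilon> c where \<epsilon>: "0 < \<epsilon>" and c: "0 < c" and many:
    "eventually (\<lambda>j. c * B ^ (2 * j) \<le> real (card {i \<in> window_indices s B b j. \<epsilon>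
        \<le> window_weight s B b j (fst i)})) sequentially"
    using many_window_indices[OF B window] by blast
  define \<kappa> where "\<kappa> = (2 * B + 1) * (4 * B + 1)"
  note card = card_window_indices[OF B window, of s, folded \<kappa>_def]
  let ?R = "\<lambda>j. (B ^ j) powr (- \<gamma>)"
  let ?W = "\<lambda>j p. window_weight s B b j (fst (fst p))"
  have D0: "0 < real D" using D by simp
  \<comment> \<open>A summand contains the squared weight, whence the powers 4 here and 8
    below.\<close>
  have sq: "expectation (\<lambda>\<omega>. (summand j p \<omega>)\<^sup>2) = ?W j p ^ 4 * expectation (\<lambda>\<omega>. (channel_statistic p \<omega>)\<^sup>2)" for j p
    by (simp add: summand_def power_mult_distrib flip: power_mult)
  have fo: "expectation (\<lambda>\<omega>. summand j p \<omega> ^ 4) = ?W j p ^ 8 * expectation (\<lambda>\<omega>. channel_statistic p \<omega> ^ 4)" for j p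
    by (simp add: summand_def power_mult_distrib flip: power_mult)
  have cardS: "real (card (summand_indices j)) = 2 * real (card (window_indices s B b j))" for j
    by (simp add: summand_indices_def card_cartesian_product card_UNIV_bool)
  have W1: "?W j p ^ n \<le> 1" "0 \<le> ?W j p ^ n" for j p n
    using weight_bounds by (simp_all add: power_le_one)
  define U where "U = 2 * \<kappa> * (6 * D * (D * hi\<^sup>2))"
  define F where "F = 2 * \<kappa> * (848 * D ^ 3 * (D * hi ^ 4))"
  define L where "L = 2 * c * (\<epsilon> ^ 4 * (2 * lo\<^sup>2 / (real D)\<^sup>2))"
  have U: "eventually (\<lambda>j. total_variance j \<le> U * (B ^ (2 * j) * (?R j)\<^sup>2)) sequentially"
    using nv card
  proof eventually_elim
    case (elim j)
    have "expectation (\<lambda>\<omega>. (summand j p \<omega>)\<^sup>2) \<le> 6 * D * (D * (hi * ?R j)\<^sup>2)" if p: "p \<in> summand_indices j" for p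
    proof -
      have i: "fst p \<in> window_indices s B b j" using p by (auto simp: summand_indices_def)
      \<comment> \<open>With the lower bound this makes the noise variances nonnegative, as
        monotonicity of powers requires.\<close>
      have lo0: "0 \<le> lo * ?R j" using lohi by simp
      have "(\<Sum>r\<in>{1..D}. (noise_variance (fst p) r)\<^sup>2) \<le> (\<Sum>r\<in>{1..D}. (hi * ?R j)\<^sup>2)"
        using elim(1) i lo0 by (intro sum_mono power_mono) (auto intro: order_trans)
      then have s2: "(\<Sum>r\<in>{1..D}. (noise_variance (fst p) r)\<^sup>2) \<le> D * (hi * ?R j)\<^sup>2" by simp
      have "expectation (\<lambda>\<omega>. (channel_statistic p \<omega>)\<^sup>2) \<le> 6 * D * (\<Sum>r\<in>{1..D}. (noise_variance (fst p) r)\<^sup>2)"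
        using channel_statistic_facts(6)[OF summand_indices_multipole[OF p], of "snd p"] by simp
      also have "\<dots> \<le> 6 * D * (D * (hi * ?R j)\<^sup>2)" by (rule mult_left_mono[OF s2]) simp
      finally have "expectation (\<lambda>\<omega>. (channel_statistic p \<omega>)\<^sup>2) \<le> 6 * D * (D * (hi * ?R j)\<^sup>2)" .
      moreover have "?W j p ^ 4 * expectation (\<lambda>\<omega>. (channel_statistic p \<omega>)\<^sup>2) \<le> 1
          * expectation (\<lambda>\<omega>. (channel_statistic p \<omega>)\<^sup>2)"
        using W1 by (intro mult_right_mono) auto
      ultimately show ?thesis unfolding sq by linarith
    qed
    then have "total_variance j \<le> real (card (summand_indices j)) * (6 * D * (D * (hi * ?R j)\<^sup>2))"
      by (intro sum_bounded_above) simp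
    also have "\<dots> \<le> (2 * (\<kappa> * B ^ (2 * j))) * (6 * D * (D * (hi * ?R j)\<^sup>2))"
      unfolding cardS using elim(2) by (intro mult_right_mono mult_left_mono) auto
    also have "\<dots> = U * (B ^ (2 * j) * (?R j)\<^sup>2)" by (simp add: U_def power_mult_distrib mult_ac)
    finally show ?case .
  qed
  have F: "eventually (\<lambda>j. total_fourth j \<le> F * (B ^ (2 * j) * ?R j ^ 4)) sequentially"
    using nv card
  proof eventually_elim
    case (elim j)
    have "expectation (\<lambda>\<omega>. summand j p \<omega> ^ 4) \<le> 848 * D ^ 3 * (D * (hi * ?R j) ^ 4)" if p: "p \<in> summand_indices j" for p
    proof -
      have i: "fst p \<in> window_indices s B b j" using p by (auto simp: summand_indices_def)
      have lo0: "0 \<le> lo * ?R j" using lohi by simp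
      have "(\<Sum>r\<in>{1..D}. noise_variance (fst p) r ^ 4) \<le> (\<Sum>r\<in>{1..D}. (hi * ?R j) ^ 4)"
        using elim(1) i lo0 by (intro sum_mono power_mono) (auto intro: order_trans)
      then have s4: "(\<Sum>r\<in>{1..D}. noise_variance (fst p) r ^ 4) \<le> D * (hi * ?R j) ^ 4" by simp
      have "expectation (\<lambda>\<omega>. channel_statistic p \<omega> ^ 4) \<le> 848 * D ^ 3 * (\<Sum>r\<in>{1..D}. noise_variance (fst p) r ^ 4)"
        using channel_statistic_facts(4)[OF summand_indices_multipole[OF p], of "snd p"] by simp
      also have "\<dots> \<le> 848 * D ^ 3 * (D * (hi * ?R j) ^ 4)" by (rule mult_left_mono[OF s4]) simp
      finally have "expectation (\<lambda>\<omega>. channel_statistic p \<omega> ^ 4) \<le> 848 * D ^ 3 * (D * (hi * ?R j) ^ 4)" .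
      moreover have "?W j p ^ 8 * expectation (\<lambda>\<omega>. channel_statistic p \<omega> ^ 4) \<le> 1
          * expectation (\<lambda>\<omega>. channel_statistic p \<omega> ^ 4)"
        using W1 by (intro mult_right_mono Bochner_Integration.integral_nonneg) auto
      ultimately show ?thesis unfolding fo by linarith
    qed
    then have "total_fourth j \<le> real (card (summand_indices j)) * (848 * D ^ 3 * (D * (hi * ?R j) ^ 4))"
      by (intro sum_bounded_above) simp
    also have "\<dots> \<le> (2 * (\<kappa> * B ^ (2 * j))) * (848 * D ^ 3 * (D * (hi * ?R j) ^ 4))"
      unfolding cardS using elim(2) by (intro mult_right_mono mult_left_mono) auto
    also have "\<dots> = F * (B ^ (2 * j) * ?R j ^ 4)" by (simp add: F_def power_mult_distrib mult_ac)
    finally show ?case .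
  qed
  have L: "eventually (\<lambda>j. L * (B ^ (2 * j) * (?R j)\<^sup>2) \<le> total_variance j) sequentially"
    using nv many
  proof eventually_elim
    case (elim j)
    define G where "G = {i \<in> window_indices s B b j. \<epsilon> \<le> window_weight s B b j (fst i)}"
    let ?m = "\<epsilon> ^ 4 * (2 * (lo * ?R j)\<^sup>2 / (real D)\<^sup>2)"
    have sub: "G \<times> UNIV \<subseteq> summand_indices j" by (auto simp: G_def summand_indices_def)
    have "?m \<le> expectation (\<lambda>\<omega>. (summand j p \<omega>)\<^sup>2)" if p: "p \<in> G \<times> UNIV" for p
    proof -
      have ps: "p \<in> summand_indices j" using p sub by blast
      have i: "fst p \<in> window_indices s B b j" "\<epsilon> \<le> ?W j p" using p by (auto simp: G_def)
      have "(lo * ?R j)\<^sup>2 \<le> (noise_variance (fst p) 1)\<^sup>2"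
        using elim(1) i D lohi by (intro power_mono) auto
      then have "2 * (lo * ?R j)\<^sup>2 / (real D)\<^sup>2 \<le> 2 * (noise_variance (fst p) 1)\<^sup>2 / (real D)\<^sup>2"
        by (intro divide_right_mono) auto
      also have "\<dots> \<le> expectation (\<lambda>\<omega>. (channel_statistic p \<omega>)\<^sup>2)"
        using channel_statistic_facts(7)[OF summand_indices_multipole[OF ps], of "snd p"] by simp
      finally have "2 * (lo * ?R j)\<^sup>2 / (real D)\<^sup>2 \<le> expectation (\<lambda>\<omega>. (channel_statistic p \<omega>)\<^sup>2)" .
      moreover have "\<epsilon> ^ 4 \<le> ?W j p ^ 4" using i(2) \<epsilon> by (intro power_mono) auto
      ultimately show ?thesis unfolding sq using W1 by (intro mult_mono) auto
    qed
    then have "real (card (G \<times> (UNIV :: bool set))) * ?m \<le> (\<Sum>p\<in>G \<times> UNIV. expectation (\<lambda>\<omega>. (summand j p \<omega>)\<^sup>2))"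
      by (intro sum_bounded_below) simp
    also have "\<dots> \<le> total_variance j"
      by (rule sum_mono2[OF finite_summand_indices sub]) simp
    finally have "real (card (G \<times> (UNIV :: bool set))) * ?m \<le> total_variance j" .
    moreover have "(2 * (c * B ^ (2 * j))) * ?m \<le> real (card (G \<times> (UNIV :: bool set))) * ?m"
      using elim(2) \<epsilon> by (intro mult_right_mono) (auto simp: card_cartesian_product card_UNIV_bool G_def)
    moreover have "L * (B ^ (2 * j) * (?R j)\<^sup>2) = (2 * (c * B ^ (2 * j))) * ?m"
      by (simp add: L_def power_mult_distrib mult_ac)
    ultimately show ?case by linarith
  qed
  show thesis
    by (rule that[OF _ U L F]) (use c \<epsilon> lohi D0 in \<open>simp add: L_def\<close>)
qed

text \<open>The total of the fourth moments over the squared variance is of order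
  \<open>B^(-2j)\<close>, the inverse number of summands: the powers of
  \<open>(B ^ j) powr (- \<gamma>)\<close> cancel. The lower bound on the variance is needed exactly
  here.\<close>

theorem difference_clt:
  "weak_conv_m (\<lambda>j. distr M borel (\<lambda>\<omega>. difference j \<omega> / sqrt (variance (\<lambda>\<omega>. difference j \<omega>)))) std_normal_distribution"
  "(\<lambda>j. variance (\<lambda>\<omega>. difference j \<omega>)) \<in> O(\<lambda>j. B powr (2 * (1 - \<gamma>) * real j))"
proof -
  obtain U L F where L: "0 < L"
    and U: "eventually (\<lambda>j. total_variance j \<le> U * (B ^ (2 * j) * ((B ^ j) powr (- \<gamma>))\<^sup>2)) sequentially"
    and low: "eventually (\<lambda>j. L * (B ^ (2 * j) * ((B ^ j) powr (- \<gamma>))\<^sup>2) \<le> total_variance j) sequentially"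
    and F: "eventually (\<lambda>j. total_fourth j \<le> F * (B ^ (2 * j) * ((B ^ j) powr (- \<gamma>)) ^ 4)) sequentially"
    using moment_asymptotics by blast
  let ?R = "\<lambda>j. (B ^ j) powr (- \<gamma>)"
  have B0: "0 < B ^ j" for j using B by simp
  have R0: "0 < ?R j" for j using B by simp
  have pos: "eventually (\<lambda>j. 0 < total_variance j) sequentially"
    using low
  proof eventually_elim
    case (elim j)
    have "0 < L * (B ^ (2 * j) * (?R j)\<^sup>2)" using L B0[of "2 * j"] R0[of j] by simp
    then show ?case using elim by linarith
  qed
  have lyap: "(\<lambda>j. total_fourth j / (total_variance j)\<^sup>2) \<longlonglongrightarrow> 0"
  proof (rule Lim_null_comparison)
    show "eventually (\<lambda>j. norm (total_fourth j / (total_variance j)\<^sup>2) \<le> F / L\<^sup>2 * (1 / B) ^ (2 * j)) sequentially"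
      using F low
    proof eventually_elim
      case (elim j)
      let ?X = "B ^ (2 * j)"
      have X0: "0 < ?X" by (rule B0)
      have f0: "0 \<le> total_fourth j" by (intro sum_nonneg Bochner_Integration.integral_nonneg) simp
      have l0: "0 < L * (?X * (?R j)\<^sup>2)" using L X0 R0[of j] by simp
      have "(L * (?X * (?R j)\<^sup>2))\<^sup>2 \<le> (total_variance j)\<^sup>2" using l0 elim(2) by (intro power_mono) auto
      then have "total_fourth j / (total_variance j)\<^sup>2 \<le> F * (?X * ?R j ^ 4) / (L * (?X * (?R j)\<^sup>2))\<^sup>2"
        by (rule frac_le[OF order_trans[OF f0 elim(1)] elim(1) zero_less_power[OF l0]])
      also have "(L * (?X * (?R j)\<^sup>2))\<^sup>2 = L\<^sup>2 * (?X\<^sup>2 * ?R j ^ 4)" by (simp add: power_mult_distrib)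
      also have "F * (?X * ?R j ^ 4) / (L\<^sup>2 * (?X\<^sup>2 * ?R j ^ 4)) = F / L\<^sup>2 * (1 / ?X)"
        using R0[of j] X0 B by (simp add: power2_eq_square)
      also have "1 / ?X = (1 / B) ^ (2 * j)" by (simp add: power_one_over)
      finally show ?case using f0 by simp
    qed
    have "(\<lambda>j. ((1 / B)\<^sup>2) ^ j) \<longlonglongrightarrow> 0"
      using B by (intro LIMSEQ_realpow_zero) (auto simp: power_less_one_iff power_one_over)
    then show "(\<lambda>j. F / L\<^sup>2 * (1 / B) ^ (2 * j)) \<longlonglongrightarrow> 0"
      unfolding power_mult by (rule tendsto_mult_right_zero)
  qed
  have clt: "weak_conv_m (\<lambda>j. distr M borel (\<lambda>\<omega>. (\<Sum>p\<in>summand_indices j. summand j p \<omega>) / sqrt (total_variance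
      j))) std_normal_distribution"
    by (rule lyapunov_central_limit[OF finite_summand_indices summands_indep summand_facts(3,2) pos lyap])
  \<comment> \<open>Almost sure equality preserves the law, so the limit for the sum is the limit
    for the estimators.\<close>
  have "distr M borel (\<lambda>\<omega>. difference j \<omega> / sqrt (variance (\<lambda>\<omega>. difference j \<omega>)))
      = distr M borel (\<lambda>\<omega>. (\<Sum>p\<in>summand_indices j. summand j p \<omega>) / sqrt (total_variance j))" for j
  proof -
    note [measurable] = estimators_measurable summand_facts(1)
    show ?thesis
      unfolding difference_variance
      by (rule distr_cong_AE) (use difference_eq_sum[of j] in \<open>auto elim!: eventually_mono\<close>)
  qed
  then show "weak_conv_m (\<lambda>j. distr M borel (\<lambda>\<omega>. difference j \<omega> / sqrt (variance (\<lambda>\<omega>. difference j \<omega>))))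
      std_normal_distribution"
    using clt by simp
  show "(\<lambda>j. variance (\<lambda>\<omega>. difference j \<omega>)) \<in> O(\<lambda>j. B powr (2 * (1 - \<gamma>) * real j))"
  proof (rule bigoI)
    show "eventually (\<lambda>j. norm (variance (\<lambda>\<omega>. difference j \<omega>)) \<le> U * norm (B powr (2 * (1 - \<gamma>) * real j))) sequentially"
      using U
    proof eventually_elim
      case (elim j)
      have "B ^ (2 * j) * (?R j)\<^sup>2 = B powr (2 * real j) * (B powr (- \<gamma> * real j))\<^sup>2"
        using B by (simp add: powr_powr mult.commute flip: powr_realpow)
      also have "\<dots> = B powr (2 * real j + (- \<gamma> * real j) + (- \<gamma> * real j))"
        by (simp only: powr_add power2_eq_square mult.assoc)
      also have "2 * real j + (- \<gamma> * real j) + (- \<gamma> * real j) = 2 * (1 - \<gamma>) * real j" by (simp add: algebra_simps)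
      finally have e: "B ^ (2 * j) * (?R j)\<^sup>2 = B powr (2 * (1 - \<gamma>) * real j)" .
      have "0 \<le> total_variance j" by (intro sum_nonneg) simp
      then show ?case using elim unfolding difference_variance e by simp
    qed
  qed
qed

end
end
end

theorem proposition15:
  fixes M :: "'w measure"
    and s :: int and D :: nat
    and B \<alpha> \<gamma> :: real and b :: "real \<Rightarrow> real"
    and K :: "nat \<Rightarrow> nat" and \<xi> :: "nat \<Rightarrow> nat \<Rightarrow> real ^ 3" and w :: "nat \<Rightarrow> nat \<Rightarrow> real"
    and C :: "nat \<Rightarrow> real" and CN :: "nat \<Rightarrow> nat \<Rightarrow> real"
    and P :: "'w \<Rightarrow> real ^ 3 \<Rightarrow> complex" and N :: "nat \<Rightarrow> 'w \<Rightarrow> real ^ 3 \<Rightarrow> complex"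
    and \<psi> :: "nat \<Rightarrow> nat \<Rightarrow> real ^ 3 \<Rightarrow> complex" and \<Delta> :: "nat \<Rightarrow> 'w \<Rightarrow> real"
  assumes "prob_space M"
    and "2 \<le> D"
    and "1 < B" and "needlet_window B b" and "cubature_system s B K \<xi> w"
    and "gaussian_isotropic_spin_field M s C P"
    and "\<And>r. r \<in> {1..D} \<Longrightarrow> gaussian_isotropic_spin_field M s (CN r) (N r)"
    and "independent_signal_noise M D P N"
    and "2 < \<alpha>" and "regular_spectrum s \<alpha> C"
    and "2 < \<gamma>" and "\<And>r. r \<in> {1..D} \<Longrightarrow> regular_spectrum s \<gamma> (CN r)"
  defines "\<psi> \<equiv> spin_needlet s B b \<xi> w"
  defines "\<Delta> \<equiv> (\<lambda>j \<omega>. Gamma_CP D K \<psi> P N j \<omega> - Gamma_AP M D K \<psi> P N j \<omega>)"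
  shows "weak_conv_m
           (\<lambda>j. distr M borel (\<lambda>\<omega>. \<Delta> j \<omega> / sqrt (prob_space.variance M (\<Delta> j))))
           std_normal_distribution \<and>
         (\<lambda>j. prob_space.variance M (\<Delta> j)) \<in> O(\<lambda>j. B powr (2 * (1 - \<gamma>) * real j))"
proof -
  interpret prob_space M by fact
  note clt = difference_clt[OF assms(2-7) assms(8) assms(12,11)]
  show ?thesis
    unfolding \<Delta>_def \<psi>_def by (intro conjI clt)
qed

end
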